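(* Let $(X,d)$ be an extended metric space with bounded geometry, and let $\mathcal{A}$ be a nonzero unital pre-$C^*$-algebra that contains the translation algebra $\mathbb{C}_{\mathrm{u}}(X)$ as a dense $*$-subalgebra. Let $k,n$ be positive integers with $n\ge 2$. Then the following conditions are equivalent: (1) $(X,d)$ is amenable. (2) The algebraic uniform Roe algebra $C^*_{\mathrm{u,alg}}(X)$ is algebraically amenable. (3) $\mathcal{A}$ is a Følner pre-$C^*$-algebra. (4) $\mathcal{A}$ has a tracial state. (5) $M_k(\mathcal{A})$ is not properly infinite. (6) $\mathcal{A}$ does not contain the Leavitt algebra $L(1,n)$ as a unital $*$-subalgebra. (7) $\mathcal{A}$ does not contain the Leavitt algebra $L_\infty$ as a unital $*$-subalgebra. (8) $[1]_0\ne[0]_0$ in the algebraic $K$-group $K_0(\mathcal{A})$.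
   Context: Extended metric spaces: metrics $d\colon X\times X\to[0,\infty]$ may take the value $\infty$. $(X,d)$ has bounded geometry if it is uniformly discrete (there is $C>0$ with $d(x,y)\ge C$ for all $x\ne y$) and $\sup_{x\in X}|B_R(x)|<\infty$ for every $R>0$, where $B_R(x)=\{y: d(x,y)\le R\}$. Amenability of $(X,d)$: for $A\subset X$ and $R>0$ let $\partial_RA=\{x\in X: d(x,A)\le R \text{ and } d(x,X\setminus A)\le R\}$ (the distance to the empty set is $\infty$). $(X,d)$ is amenable if for all $R>0,\varepsilon>0$ there is a finite non-empty $F\subset X$ with $|\partial_RF|\le\varepsilon|F|$. Partial translations: a partial translation on $X$ is a bijection $t\colon A\to B$ between subsets $A,B\subset X$ with $\sup_{x\in A}d(x,t(x))<\infty$. It defines a partial isometry $V_t\in\mathcal{L}(\ell^2(X))$ by $V_t\delta_x=\delta_{t(x)}$ for $x\in A$ and $V_t\delta_x=0$ for $x\notin A$. The translation algebra $\mathbb{C}_{\mathrm{u}}(X)$ is the $*$-subalgebra of $\mathcal{L}(\ell^2(X))$ generated by all $V_t$. The algebraic uniform Roe algebra $C^*_{\mathrm{u,alg}}(X)$ is the unital $*$-subalgebra of $\mathcal{L}(\ell^2(X))$ generated by $\mathbb{C}_{\mathrm{u}}(X)$ and $\ell^\infty(X)$ (diagonal operators). A unital pre-$C^*$-algebra is a unital complex $*$-algebra with a norm satisfying all properties of a $C^*$-norm except possibly completeness. The norm on $\mathcal{A}$ need not restrict to the operator norm of $\mathcal{L}(\ell^2(X))$ on $\mathbb{C}_{\mathrm{u}}(X)$.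 The positive cone is $\mathcal{A}_+=\mathcal{A}\cap\overline{\mathcal{A}}_+$, where $\overline{\mathcal{A}}$ is the $C^*$-completion. A tracial state is a linear functional $\tau$ with $\tau(\mathcal{A}_+)\subset[0,\infty)$, $\tau(1)=1$, $\tau(ab)=\tau(ba)$. Algebraic amenability: a complex algebra $\mathcal{B}$ is (left) algebraically amenable if for every $\varepsilon>0$ and finite $\mathcal{F}\subset\mathcal{B}$ there is a nonzero finite-dimensional linear subspace $W\subset\mathcal{B}$ with $\dim(aW+W)\le(1+\varepsilon)\dim W$ for all $a\in\mathcal{F}$. Følner pre-$C^*$-algebra: there is a net of unital completely positive maps $\varphi_i\colon\mathcal{A}\to M_{k(i)}(\mathbb{C})$ ($k(i)\ge1$) with $\lim_i\|\varphi_i(AB)-\varphi_i(A)\varphi_i(B)\|_{2,\mathrm{tr}}=0$ for all $A,B\in\mathcal{A}$, where $\|F\|_{2,\mathrm{tr}}=\sqrt{\mathrm{tr}(F^*F)}$ and $\mathrm{tr}$ is the normalized trace. Here $\varphi$ is completely positive if for each $m$ the entrywise map $M_m(\mathcal{A})\to M_m(M_{k}(\mathbb{C}))$ maps $M_m(\mathcal{A})_+$ to positive matrices, where $M_m(\mathcal{A})_+=\{(\sum_{l=1}^{r}X_{l,i}^*A_lX_{l,j})_{i,j}: r\in\mathbb{N}, A_l\in\mathcal{A}_+, X_{l,i}\in\mathcal{A}\}$. Properly infinite: idempotents $e,f$ in an algebra $\mathcal{B}$ are equivalent ($e\sim f$) if $e=xy$, $f=yx$ for some $x,y\in\mathcal{B}$.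 A nonzero unital algebra $\mathcal{B}$ is properly infinite if there are mutually orthogonal idempotents $e_1,e_2\in\mathcal{B}$ with $e_1\sim 1\sim e_2$. Leavitt algebras (over $\mathbb{C}$): $L(1,n)$ is the unital algebra generated by $X_1,\dots,X_n,Y_1,\dots,Y_n$ subject to $\sum_{j=1}^nX_jY_j=1$ and $Y_iX_j=\delta_{ij}1$; $L_\infty$ is the unital algebra generated by $X_1,Y_1,X_2,Y_2,\dots$ subject to $Y_jX_i=\delta_{i,j}1$. Both are $*$-algebras with the conjugate-linear involution determined by $X_i^*=Y_i$. "Contains as a unital $*$-subalgebra" means there is an injective unital $*$-homomorphism into $\mathcal{A}$. $K_0(\mathcal{A})$ is the usual algebraic $K_0$-group of the unital ring $\mathcal{A}$, and $[e]_0$ is the class of an idempotent $e$. *)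

theory Defs
  imports
    "HOL-Analysis.Inner_Product"
    "HOL-Analysis.Infinite_Sum"
    "HOL-Analysis.Elementary_Metric_Spaces"
    "HOL-Library.Extended_Nonnegative_Real"
    "HOL-Library.Nonpos_Ints"
    "HOL-Library.Poly_Mapping"
    "HOL-Algebra.QuotRing"
    "Jordan_Normal_Form.Schur_Decomposition"
begin

section \<open>Complex *-algebras\<close>

class scaleC =
  fixes scaleC :: "complex \<Rightarrow> 'a \<Rightarrow> 'a"  (infixr \<open>*\<^sub>C\<close> 75)

class complex_vector = scaleC + ab_group_add +
  assumes scaleC_add_right: "c *\<^sub>C (a + b) = c *\<^sub>C a + c *\<^sub>C b"
    and scaleC_add_left: "(c + c') *\<^sub>C a = c *\<^sub>C a + c' *\<^sub>C a"
    and scaleC_scaleC: "c *\<^sub>C c' *\<^sub>C a = (c * c') *\<^sub>C a"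
    and scaleC_one: "1 *\<^sub>C a = a"

global_interpretation complex_vector: vector_space "scaleC :: complex \<Rightarrow> 'a \<Rightarrow> 'a::complex_vector"
  defines csubspace = complex_vector.subspace
    and cspan = complex_vector.span
    and cdependent = complex_vector.dependent
    and crepresentation = complex_vector.representation
    and cextend_basis = complex_vector.extend_basis
    and cdim = complex_vector.dim
  by unfold_locales (simp_all add: scaleC_add_right scaleC_add_left scaleC_scaleC scaleC_one)

definition clinear :: "('a::complex_vector \<Rightarrow> 'b::complex_vector) \<Rightarrow> bool"
  where "clinear = Vector_Spaces.linear scaleC scaleC"

class adjoint =
  fixes adj :: "'a \<Rightarrow> 'a"

class complex_star_algebra = complex_vector + ring_1 + adjoint +
  assumes mult_scaleC_left: "(c *\<^sub>C a) * b = c *\<^sub>C (a * b)"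
    and mult_scaleC_right: "a * (c *\<^sub>C b) = c *\<^sub>C (a * b)"
    and adj_adj: "adj (adj a) = a"
    and adj_add: "adj (a + b) = adj a + adj b"
    and adj_scaleC: "adj (c *\<^sub>C a) = cnj c *\<^sub>C adj a"
    and adj_mult: "adj (a * b) = adj b * adj a"

instantiation complex :: complex_vector
begin
definition scaleC_complex :: "complex \<Rightarrow> complex \<Rightarrow> complex" where "scaleC_complex c z = c * z"
instance by standard (simp_all add: scaleC_complex_def algebra_simps)
end

text \<open>\<open>real_normed_algebra_1\<close> contributes the norm axioms, \<open>norm (a * b) \<le> norm a * norm b\<close>,
  \<open>0 \<noteq> 1\<close> and \<open>norm 1 = 1\<close>; the last one follows from the C*-identity
  in a nonzero algebra.\<close>

class pre_cstar_algebra = complex_star_algebra + real_normed_algebra_1 +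
  assumes scaleR_scaleC: "scaleR r a = complex_of_real r *\<^sub>C a"
    and norm_scaleC: "norm (c *\<^sub>C a) = cmod c * norm a"
    and cstar_identity: "norm (adj a * a) = (norm a)\<^sup>2"

class cstar_algebra = pre_cstar_algebra + complete_space

section \<open>Square-summable functions\<close>

typedef 'x ell2 = "{f :: 'x \<Rightarrow> complex. (\<lambda>x. (cmod (f x))\<^sup>2) summable_on UNIV}"
  morphisms ell2_fun Abs_ell2
  by (rule exI[of _ "\<lambda>_. 0"]) simp

setup_lifting type_definition_ell2

lemma ell2_mult_abs_summable:
  fixes f g :: "'x \<Rightarrow> complex"
  assumes "(\<lambda>x. (cmod (f x))\<^sup>2) summable_on UNIV" "(\<lambda>x. (cmod (g x))\<^sup>2) summable_on UNIV"
  shows "(\<lambda>x. norm (f x) * norm (g x)) summable_on UNIV"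
proof (rule summable_on_comparison_test)
  show "(\<lambda>x. (cmod (f x))\<^sup>2 + (cmod (g x))\<^sup>2) summable_on UNIV"
    by (intro summable_on_add assms)
  fix x
  have "2 * (norm (f x) * norm (g x)) \<le> (cmod (f x))\<^sup>2 + (cmod (g x))\<^sup>2"
    using sum_squares_bound[of "norm (f x)" "norm (g x)"] by simp
  moreover have "0 \<le> norm (f x) * norm (g x)" by simp
  ultimately show "norm (f x) * norm (g x) \<le> (cmod (f x))\<^sup>2 + (cmod (g x))\<^sup>2" by linarith
qed auto

instantiation ell2 :: (type) complex_vector
begin

lift_definition zero_ell2 :: "'x ell2" is "\<lambda>_. 0" by simp

lift_definition plus_ell2 :: "'x ell2 \<Rightarrow> 'x ell2 \<Rightarrow> 'x ell2" is "\<lambda>f g x. f x + g x"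
proof -
  fix f g :: "'x \<Rightarrow> complex"
  assume a: "(\<lambda>x. (cmod (f x))\<^sup>2) summable_on UNIV" "(\<lambda>x. (cmod (g x))\<^sup>2) summable_on UNIV"
  show "(\<lambda>x. (cmod (f x + g x))\<^sup>2) summable_on UNIV"
  proof (rule summable_on_comparison_test)
    show "(\<lambda>x. 2 * ((cmod (f x))\<^sup>2 + (cmod (g x))\<^sup>2)) summable_on UNIV"
      by (intro summable_on_cmult_right summable_on_add a)
    fix x
    have "(cmod (f x + g x))\<^sup>2 \<le> (cmod (f x) + cmod (g x))\<^sup>2"
      by (intro power_mono norm_triangle_ineq) auto
    also have "\<dots> \<le> 2 * ((cmod (f x))\<^sup>2 + (cmod (g x))\<^sup>2)"
      using sum_squares_bound[of "cmod (f x)" "cmod (g x)"] by (simp add: power2_sum)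
    finally show "(cmod (f x + g x))\<^sup>2 \<le> 2 * ((cmod (f x))\<^sup>2 + (cmod (g x))\<^sup>2)" .
  qed auto
qed

lift_definition uminus_ell2 :: "'x ell2 \<Rightarrow> 'x ell2" is "\<lambda>f x. - f x" by simp

definition minus_ell2 :: "'x ell2 \<Rightarrow> 'x ell2 \<Rightarrow> 'x ell2" where "minus_ell2 f g = f + - g"

lift_definition scaleC_ell2 :: "complex \<Rightarrow> 'x ell2 \<Rightarrow> 'x ell2" is "\<lambda>c f x. c * f x"
  by (auto simp: norm_mult power_mult_distrib intro!: summable_on_cmult_right)

instance
  by standard (unfold minus_ell2_def, (transfer, auto simp: algebra_simps)+)

end

definition cinner :: "'x ell2 \<Rightarrow> 'x ell2 \<Rightarrow> complex"
  where "cinner f g = (\<Sum>\<^sub>\<infinity>x. cnj (ell2_fun f x) * ell2_fun g x)"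

lemma cinner_abs_summable: "(\<lambda>x. norm (cnj (ell2_fun f x) * ell2_fun g x)) summable_on UNIV"
  using ell2_mult_abs_summable[OF ell2_fun[of f, simplified] ell2_fun[of g, simplified]]
  by (simp add: norm_mult)

lemma cinner_summable: "(\<lambda>x. cnj (ell2_fun f x) * ell2_fun g x) summable_on UNIV"
  using cinner_abs_summable by (rule abs_summable_summable)

lemma cinner_add_left: "cinner (f + f') g = cinner f g + cinner f' g"
  unfolding cinner_def
  by (subst infsum_add[symmetric, OF cinner_summable cinner_summable])
     (simp add: plus_ell2.rep_eq algebra_simps)

lemma cinner_add_right: "cinner g (f + f') = cinner g f + cinner g f'"
  unfolding cinner_def
  by (subst infsum_add[symmetric, OF cinner_summable cinner_summable])
     (simp add: plus_ell2.rep_eq algebra_simps)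

lemma cinner_scaleC_left: "cinner (c *\<^sub>C f) g = cnj c * cinner f g"
  unfolding cinner_def
  by (simp add: scaleC_ell2.rep_eq mult.assoc infsum_cmult_right')

lemma cinner_scaleC_right: "cinner f (c *\<^sub>C g) = c * cinner f g"
  unfolding cinner_def
  by (simp add: scaleC_ell2.rep_eq mult.left_commute infsum_cmult_right')

lemma cinner_commute: "cinner g f = cnj (cinner f g)"
  unfolding cinner_def infsum_cnj[symmetric] by (simp add: mult.commute)

lemma cinner_self: "cinner f f = complex_of_real (\<Sum>\<^sub>\<infinity>x. (cmod (ell2_fun f x))\<^sup>2)"
proof -
  have "cinner f f = (\<Sum>\<^sub>\<infinity>x. complex_of_real ((cmod (ell2_fun f x))\<^sup>2))"
    by (simp add: cinner_def complex_norm_square mult.commute del: of_real_power)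
  also have "\<dots> = complex_of_real (\<Sum>\<^sub>\<infinity>x. (cmod (ell2_fun f x))\<^sup>2)"
    using infsumI[OF has_sum_of_real[OF has_sum_infsum, of "\<lambda>x. (cmod (ell2_fun f x))\<^sup>2" UNIV]] ell2_fun[of f]
    by (simp add: o_def del: of_real_power)
  finally show ?thesis .
qed

lemma ell2_eqI: "(\<And>x. ell2_fun f x = ell2_fun g x) \<Longrightarrow> f = g"
  by (simp add: ell2_fun_inject[symmetric] fun_eq_iff)

instantiation ell2 :: (type) real_inner
begin

definition scaleR_ell2 :: "real \<Rightarrow> 'x ell2 \<Rightarrow> 'x ell2"
  where "scaleR_ell2 r f = complex_of_real r *\<^sub>C f"
definition inner_ell2 :: "'x ell2 \<Rightarrow> 'x ell2 \<Rightarrow> real"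
  where "inner_ell2 f g = Re (cinner f g)"
definition norm_ell2 :: "'x ell2 \<Rightarrow> real"
  where "norm_ell2 f = sqrt (inner f f)"
definition sgn_ell2 :: "'x ell2 \<Rightarrow> 'x ell2"
  where "sgn_ell2 f = inverse (norm f) *\<^sub>R f"
definition dist_ell2 :: "'x ell2 \<Rightarrow> 'x ell2 \<Rightarrow> real"
  where "dist_ell2 f g = norm (f - g)"
definition uniformity_ell2 :: "('x ell2 \<times> 'x ell2) filter"
  where "uniformity_ell2 = (INF e\<in>{0<..}. principal {(x, y). dist x y < e})"
definition open_ell2 :: "'x ell2 set \<Rightarrow> bool"
  where "open_ell2 U \<longleftrightarrow> (\<forall>x\<in>U. \<forall>\<^sub>F (x', y) in uniformity. x' = x \<longrightarrow> y \<in> U)"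

instance
proof
  fix f g h :: "'x ell2" and r s :: real
  show "r *\<^sub>R (f + g) = r *\<^sub>R f + r *\<^sub>R g" "(r + s) *\<^sub>R f = r *\<^sub>R f + s *\<^sub>R f"
    "r *\<^sub>R s *\<^sub>R f = (r * s) *\<^sub>R f" "1 *\<^sub>R f = f"
    by (simp_all add: scaleR_ell2_def scaleC_add_right scaleC_add_left scaleC_scaleC scaleC_one)
  show "inner f g = inner g f"
    unfolding inner_ell2_def by (subst cinner_commute) simp
  show "inner (f + g) h = inner f h + inner g h"
    by (simp add: inner_ell2_def cinner_add_left)
  show "inner (r *\<^sub>R f) g = r * inner f g"
    by (simp add: inner_ell2_def scaleR_ell2_def cinner_scaleC_left)
  show "0 \<le> inner f f"
    by (simp add: inner_ell2_def cinner_self infsum_nonneg)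
  show "inner f f = 0 \<longleftrightarrow> f = 0"
  proof
    assume "inner f f = 0"
    then have "(\<Sum>\<^sub>\<infinity>x. (cmod (ell2_fun f x))\<^sup>2) = 0"
      by (simp add: inner_ell2_def cinner_self)
    then have "(cmod (ell2_fun f x))\<^sup>2 = 0" for x
      using nonneg_infsum_le_0D[of "\<lambda>x. (cmod (ell2_fun f x))\<^sup>2" UNIV x] ell2_fun[of f] by simp
    then show "f = 0"
      by (intro ell2_eqI) (simp add: zero_ell2.rep_eq)
  qed (simp add: inner_ell2_def cinner_self zero_ell2.rep_eq)
qed (simp_all add: norm_ell2_def sgn_ell2_def dist_ell2_def uniformity_ell2_def open_ell2_def)

end

lemma scaleR_ell2_scaleC: "r *\<^sub>R f = complex_of_real r *\<^sub>C f" for f :: "'x ell2"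
  by (fact scaleR_ell2_def)

lemma cinner_self_norm: "cinner f f = complex_of_real ((norm f)\<^sup>2)"
  by (simp add: norm_ell2_def cinner_self inner_ell2_def infsum_nonneg)

lemma norm_ell2_square: "(norm f)\<^sup>2 = (\<Sum>\<^sub>\<infinity>x. (cmod (ell2_fun f x))\<^sup>2)"
  using cinner_self[of f] unfolding cinner_self_norm of_real_eq_iff .

lemma norm_scaleC_ell2: "norm (c *\<^sub>C f) = cmod c * norm f" for f :: "'x ell2"
proof -
  have "complex_of_real ((norm (c *\<^sub>C f))\<^sup>2) = complex_of_real ((cmod c * norm f)\<^sup>2)"
    unfolding cinner_self_norm[symmetric] power_mult_distrib of_real_mult complex_norm_square
    by (simp add: cinner_scaleC_left cinner_scaleC_right)
  then show ?thesis by (simp del: of_real_power)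
qed

lemma cmod_cinner_le: "cmod (cinner f g) \<le> norm f * norm g"
proof (cases "cinner f g = 0")
  case False
  define c where "c = cinner f g / cmod (cinner f g)"
  have c: "cmod c = 1" using False by (simp add: c_def norm_divide)
  have "inner (c *\<^sub>C f) g = Re (cnj c * cinner f g)"
    by (simp add: inner_ell2_def cinner_scaleC_left)
  also have "cnj c * cinner f g = complex_of_real ((cmod (cinner f g))\<^sup>2) / cmod (cinner f g)"
    by (simp add: c_def complex_norm_square mult.commute del: of_real_power)
  also have "\<dots> = complex_of_real (cmod (cinner f g))"
    using False by (simp add: power2_eq_square)
  finally have "cmod (cinner f g) = inner (c *\<^sub>C f) g" by simp
  also have "\<dots> \<le> norm (c *\<^sub>C f) * norm g" by (rule norm_cauchy_schwarz)
  finally show ?thesis by (simp add: norm_scaleC_ell2 c)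
qed simp

lift_definition ell2_delta :: "'x \<Rightarrow> 'x ell2" is "\<lambda>x y. if y = x then 1 else 0"
proof -
  fix x :: 'x
  have "(\<lambda>y. (cmod (if y = x then 1 else 0))\<^sup>2) summable_on {x}" by simp
  then show "(\<lambda>y. (cmod (if y = x then 1 else 0))\<^sup>2) summable_on UNIV"
    by (rule summable_on_cong_neutral[THEN iffD1, rotated -1]) auto
qed

lemma ell2_fun_sum: "ell2_fun (sum h F) y = (\<Sum>x\<in>F. ell2_fun (h x) y)"
  by (induction F rule: infinite_finite_induct) (simp_all add: zero_ell2.rep_eq plus_ell2.rep_eq)

lemma ell2_fun_diff: "ell2_fun (f - g) x = ell2_fun f x - ell2_fun g x"
  by (subst minus_ell2_def) (simp only: plus_ell2.rep_eq uminus_ell2.rep_eq diff_conv_add_uminus)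

lemma ell2_has_sum_delta: "((\<lambda>x. ell2_fun f x *\<^sub>C ell2_delta x) has_sum f) UNIV"
proof -
  let ?q = "\<lambda>x. (cmod (ell2_fun f x))\<^sup>2"
  have q: "?q summable_on UNIV" using ell2_fun[of f] by simp
  define t where "t F = (\<Sum>x\<in>F. ell2_fun f x *\<^sub>C ell2_delta x)" for F
  have t: "ell2_fun (t F) y = (if y \<in> F then ell2_fun f y else 0)" if "finite F" for F y
    using that by (simp add: t_def ell2_fun_sum scaleC_ell2.rep_eq ell2_delta.rep_eq
        if_distrib[of "\<lambda>z. _ * z"] sum.delta cong: if_cong)
  have n: "(norm (t F - f))\<^sup>2 = infsum ?q UNIV - sum ?q F" if "finite F" for F
  proof -
    have "(norm (t F - f))\<^sup>2 = (\<Sum>\<^sub>\<infinity>x. if x \<in> F then 0 else ?q x)"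
      unfolding norm_ell2_square by (intro infsum_cong) (simp add: ell2_fun_diff t that)
    also have "\<dots> = infsum ?q (UNIV - F)"
      by (rule infsum_cong_neutral) auto
    also have "\<dots> = infsum ?q UNIV - infsum ?q F"
      by (rule infsum_Diff) (use q that in auto)
    finally show ?thesis using that by simp
  qed
  have "((\<lambda>F. infsum ?q UNIV - sum ?q F) \<longlongrightarrow> infsum ?q UNIV - infsum ?q UNIV) (finite_subsets_at_top UNIV)"
    by (intro tendsto_diff tendsto_const) (use q in \<open>simp add: has_sum_infsum has_sum_def[symmetric]\<close>)
  then have "((\<lambda>F. infsum ?q UNIV - sum ?q F) \<longlongrightarrow> 0) (finite_subsets_at_top UNIV)" by simp
  then have "((\<lambda>F. (norm (t F - f))\<^sup>2) \<longlongrightarrow> 0) (finite_subsets_at_top UNIV)"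
    by (rule Lim_transform_eventually)
       (use n in \<open>auto simp: eventually_finite_subsets_at_top_weakI\<close>)
  then have "((\<lambda>F. sqrt ((norm (t F - f))\<^sup>2)) \<longlongrightarrow> sqrt 0) (finite_subsets_at_top UNIV)"
    by (rule tendsto_real_sqrt)
  then have "((\<lambda>F. norm (t F - f)) \<longlongrightarrow> 0) (finite_subsets_at_top UNIV)" by simp
  then have "(t \<longlongrightarrow> f) (finite_subsets_at_top UNIV)"
    by (simp add: tendsto_iff dist_norm)
  then show ?thesis unfolding has_sum_def t_def[abs_def] .
qed

section \<open>Bounded operators on \<open>\<ell>\<^sup>2(X)\<close>\<close>

typedef 'x ell2_op = "{T :: 'x ell2 \<Rightarrow> 'x ell2. bounded_linear T \<and> (\<forall>c f. T (c *\<^sub>C f) = c *\<^sub>C T f)}"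
  morphisms op_apply Abs_ell2_op
  by (rule exI[of _ "\<lambda>_. 0"]) (auto simp: complex_vector.scale_zero_right)

setup_lifting type_definition_ell2_op

lemma op_apply_bounded_linear: "bounded_linear (op_apply T)"
  and op_apply_scaleC: "op_apply T (c *\<^sub>C f) = c *\<^sub>C op_apply T f"
  using op_apply[of T] by auto

lemma ell2_op_eqI: "(\<And>f. op_apply S f = op_apply T f) \<Longrightarrow> S = T"
  by (simp add: op_apply_inject[symmetric] fun_eq_iff)

lemma op_apply_diff: "op_apply T (f - g) = op_apply T f - op_apply T g"
  and op_apply_add: "op_apply T (f + g) = op_apply T f + op_apply T g"
  using op_apply_bounded_linear[of T]
  by (simp_all add: bounded_linear.linear linear_diff linear_add)

lemma bounded_linear_scaleC_ell2: "bounded_linear (\<lambda>f :: 'x ell2. c *\<^sub>C f)"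
  by (rule bounded_linear_intro[where K = "cmod c"])
     (simp_all add: scaleC_add_right scaleR_ell2_scaleC scaleC_scaleC norm_scaleC_ell2 mult.commute)

instantiation ell2_op :: (type) "{complex_vector, ring_1}"
begin

lift_definition zero_ell2_op :: "'x ell2_op" is "\<lambda>_. 0"
  by (simp add: complex_vector.scale_zero_right)

lift_definition one_ell2_op :: "'x ell2_op" is "\<lambda>f. f"
  by (simp add: bounded_linear_ident)

lift_definition plus_ell2_op :: "'x ell2_op \<Rightarrow> 'x ell2_op \<Rightarrow> 'x ell2_op" is "\<lambda>S T f. S f + T f"
  by (simp add: bounded_linear_add scaleC_add_right)

lift_definition uminus_ell2_op :: "'x ell2_op \<Rightarrow> 'x ell2_op" is "\<lambda>T f. - T f"
  by (simp add: bounded_linear_minus complex_vector.scale_minus_right)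

definition minus_ell2_op :: "'x ell2_op \<Rightarrow> 'x ell2_op \<Rightarrow> 'x ell2_op" where "minus_ell2_op S T = S + - T"

lift_definition times_ell2_op :: "'x ell2_op \<Rightarrow> 'x ell2_op \<Rightarrow> 'x ell2_op" is "\<lambda>S T f. S (T f)"
  by (simp add: bounded_linear_compose)

lift_definition scaleC_ell2_op :: "complex \<Rightarrow> 'x ell2_op \<Rightarrow> 'x ell2_op" is "\<lambda>c T f. c *\<^sub>C T f"
  by (auto simp: scaleC_scaleC mult.commute intro: bounded_linear_compose[OF bounded_linear_scaleC_ell2])

instance
proof
  fix S T U :: "'x ell2_op" and c c' :: complex
  note [simp] = plus_ell2_op.rep_eq uminus_ell2_op.rep_eq times_ell2_op.rep_eq scaleC_ell2_op.rep_eq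
    zero_ell2_op.rep_eq one_ell2_op.rep_eq op_apply_add
  show "S + T + U = S + (T + U)" "S + T = T + S" "0 + S = S" "- S + S = 0"
    "S * T * U = S * (T * U)" "1 * S = S" "S * 1 = S" "(S + T) * U = S * U + T * U"
    "S * (T + U) = S * T + S * U"
    by (rule ell2_op_eqI, simp add: algebra_simps)+
  show "S - T = S + - T" by (rule minus_ell2_op_def)
  show "c *\<^sub>C (S + T) = c *\<^sub>C S + c *\<^sub>C T" "(c + c') *\<^sub>C S = c *\<^sub>C S + c' *\<^sub>C S"
    "c *\<^sub>C c' *\<^sub>C S = (c * c') *\<^sub>C S" "1 *\<^sub>C S = S"
    by (rule ell2_op_eqI, simp add: scaleC_add_right scaleC_add_left scaleC_scaleC scaleC_one)+
  have "ell2_delta undefined \<noteq> (0 :: 'x ell2)"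
    by (auto simp: ell2_fun_inject[symmetric] ell2_delta.rep_eq zero_ell2.rep_eq fun_eq_iff)
  moreover have "op_apply (0 :: 'x ell2_op) f = 0" "op_apply (1 :: 'x ell2_op) f = f" for f
    by (simp_all add: zero_ell2_op.rep_eq one_ell2_op.rep_eq)
  ultimately show "(0 :: 'x ell2_op) \<noteq> 1" by fastforce
qed

end

lemma cinner_delta_left: "cinner (ell2_delta x) g = ell2_fun g x"
proof -
  have "cinner (ell2_delta x) g = (\<Sum>\<^sub>\<infinity>y\<in>{x}. cnj (ell2_fun (ell2_delta x) y) * ell2_fun g y)"
    unfolding cinner_def by (rule infsum_cong_neutral) (auto simp: ell2_delta.rep_eq)
  then show ?thesis by (simp add: ell2_delta.rep_eq)
qed

lemma bounded_linear_cinner_right: "bounded_linear (cinner f)"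
  by (rule bounded_linear_intro[where K = "norm f"])
     (simp_all add: cinner_add_right scaleR_ell2_scaleC cinner_scaleC_right scaleR_conv_of_real,
       simp add: cmod_cinner_le mult.commute[of "norm _" "norm f"])

lemma ell2_op_adjoint_exists: "\<exists>S :: 'x ell2_op. \<forall>f g. cinner f (op_apply S g) = cinner (op_apply T f) g"
proof -
  let ?s = "\<lambda>g x. cinner (op_apply T (ell2_delta x)) g"
  obtain K where K: "\<And>f. norm (op_apply T f) \<le> norm f * K" "0 < K"
    using bounded_linear.pos_bounded[OF op_apply_bounded_linear[of T]] by auto
  have fin: "(\<Sum>x\<in>F. (cmod (?s g x))\<^sup>2) \<le> (K * norm g)\<^sup>2" if "finite F" for F g
  proof -
    define h where "h = (\<Sum>x\<in>F. ?s g x *\<^sub>C ell2_delta x)"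
    have h: "ell2_fun h y = (if y \<in> F then ?s g y else 0)" for y
      using that by (simp add: h_def ell2_fun_sum scaleC_ell2.rep_eq ell2_delta.rep_eq
          if_distrib[of "\<lambda>z. _ * z"] sum.delta cong: if_cong)
    have "(norm h)\<^sup>2 = (\<Sum>\<^sub>\<infinity>x\<in>F. (cmod (?s g x))\<^sup>2)"
      unfolding norm_ell2_square by (rule infsum_cong_neutral) (auto simp: h)
    then have nh: "(norm h)\<^sup>2 = (\<Sum>x\<in>F. (cmod (?s g x))\<^sup>2)" using that by simp
    have "cinner (op_apply T h) g = (\<Sum>x\<in>F. cnj (?s g x) * ?s g x)"
      unfolding h_def using that
    proof (induction F)
      case empty
      then show ?case
        by (simp add: linear_0[OF bounded_linear.linear[OF op_apply_bounded_linear]]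
            cinner_def zero_ell2.rep_eq)
    qed (simp add: op_apply_add cinner_add_left op_apply_scaleC cinner_scaleC_left)
    also have "\<dots> = complex_of_real ((norm h)\<^sup>2)"
      unfolding nh of_real_sum by (simp add: complex_norm_square mult.commute del: of_real_power)
    finally have "(norm h)\<^sup>2 = cmod (cinner (op_apply T h) g)" by (simp del: of_real_power)
    also have "\<dots> \<le> norm (op_apply T h) * norm g" by (rule cmod_cinner_le)
    also have "\<dots> \<le> norm h * K * norm g" by (intro mult_right_mono K) auto
    finally have "norm h * norm h \<le> norm h * (K * norm g)" by (simp add: power2_eq_square mult.assoc)
    then have "norm h \<le> K * norm g" using K(2)
      by (cases "norm h = 0") (auto simp: mult_le_cancel_left)
    then show ?thesis unfolding nh[symmetric] by (intro power_mono) auto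
  qed
  have sum: "(\<lambda>x. (cmod (?s g x))\<^sup>2) summable_on UNIV" for g
    by (rule nonneg_bdd_above_summable_on) (use fin[of _ g] in \<open>auto intro!: bdd_aboveI2\<close>)
  define S where "S g = Abs_ell2 (?s g)" for g
  have S: "ell2_fun (S g) x = ?s g x" for g x
    unfolding S_def using sum by (simp add: Abs_ell2_inverse)
  have "(norm (S g))\<^sup>2 \<le> (K * norm g)\<^sup>2" for g
    unfolding norm_ell2_square S
    by (rule infsum_le_finite_sums) (use sum fin[of _ g] in auto)
  then have nS: "norm (S g) \<le> norm g * K" for g
    using K(2) by (subst mult.commute, intro power2_le_imp_le[of "norm (S g)"]) auto
  have blS: "bounded_linear S"
    by (rule bounded_linear_intro[where K = K])
       (auto intro!: ell2_eqI nS simp: S plus_ell2.rep_eq cinner_add_right scaleR_ell2_scaleC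
         scaleC_ell2.rep_eq cinner_scaleC_right)
  moreover have "S (c *\<^sub>C g) = c *\<^sub>C S g" for c g
    by (intro ell2_eqI) (simp add: S scaleC_ell2.rep_eq cinner_scaleC_right)
  ultimately have op: "op_apply (Abs_ell2_op S) = S"
    by (intro Abs_ell2_op_inverse) auto
  have "cinner g (op_apply T f) = cinner (S g) f" for f g
  proof -
    have "bounded_linear (\<lambda>f. cinner g (op_apply T f))"
      by (rule bounded_linear_compose[OF bounded_linear_cinner_right op_apply_bounded_linear])
    from has_sum_bounded_linear[OF this ell2_has_sum_delta[of f]]
    have 1: "((\<lambda>x. cinner g (op_apply T (ell2_fun f x *\<^sub>C ell2_delta x))) has_sum cinner g (op_apply T f)) UNIV" .
    from has_sum_bounded_linear[OF bounded_linear_cinner_right ell2_has_sum_delta[of f], of "S g"]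
    have 2: "((\<lambda>x. cinner (S g) (ell2_fun f x *\<^sub>C ell2_delta x)) has_sum cinner (S g) f) UNIV" .
    have "cinner g (op_apply T (ell2_fun f x *\<^sub>C ell2_delta x))
        = cinner (S g) (ell2_fun f x *\<^sub>C ell2_delta x)" for x
    proof -
      have "cinner (S g) (ell2_delta x) = cinner g (op_apply T (ell2_delta x))"
        by (subst cinner_commute, simp add: cinner_delta_left S, subst cinner_commute[of g], simp)
      then show ?thesis by (simp add: op_apply_scaleC cinner_scaleC_right)
    qed
    with 1 have "((\<lambda>x. cinner (S g) (ell2_fun f x *\<^sub>C ell2_delta x)) has_sum cinner g (op_apply T f)) UNIV"
      by simp
    from has_sum_unique[OF this 2] show ?thesis .
  qed
  then have "cinner f (op_apply (Abs_ell2_op S) g) = cinner (op_apply T f) g" for f g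
    unfolding op by (metis cinner_commute)
  then show ?thesis by blast
qed

lemma cinner_ext: "(\<And>f. cinner f g = cinner f h) \<Longrightarrow> g = h"
  by (rule ell2_eqI) (metis cinner_delta_left)

instantiation ell2_op :: (type) adjoint
begin

definition adj_ell2_op :: "'x ell2_op \<Rightarrow> 'x ell2_op"
  where "adj_ell2_op T = (THE S. \<forall>f g. cinner f (op_apply S g) = cinner (op_apply T f) g)"

instance ..

end

lemma ell2_op_adj_eqI:
  assumes "\<And>f g. cinner f (op_apply S g) = cinner (op_apply T f) g"
  shows "adj T = S"
  unfolding adj_ell2_op_def
proof (rule the_equality)
  fix S' assume "\<forall>f g. cinner f (op_apply S' g) = cinner (op_apply T f) g"
  with assms show "S' = S" by (intro ell2_op_eqI cinner_ext) auto
qed (use assms in auto)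

lemma cinner_adj_right: "cinner f (op_apply (adj T) g) = cinner (op_apply T f) g"
  using ell2_op_adjoint_exists[of T] ell2_op_adj_eqI by metis

lemma cinner_adj_left: "cinner (op_apply (adj T) f) g = cinner f (op_apply T g)"
  by (subst cinner_commute, simp add: cinner_adj_right, subst cinner_commute, simp)

instance ell2_op :: (type) complex_star_algebra
proof
  fix S T :: "'x ell2_op" and c :: complex
  show "(c *\<^sub>C S) * T = c *\<^sub>C (S * T)" "S * (c *\<^sub>C T) = c *\<^sub>C (S * T)"
    by (rule ell2_op_eqI, simp add: times_ell2_op.rep_eq scaleC_ell2_op.rep_eq op_apply_scaleC)+
  show "adj (adj S) = S" "adj (S + T) = adj S + adj T" "adj (c *\<^sub>C S) = cnj c *\<^sub>C adj S"
    "adj (S * T) = adj T * adj S"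
    by (rule ell2_op_adj_eqI, simp add: cinner_adj_left cinner_adj_right plus_ell2_op.rep_eq
        cinner_add_left cinner_add_right scaleC_ell2_op.rep_eq cinner_scaleC_left
        cinner_scaleC_right times_ell2_op.rep_eq)+
qed

section \<open>The C*-completion\<close>

lemma norm_adj: "norm (adj a) = norm a" for a :: "'a::pre_cstar_algebra"
proof -
  have *: "norm b \<le> norm (adj b)" for b :: 'a
  proof (cases "norm b = 0")
    case False
    have "norm b * norm b \<le> norm (adj b) * norm b"
      using norm_mult_ineq[of "adj b" b] by (simp add: cstar_identity power2_eq_square)
    with False show ?thesis by simp
  qed simp
  from *[of a] *[of "adj a"] show ?thesis by (simp add: adj_adj)
qed

lemma adj_diff: "adj (a - b) = adj a - adj b" for a b :: "'a::complex_star_algebra"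
  by (metis adj_add add_diff_cancel diff_add_cancel)

lemma scaleC_diff_right: "c *\<^sub>C (a - b) = c *\<^sub>C a - c *\<^sub>C b" for a b :: "'a::complex_vector"
  by (rule complex_vector.scale_right_diff_distrib)

lemma Cauchy_norm_le:
  fixes f :: "nat \<Rightarrow> 'a::real_normed_vector" and g :: "nat \<Rightarrow> 'b::real_normed_vector"
  assumes "Cauchy f" and le: "\<And>m n. norm (g m - g n) \<le> K * norm (f m - f n)"
  shows "Cauchy g"
  unfolding Cauchy_iff
proof (intro allI impI)
  fix e :: real assume e: "0 < e"
  then have "0 < e / (\<bar>K\<bar> + 1)" by simp
  then obtain M where M: "\<And>m n. m \<ge> M \<Longrightarrow> n \<ge> M \<Longrightarrow> norm (f m - f n) < e / (\<bar>K\<bar> + 1)"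
    using assms(1) unfolding Cauchy_iff by meson
  have "norm (g m - g n) < e" if "m \<ge> M" "n \<ge> M" for m n
  proof -
    have "norm (g m - g n) \<le> K * norm (f m - f n)" by (rule le)
    also have "\<dots> \<le> (\<bar>K\<bar> + 1) * norm (f m - f n)" by (intro mult_right_mono) auto
    also have "\<dots> < e" using M[OF that] by (simp add: field_simps)
    finally show ?thesis .
  qed
  then show "\<exists>M. \<forall>m\<ge>M. \<forall>n\<ge>M. norm (g m - g n) < e" by blast
qed

lemma Cauchy_norm_sum_le:
  fixes f g :: "nat \<Rightarrow> 'a::real_normed_vector" and h :: "nat \<Rightarrow> 'b::real_normed_vector"
  assumes f: "Cauchy f" and g: "Cauchy g"
    and le: "\<And>m n. norm (h m - h n) \<le> K * (norm (f m - f n) + norm (g m - g n))"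
  shows "Cauchy h"
proof -
  define L where "L = \<bar>K\<bar> + 1"
  have L: "0 < L" "K \<le> L" unfolding L_def by auto
  show ?thesis unfolding Cauchy_iff
  proof (intro allI impI)
    fix e :: real assume e: "0 < e"
    then have e': "0 < e / (2 * L)" using L by simp
    then obtain M where M: "\<And>m n. m \<ge> M \<Longrightarrow> n \<ge> M \<Longrightarrow> norm (f m - f n) < e / (2 * L)"
      using f unfolding Cauchy_iff by meson
    from e' obtain N where N: "\<And>m n. m \<ge> N \<Longrightarrow> n \<ge> N \<Longrightarrow> norm (g m - g n) < e / (2 * L)"
      using g unfolding Cauchy_iff by meson
    have "norm (h m - h n) < e" if "m \<ge> max M N" "n \<ge> max M N" for m n
    proof -
      have "norm (h m - h n) \<le> K * (norm (f m - f n) + norm (g m - g n))" by (rule le)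
      also have "\<dots> \<le> L * (norm (f m - f n) + norm (g m - g n))"
        using L by (intro mult_right_mono) auto
      also have "\<dots> < L * (e / (2 * L) + e / (2 * L))"
        using M[of m n] N[of m n] that L by (intro mult_strict_left_mono add_strict_mono) auto
      also have "\<dots> = e" using L by (simp add: field_simps)
      finally show ?thesis .
    qed
    then show "\<exists>M. \<forall>m\<ge>M. \<forall>n\<ge>M. norm (h m - h n) < e" by blast
  qed
qed

lemma Cauchy_plus:
  fixes f g :: "nat \<Rightarrow> 'a::real_normed_vector"
  assumes "Cauchy f" "Cauchy g"
  shows "Cauchy (\<lambda>n. f n + g n)"
proof (rule Cauchy_norm_sum_le[OF assms, where K = 1])
  fix m n
  show "norm (f m + g m - (f n + g n)) \<le> 1 * (norm (f m - f n) + norm (g m - g n))"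
    using norm_triangle_ineq[of "f m - f n" "g m - g n"] by (simp add: algebra_simps)
qed

lemma Cauchy_times:
  fixes f g :: "nat \<Rightarrow> 'a::real_normed_algebra"
  assumes "Cauchy f" "Cauchy g"
  shows "Cauchy (\<lambda>n. f n * g n)"
proof -
  from Cauchy_Bseq[OF assms(1)] obtain A where A: "\<And>n. norm (f n) \<le> A" by (auto simp: Bseq_def)
  from Cauchy_Bseq[OF assms(2)] obtain B where B: "\<And>n. norm (g n) \<le> B" by (auto simp: Bseq_def)
  have "0 \<le> A" "0 \<le> B" using A[of 0] B[of 0] norm_ge_zero order_trans by blast+
  show ?thesis
  proof (rule Cauchy_norm_sum_le[OF assms, where K = "max A B"])
    fix m n
    have "f m * g m - f n * g n = (f m - f n) * g m + f n * (g m - g n)"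
      by (simp add: algebra_simps)
    then have "norm (f m * g m - f n * g n) \<le> norm ((f m - f n) * g m) + norm (f n * (g m - g n))"
      by (simp add: norm_triangle_ineq)
    also have "\<dots> \<le> norm (f m - f n) * norm (g m) + norm (f n) * norm (g m - g n)"
      by (intro add_mono norm_mult_ineq)
    also have "\<dots> \<le> norm (f m - f n) * max A B + max A B * norm (g m - g n)"
      using A[of n] B[of m] \<open>0 \<le> A\<close> by (intro add_mono mult_mono) auto
    finally show "norm (f m * g m - f n * g n) \<le> max A B * (norm (f m - f n) + norm (g m - g n))"
      by (simp add: algebra_simps)
  qed
qed

lemma Cauchy_uminus: "Cauchy f \<Longrightarrow> Cauchy (\<lambda>n. - f n)" for f :: "nat \<Rightarrow> 'a::real_normed_vector"
  by (erule Cauchy_norm_le[where K = 1]) (simp add: norm_minus_commute)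

lemma Cauchy_scaleC: "Cauchy f \<Longrightarrow> Cauchy (\<lambda>n. c *\<^sub>C f n)" for f :: "nat \<Rightarrow> 'a::pre_cstar_algebra"
  by (erule Cauchy_norm_le[where K = "cmod c"]) (simp add: scaleC_diff_right[symmetric] norm_scaleC)

lemma Cauchy_adj: "Cauchy f \<Longrightarrow> Cauchy (\<lambda>n. adj (f n))" for f :: "nat \<Rightarrow> 'a::pre_cstar_algebra"
  by (erule Cauchy_norm_le[where K = 1]) (simp add: adj_diff[symmetric] norm_adj)

lemma Cauchy_norm: "Cauchy f \<Longrightarrow> Cauchy (\<lambda>n. norm (f n))" for f :: "nat \<Rightarrow> 'a::real_normed_vector"
  by (erule Cauchy_norm_le[where K = 1]) (simp add: norm_triangle_ineq3)

lemma Cauchy_const: "Cauchy (\<lambda>_::nat. a)" for a :: "'a::real_normed_vector"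
  by (simp add: Cauchy_iff)

definition cauchy_equiv :: "(nat \<Rightarrow> 'a::real_normed_vector) \<Rightarrow> (nat \<Rightarrow> 'a) \<Rightarrow> bool"
  where "cauchy_equiv f g \<longleftrightarrow> Cauchy f \<and> Cauchy g \<and> (\<lambda>n. f n - g n) \<longlonglongrightarrow> 0"

lemma cauchy_equiv_refl: "cauchy_equiv f f \<longleftrightarrow> Cauchy f"
  by (simp add: cauchy_equiv_def)

quotient_type (overloaded) 'a cstar_completion = "nat \<Rightarrow> 'a::pre_cstar_algebra" / partial: cauchy_equiv
proof (rule part_equivpI)
  show "\<exists>f::nat \<Rightarrow> 'a. cauchy_equiv f f"
    by (rule exI[of _ "\<lambda>_. 0"]) (simp add: cauchy_equiv_refl Cauchy_const)
  show "symp (cauchy_equiv :: (nat \<Rightarrow> 'a) \<Rightarrow> _)"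
  proof (rule sympI)
    fix f g :: "nat \<Rightarrow> 'a" assume "cauchy_equiv f g"
    then show "cauchy_equiv g f"
      using tendsto_minus[of "\<lambda>n. f n - g n" 0 sequentially] by (simp add: cauchy_equiv_def)
  qed
  show "transp (cauchy_equiv :: (nat \<Rightarrow> 'a) \<Rightarrow> _)"
  proof (rule transpI)
    fix f g h :: "nat \<Rightarrow> 'a" assume "cauchy_equiv f g" "cauchy_equiv g h"
    then show "cauchy_equiv f h"
      using tendsto_add[of "\<lambda>n. f n - g n" 0 sequentially "\<lambda>n. g n - h n" 0] by (simp add: cauchy_equiv_def)
  qed
qed

lift_definition completion_embed :: "'a::pre_cstar_algebra \<Rightarrow> 'a cstar_completion" is "\<lambda>a _. a"
  by (simp add: cauchy_equiv_refl Cauchy_const)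

instantiation cstar_completion :: (pre_cstar_algebra) "{complex_vector, ring_1, adjoint, real_vector}"
begin

lift_definition zero_cstar_completion :: "'a cstar_completion" is "\<lambda>_. 0"
  by (simp add: cauchy_equiv_refl Cauchy_const)

lift_definition one_cstar_completion :: "'a cstar_completion" is "\<lambda>_. 1"
  by (simp add: cauchy_equiv_refl Cauchy_const)

lift_definition plus_cstar_completion :: "'a cstar_completion \<Rightarrow> 'a cstar_completion \<Rightarrow> 'a cstar_completion"
  is "\<lambda>f g n. f n + g n"
proof -
  fix f f' g g' :: "nat \<Rightarrow> 'a"
  assume a: "cauchy_equiv f f'" "cauchy_equiv g g'"
  then show "cauchy_equiv (\<lambda>n. f n + g n) (\<lambda>n. f' n + g' n)"
    using tendsto_add[of "\<lambda>n. f n - f' n" 0 sequentially "\<lambda>n. g n - g' n" 0]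
    by (auto simp: cauchy_equiv_def Cauchy_plus algebra_simps)
qed

lift_definition uminus_cstar_completion :: "'a cstar_completion \<Rightarrow> 'a cstar_completion" is "\<lambda>f n. - f n"
proof -
  fix f f' :: "nat \<Rightarrow> 'a"
  assume a: "cauchy_equiv f f'"
  then show "cauchy_equiv (\<lambda>n. - f n) (\<lambda>n. - f' n)"
    using tendsto_minus[of "\<lambda>n. f n - f' n" 0 sequentially]
    by (auto simp: cauchy_equiv_def Cauchy_uminus algebra_simps)
qed

definition minus_cstar_completion :: "'a cstar_completion \<Rightarrow> 'a cstar_completion \<Rightarrow> 'a cstar_completion"
  where "minus_cstar_completion x y = x + - y"

lift_definition times_cstar_completion :: "'a cstar_completion \<Rightarrow> 'a cstar_completion \<Rightarrow> 'a cstar_completion"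
  is "\<lambda>f g n. f n * g n"
proof -
  fix f f' g g' :: "nat \<Rightarrow> 'a"
  assume a: "cauchy_equiv f f'" "cauchy_equiv g g'"
  then have C: "Cauchy f" "Cauchy f'" "Cauchy g" "Cauchy g'"
    and f0: "(\<lambda>n. f n - f' n) \<longlonglongrightarrow> 0" and g0: "(\<lambda>n. g n - g' n) \<longlonglongrightarrow> 0"
    by (auto simp: cauchy_equiv_def)
  have "Zfun (\<lambda>n. (f n - f' n) * g n) sequentially"
    by (rule bounded_bilinear.Zfun_prod_Bfun[OF bounded_bilinear_mult])
       (use f0 Cauchy_Bseq[OF C(3)] in \<open>auto simp: tendsto_Zfun_iff\<close>)
  moreover have "Zfun (\<lambda>n. f' n * (g n - g' n)) sequentially"
    by (rule bounded_bilinear.Bfun_prod_Zfun[OF bounded_bilinear_mult])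
       (use g0 Cauchy_Bseq[OF C(2)] in \<open>auto simp: tendsto_Zfun_iff\<close>)
  ultimately have "Zfun (\<lambda>n. (f n - f' n) * g n + f' n * (g n - g' n)) sequentially"
    by (rule Zfun_add)
  then have "(\<lambda>n. f n * g n - f' n * g' n) \<longlonglongrightarrow> 0"
    by (simp add: tendsto_Zfun_iff algebra_simps)
  with C show "cauchy_equiv (\<lambda>n. f n * g n) (\<lambda>n. f' n * g' n)"
    by (simp add: cauchy_equiv_def Cauchy_times)
qed

lift_definition scaleC_cstar_completion :: "complex \<Rightarrow> 'a cstar_completion \<Rightarrow> 'a cstar_completion"
  is "\<lambda>c f n. c *\<^sub>C f n"
proof -
  fix c and f f' :: "nat \<Rightarrow> 'a"
  assume a: "cauchy_equiv f f'"
  then have "(\<lambda>n. cmod c * norm (f n - f' n)) \<longlonglongrightarrow> 0"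
    unfolding cauchy_equiv_def using tendsto_mult_right_zero tendsto_norm_zero by blast
  then have "(\<lambda>n. c *\<^sub>C f n - c *\<^sub>C f' n) \<longlonglongrightarrow> 0"
    by (subst tendsto_norm_zero_iff[symmetric]) (simp add: scaleC_diff_right[symmetric] norm_scaleC)
  with a show "cauchy_equiv (\<lambda>n. c *\<^sub>C f n) (\<lambda>n. c *\<^sub>C f' n)"
    by (auto simp: cauchy_equiv_def Cauchy_scaleC)
qed

definition scaleR_cstar_completion :: "real \<Rightarrow> 'a cstar_completion \<Rightarrow> 'a cstar_completion"
  where "scaleR_cstar_completion r x = complex_of_real r *\<^sub>C x"

lift_definition adj_cstar_completion :: "'a cstar_completion \<Rightarrow> 'a cstar_completion" is "\<lambda>f n. adj (f n)"
proof -
  fix f f' :: "nat \<Rightarrow> 'a"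
  assume a: "cauchy_equiv f f'"
  then have "(\<lambda>n. norm (f n - f' n)) \<longlonglongrightarrow> 0"
    by (auto simp: cauchy_equiv_def tendsto_norm_zero_iff)
  then have "(\<lambda>n. adj (f n) - adj (f' n)) \<longlonglongrightarrow> 0"
    by (subst tendsto_norm_zero_iff[symmetric]) (simp add: adj_diff[symmetric] norm_adj)
  with a show "cauchy_equiv (\<lambda>n. adj (f n)) (\<lambda>n. adj (f' n))"
    by (auto simp: cauchy_equiv_def Cauchy_adj)
qed

instance
proof
  fix x y z :: "'a cstar_completion" and c c' :: complex and r s :: real
  show "x + y + z = x + (y + z)"
    by transfer (simp add: cauchy_equiv_refl Cauchy_plus add.assoc)
  show "x + y = y + x"
    by transfer (simp add: cauchy_equiv_refl Cauchy_plus add.commute)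
  show "0 + x = x" by transfer (simp add: cauchy_equiv_refl)
  show "- x + x = 0" by transfer (simp add: cauchy_equiv_refl Cauchy_const)
  show "x - y = x + - y" by (rule minus_cstar_completion_def)
  show "x * y * z = x * (y * z)"
    by transfer (simp add: cauchy_equiv_refl Cauchy_times mult.assoc)
  show "1 * x = x" "x * 1 = x" by (transfer, simp add: cauchy_equiv_refl)+
  show "(x + y) * z = x * z + y * z"
    by transfer (simp add: cauchy_equiv_refl Cauchy_times Cauchy_plus distrib_right)
  show "x * (y + z) = x * y + x * z"
    by transfer (simp add: cauchy_equiv_refl Cauchy_times Cauchy_plus distrib_left)
  show "(0 :: 'a cstar_completion) \<noteq> 1"
    by transfer (simp add: cauchy_equiv_def tendsto_const_iff)
  show cv: "c *\<^sub>C (x + y) = c *\<^sub>C x + c *\<^sub>C y"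
    by transfer (simp add: cauchy_equiv_refl Cauchy_scaleC Cauchy_plus scaleC_add_right)
  show "(c + c') *\<^sub>C x = c *\<^sub>C x + c' *\<^sub>C x"
    by transfer (simp add: cauchy_equiv_refl Cauchy_scaleC Cauchy_plus scaleC_add_left)
  show "c *\<^sub>C c' *\<^sub>C x = (c * c') *\<^sub>C x"
    by transfer (simp add: cauchy_equiv_refl Cauchy_scaleC scaleC_scaleC)
  show "1 *\<^sub>C x = x" by transfer (simp add: cauchy_equiv_refl scaleC_one)
  show "r *\<^sub>R (x + y) = r *\<^sub>R x + r *\<^sub>R y" unfolding scaleR_cstar_completion_def
    by transfer (simp add: cauchy_equiv_refl Cauchy_scaleC Cauchy_plus scaleC_add_right)
  show "(r + s) *\<^sub>R x = r *\<^sub>R x + s *\<^sub>R x" unfolding scaleR_cstar_completion_def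
    by transfer (simp add: cauchy_equiv_refl Cauchy_scaleC Cauchy_plus scaleC_add_left)
  show "r *\<^sub>R s *\<^sub>R x = (r * s) *\<^sub>R x" unfolding scaleR_cstar_completion_def
    by transfer (simp add: cauchy_equiv_refl Cauchy_scaleC scaleC_scaleC)
  show "1 *\<^sub>R x = x" unfolding scaleR_cstar_completion_def
    by transfer (simp add: cauchy_equiv_refl scaleC_one)
qed

end

instance cstar_completion :: (pre_cstar_algebra) complex_star_algebra
proof
  fix x y :: "'a cstar_completion" and c :: complex
  show "(c *\<^sub>C x) * y = c *\<^sub>C (x * y)"
    by transfer (simp add: cauchy_equiv_refl Cauchy_scaleC Cauchy_times mult_scaleC_left)
  show "x * (c *\<^sub>C y) = c *\<^sub>C (x * y)"
    by transfer (simp add: cauchy_equiv_refl Cauchy_scaleC Cauchy_times mult_scaleC_right)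
  show "adj (adj x) = x" by transfer (simp add: cauchy_equiv_refl adj_adj)
  show "adj (x + y) = adj x + adj y"
    by transfer (simp add: cauchy_equiv_refl Cauchy_adj Cauchy_plus adj_add)
  show "adj (c *\<^sub>C x) = cnj c *\<^sub>C adj x"
    by transfer (simp add: cauchy_equiv_refl Cauchy_scaleC Cauchy_adj adj_scaleC)
  show "adj (x * y) = adj y * adj x"
    by transfer (simp add: cauchy_equiv_refl Cauchy_adj Cauchy_times adj_mult)
qed

lemma completion_cases:
  obtains f where "Cauchy f" "x = abs_cstar_completion f"
  using Quotient_abs_rep[OF Quotient_cstar_completion, of x] Quotient_rep_reflp[OF Quotient_cstar_completion, of x]
  by (metis cauchy_equiv_refl)

instantiation cstar_completion :: (pre_cstar_algebra) real_normed_algebra_1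
begin

lift_definition norm_cstar_completion :: "'a cstar_completion \<Rightarrow> real" is "\<lambda>f. lim (\<lambda>n. norm (f n))"
proof -
  fix f f' :: "nat \<Rightarrow> 'a"
  assume a: "cauchy_equiv f f'"
  then have "Cauchy (\<lambda>n. norm (f n))"
    unfolding cauchy_equiv_def
    by (simp add: Cauchy_norm)
  then obtain L where L: "(\<lambda>n. norm (f n)) \<longlonglongrightarrow> L"
    using Cauchy_convergent convergent_def by blast
  have "(\<lambda>n. norm (f n) - norm (f' n)) \<longlonglongrightarrow> 0"
  proof (rule tendsto_0_le[where K = 1])
    show "\<forall>\<^sub>F n in sequentially. norm (norm (f n) - norm (f' n)) \<le> norm (f n - f' n) * 1"
      by (simp add: norm_triangle_ineq3)
    show "(\<lambda>n. f n - f' n) \<longlonglongrightarrow> 0"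
      using a by (simp add: cauchy_equiv_def)
  qed
  from tendsto_diff[OF L this] have "(\<lambda>n. norm (f' n)) \<longlonglongrightarrow> L" by simp
  with L show "lim (\<lambda>n. norm (f n)) = lim (\<lambda>n. norm (f' n))" by (simp add: limI)
qed

definition sgn_cstar_completion :: "'a cstar_completion \<Rightarrow> 'a cstar_completion"
  where "sgn_cstar_completion x = inverse (norm x) *\<^sub>R x"
definition dist_cstar_completion :: "'a cstar_completion \<Rightarrow> 'a cstar_completion \<Rightarrow> real"
  where "dist_cstar_completion x y = norm (x - y)"
definition uniformity_cstar_completion :: "('a cstar_completion \<times> 'a cstar_completion) filter"
  where "uniformity_cstar_completion = (INF e\<in>{0<..}. principal {(x, y). dist x y < e})"
definition open_cstar_completion :: "'a cstar_completion set \<Rightarrow> bool"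
  where "open_cstar_completion U \<longleftrightarrow> (\<forall>x\<in>U. \<forall>\<^sub>F (x', y) in uniformity. x' = x \<longrightarrow> y \<in> U)"

instance
proof
  have completion_norm_tendsto: "(\<lambda>n. norm (f n)) \<longlonglongrightarrow> norm (abs_cstar_completion f)" if "Cauchy f" for f :: "nat \<Rightarrow> 'a"
  proof -
    have "norm (abs_cstar_completion f) = lim (\<lambda>n. norm (f n))"
      using that by (simp add: norm_cstar_completion.abs_eq cauchy_equiv_refl)
    moreover have "Cauchy (\<lambda>n. norm (f n))"
      using that by (simp add: Cauchy_norm)
    ultimately show ?thesis
      by (simp add: Cauchy_convergent convergent_LIMSEQ_iff[symmetric])
  qed
  fix x y :: "'a cstar_completion" and r :: real
  obtain f where f: "Cauchy f" "x = abs_cstar_completion f" by (rule completion_cases)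
  obtain g where g: "Cauchy g" "y = abs_cstar_completion g" by (rule completion_cases)
  note [simp] = cauchy_equiv_refl
  note F = completion_norm_tendsto[OF f(1), folded f(2)]
  note G = completion_norm_tendsto[OF g(1), folded g(2)]
  show "r *\<^sub>R x * y = r *\<^sub>R (x * y)" "x * r *\<^sub>R y = r *\<^sub>R (x * y)"
    by (simp_all add: scaleR_cstar_completion_def mult_scaleC_left mult_scaleC_right)
  show "norm x = 0 \<longleftrightarrow> x = 0"
  proof
    assume "norm x = 0"
    with F have "f \<longlonglongrightarrow> 0" by (simp add: tendsto_norm_zero_iff)
    then have "cauchy_equiv f (\<lambda>_. 0)" using f by (simp add: cauchy_equiv_def Cauchy_const)
    then show "x = 0" unfolding f zero_cstar_completion_def
      using Quotient_rel_abs[OF Quotient_cstar_completion] by blast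
  next
    assume "x = 0"
    moreover have "norm (0 :: 'a cstar_completion) = 0" by transfer (simp add: limI)
    ultimately show "norm x = 0" by simp
  qed
  have "x + y = abs_cstar_completion (\<lambda>n. f n + g n)"
    using f g by (simp add: plus_cstar_completion.abs_eq)
  from completion_norm_tendsto[OF Cauchy_plus[OF f(1) g(1)], folded this]
  show "norm (x + y) \<le> norm x + norm y"
    by (rule LIMSEQ_le[OF _ tendsto_add[OF F G]]) (auto intro: norm_triangle_ineq)
  have "x * y = abs_cstar_completion (\<lambda>n. f n * g n)"
    using f g by (simp add: times_cstar_completion.abs_eq)
  from completion_norm_tendsto[OF Cauchy_times[OF f(1) g(1)], folded this]
  show "norm (x * y) \<le> norm x * norm y"
    by (rule LIMSEQ_le[OF _ tendsto_mult[OF F G]]) (auto intro: norm_mult_ineq)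
  have "r *\<^sub>R x = abs_cstar_completion (\<lambda>n. complex_of_real r *\<^sub>C f n)"
    using f by (simp add: scaleR_cstar_completion_def scaleC_cstar_completion.abs_eq)
  from completion_norm_tendsto[OF Cauchy_scaleC[OF f(1)], of "complex_of_real r", folded this]
  show "norm (r *\<^sub>R x) = \<bar>r\<bar> * norm x"
    using tendsto_mult[OF tendsto_const F, of "\<bar>r\<bar>"] LIMSEQ_unique by (simp add: norm_scaleC) blast
  show "norm (1 :: 'a cstar_completion) = 1" by transfer (simp add: limI)
qed (simp_all add: sgn_cstar_completion_def dist_cstar_completion_def uniformity_cstar_completion_def
      open_cstar_completion_def)

end

lemma completion_norm_tendsto:
  assumes "Cauchy f"
  shows "(\<lambda>n. norm (f n)) \<longlonglongrightarrow> norm (abs_cstar_completion f)"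
proof -
  have "norm (abs_cstar_completion f) = lim (\<lambda>n. norm (f n))"
    using assms by (simp add: norm_cstar_completion.abs_eq cauchy_equiv_refl)
  moreover have "Cauchy (\<lambda>n. norm (f n))"
    using assms by (simp add: Cauchy_norm)
  ultimately show ?thesis
    by (simp add: Cauchy_convergent convergent_LIMSEQ_iff[symmetric])
qed

lemma completion_embed_add: "completion_embed (a + b) = completion_embed a + completion_embed b"
  by transfer (simp add: cauchy_equiv_refl Cauchy_const)

lemma completion_embed_mult: "completion_embed (a * b) = completion_embed a * completion_embed b"
  by transfer (simp add: cauchy_equiv_refl Cauchy_const)

lemma completion_embed_scaleC: "completion_embed (c *\<^sub>C a) = c *\<^sub>C completion_embed a"
  by transfer (simp add: cauchy_equiv_refl Cauchy_const)

lemma completion_embed_adj: "completion_embed (adj a) = adj (completion_embed a)"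
  by transfer (simp add: cauchy_equiv_refl Cauchy_const)

lemma completion_embed_one: "completion_embed 1 = 1"
  by transfer (simp add: cauchy_equiv_refl Cauchy_const)

lemma norm_completion_embed: "norm (completion_embed a) = norm a"
  by transfer (simp add: limI)

lemma completion_embed_diff: "completion_embed (a - b) = completion_embed a - completion_embed b"
  by (metis completion_embed_add add_diff_cancel diff_add_cancel)

lemma completion_embed_tendsto:
  assumes f: "Cauchy f"
  shows "(\<lambda>n. completion_embed (f n)) \<longlonglongrightarrow> abs_cstar_completion f"
  unfolding LIMSEQ_iff
proof (intro allI impI)
  fix e :: real assume "0 < e"
  then obtain M where M: "\<And>m n. m \<ge> M \<Longrightarrow> n \<ge> M \<Longrightarrow> norm (f m - f n) < e / 2"
    using f unfolding Cauchy_iff by (meson half_gt_zero)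
  have "norm (completion_embed (f n) - abs_cstar_completion f) < e" if "n \<ge> M" for n
  proof -
    have "completion_embed (f n) - abs_cstar_completion f = abs_cstar_completion (\<lambda>k. f n + - f k)"
      using f unfolding minus_cstar_completion_def completion_embed.abs_eq
      by (simp add: uminus_cstar_completion.abs_eq plus_cstar_completion.abs_eq cauchy_equiv_refl
          Cauchy_uminus Cauchy_const)
    from completion_norm_tendsto[OF Cauchy_plus[OF Cauchy_const Cauchy_uminus[OF f]], of "f n", folded this]
    have "norm (completion_embed (f n) - abs_cstar_completion f) \<le> e / 2"
      by (rule LIMSEQ_le_const2) (use M[OF that] in \<open>force intro: less_imp_le\<close>)
    with \<open>0 < e\<close> show ?thesis by simp
  qed
  then show "\<exists>N. \<forall>n\<ge>N. norm (completion_embed (f n) - abs_cstar_completion f) < e" by blast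
qed

lemma completion_embed_dense: "closure (range completion_embed) = UNIV"
proof -
  have "x \<in> closure (range completion_embed)" for x :: "'a cstar_completion"
  proof -
    obtain f where f: "Cauchy f" "x = abs_cstar_completion f" by (rule completion_cases)
    from completion_embed_tendsto[OF f(1)] f(2) show ?thesis
      unfolding closure_sequential
      by (auto intro!: exI[of _ "\<lambda>n. completion_embed (f n)"])
  qed
  then show ?thesis by auto
qed

instance cstar_completion :: (pre_cstar_algebra) cstar_algebra
proof
  fix x :: "'a cstar_completion" and r :: real and c :: complex
  obtain f where f: "Cauchy f" "x = abs_cstar_completion f" by (rule completion_cases)
  note [simp] = cauchy_equiv_refl
  note F = completion_norm_tendsto[OF f(1), folded f(2)]
  show "r *\<^sub>R x = complex_of_real r *\<^sub>C x" by (rule scaleR_cstar_completion_def)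
  have "c *\<^sub>C x = abs_cstar_completion (\<lambda>n. c *\<^sub>C f n)"
    using f by (simp add: scaleC_cstar_completion.abs_eq)
  from completion_norm_tendsto[OF Cauchy_scaleC[OF f(1)], of c, folded this]
  show "norm (c *\<^sub>C x) = cmod c * norm x"
    using tendsto_mult[OF tendsto_const F, of "cmod c"] LIMSEQ_unique by (simp add: norm_scaleC) blast
  have "adj x * x = abs_cstar_completion (\<lambda>n. adj (f n) * f n)"
    using f by (simp add: adj_cstar_completion.abs_eq times_cstar_completion.abs_eq Cauchy_adj)
  from completion_norm_tendsto[OF Cauchy_times[OF Cauchy_adj[OF f(1)] f(1)], folded this]
  show "norm (adj x * x) = (norm x)\<^sup>2"
    using tendsto_power[OF F, of 2] LIMSEQ_unique by (simp add: cstar_identity) blast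
next
  fix X :: "nat \<Rightarrow> 'a cstar_completion"
  assume X: "Cauchy X"
  have "\<exists>a. norm (X n - completion_embed a) < inverse (real (Suc n))" for n
  proof -
    obtain f where f: "Cauchy f" "X n = abs_cstar_completion f" by (rule completion_cases)
    from completion_embed_tendsto[OF f(1), folded f(2)]
    obtain k where "norm (completion_embed (f k) - X n) < inverse (real (Suc n))"
      unfolding LIMSEQ_iff by (metis inverse_positive_iff_positive of_nat_0_less_iff zero_less_Suc order_refl)
    then show ?thesis by (metis norm_minus_commute)
  qed
  then obtain a where a: "\<And>n. norm (X n - completion_embed (a n)) < inverse (real (Suc n))"
    by metis
  have "(\<lambda>n. X n - completion_embed (a n)) \<longlonglongrightarrow> 0"
    by (rule tendsto_0_le[OF LIMSEQ_inverse_real_of_nat, where K = 1])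
       (use a in \<open>auto intro!: always_eventually less_imp_le\<close>)
  then have d: "(\<lambda>n. completion_embed (a n) - X n) \<longlonglongrightarrow> 0"
    using tendsto_minus by fastforce
  then have "Cauchy (\<lambda>n. (completion_embed (a n) - X n) + X n)"
    by (intro Cauchy_plus LIMSEQ_imp_Cauchy[OF d] X)
  then have "Cauchy (\<lambda>n. completion_embed (a n))" by simp
  then have "Cauchy a"
    by (rule Cauchy_norm_le[where K = 1]) (simp add: completion_embed_diff[symmetric] norm_completion_embed)
  from tendsto_diff[OF completion_embed_tendsto[OF this] d]
  show "convergent X" by (auto simp: convergent_def)
qed

section \<open>Algebraic \<open>K\<^sub>0\<close>\<close>

definition idempotent_mat :: "'a::ring_1 mat \<Rightarrow> bool"
  where "idempotent_mat e \<longleftrightarrow> square_mat e \<and> e * e = e"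

definition idem_mat_equiv :: "'a::ring_1 mat \<Rightarrow> 'a mat \<Rightarrow> bool"
  where "idem_mat_equiv e f \<longleftrightarrow> idempotent_mat e \<and> idempotent_mat f \<and>
    (\<exists>x\<in>carrier_mat (dim_row e) (dim_row f). \<exists>y\<in>carrier_mat (dim_row f) (dim_row e).
      e = x * y \<and> f = y * x)"

definition mat_direct_sum :: "'a::zero mat \<Rightarrow> 'a mat \<Rightarrow> 'a mat"
  where "mat_direct_sum e f =
    four_block_mat e (0\<^sub>m (dim_row e) (dim_col f)) (0\<^sub>m (dim_row f) (dim_col e)) f"

lemma mat_direct_sum_carrier:
  "a \<in> carrier_mat n m \<Longrightarrow> b \<in> carrier_mat n' m' \<Longrightarrow> mat_direct_sum a b \<in> carrier_mat (n + n') (m + m')"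
  by (simp add: mat_direct_sum_def)

lemma mat_direct_sum_mult:
  fixes a b c d :: "'a::ring_1 mat"
  assumes "a \<in> carrier_mat n m" "c \<in> carrier_mat m l" "b \<in> carrier_mat n' m'" "d \<in> carrier_mat m' l'"
  shows "mat_direct_sum a b * mat_direct_sum c d = mat_direct_sum (a * c) (b * d)"
proof -
  have "mat_direct_sum a b * mat_direct_sum c d
      = four_block_mat a (0\<^sub>m n m') (0\<^sub>m n' m) b * four_block_mat c (0\<^sub>m m l') (0\<^sub>m m' l) d"
    using assms by (simp add: mat_direct_sum_def)
  also have "\<dots> = four_block_mat (a * c + 0\<^sub>m n m' * 0\<^sub>m m' l) (a * 0\<^sub>m m l' + 0\<^sub>m n m' * d)
      (0\<^sub>m n' m * c + b * 0\<^sub>m m' l) (0\<^sub>m n' m * 0\<^sub>m m l' + b * d)"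
    by (rule mult_four_block_mat) (use assms in auto)
  also have "\<dots> = mat_direct_sum (a * c) (b * d)"
  proof -
    have "a * c \<in> carrier_mat n l" "b * d \<in> carrier_mat n' l'" using assms by auto
    then show ?thesis using assms by (simp add: mat_direct_sum_def)
  qed
  finally show ?thesis .
qed

lemma idempotent_mat_carrier: "idempotent_mat e \<Longrightarrow> e \<in> carrier_mat (dim_row e) (dim_row e)"
  by (auto simp: idempotent_mat_def)

lemma idempotent_mat_direct_sum:
  assumes "idempotent_mat e" "idempotent_mat f"
  shows "idempotent_mat (mat_direct_sum e f)"
  using assms mat_direct_sum_mult[OF idempotent_mat_carrier[OF assms(1)] idempotent_mat_carrier[OF assms(1)]
      idempotent_mat_carrier[OF assms(2)] idempotent_mat_carrier[OF assms(2)]]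
  by (auto simp: idempotent_mat_def mat_direct_sum_def)

lemma idem_mat_equiv_refl: "idem_mat_equiv e e \<longleftrightarrow> idempotent_mat e"
proof
  assume e: "idempotent_mat e"
  then have "e = e * e" by (simp add: idempotent_mat_def)
  with e idempotent_mat_carrier[OF e] show "idem_mat_equiv e e"
    unfolding idem_mat_equiv_def by blast
qed (simp add: idem_mat_equiv_def)

lemma idem_mat_equiv_trans:
  assumes "idem_mat_equiv e f" "idem_mat_equiv f g"
  shows "idem_mat_equiv e g"
proof -
  let ?n = "dim_row e" and ?m = "dim_row f" and ?l = "dim_row g"
  obtain x y where x: "x \<in> carrier_mat ?n ?m" and y: "y \<in> carrier_mat ?m ?n"
    and e: "e = x * y" and f: "f = y * x"
    using assms(1) unfolding idem_mat_equiv_def by blast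
  obtain z w where z: "z \<in> carrier_mat ?m ?l" and w: "w \<in> carrier_mat ?l ?m"
    and f': "f = z * w" and g: "g = w * z"
    using assms(2) unfolding idem_mat_equiv_def by blast
  have i: "e * e = e" "g * g = g" "idempotent_mat e" "idempotent_mat g"
    using assms by (auto simp: idem_mat_equiv_def idempotent_mat_def)
  have "(x * z) * (w * y) = x * ((z * w) * y)"
    using x y z w by (simp add: assoc_mult_mat[of _ ?n ?m _ ?l _ ?n] assoc_mult_mat[of _ ?m ?l _ ?m _ ?n])
  also have "\<dots> = x * ((y * x) * y)" using f f' by simp
  also have "\<dots> = (x * y) * (x * y)"
    using x y by (simp add: assoc_mult_mat[of _ ?n ?m _ ?n _ ?n] assoc_mult_mat[of _ ?m ?n _ ?m _ ?n])
  finally have 1: "e = (x * z) * (w * y)" using i e by simp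
  have "(w * y) * (x * z) = w * ((y * x) * z)"
    using x y z w by (simp add: assoc_mult_mat[of _ ?l ?m _ ?n _ ?l] assoc_mult_mat[of _ ?m ?n _ ?m _ ?l])
  also have "\<dots> = w * ((z * w) * z)" using f f' by simp
  also have "\<dots> = (w * z) * (w * z)"
    using z w by (simp add: assoc_mult_mat[of _ ?l ?m _ ?l _ ?l] assoc_mult_mat[of _ ?m ?l _ ?m _ ?l])
  finally have 2: "g = (w * y) * (x * z)" using i g by simp
  have "x * z \<in> carrier_mat ?n ?l" "w * y \<in> carrier_mat ?l ?n" using x y z w by auto
  with 1 2 i(3,4) show ?thesis unfolding idem_mat_equiv_def by blast
qed

lemma idem_mat_equiv_sym: "idem_mat_equiv e f \<Longrightarrow> idem_mat_equiv f e"
  unfolding idem_mat_equiv_def by blast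

quotient_type (overloaded) 'a idem_class = "'a::ring_1 mat" / partial: idem_mat_equiv
proof (rule part_equivpI)
  have "idem_mat_equiv (0\<^sub>m 0 0 :: 'a mat) (0\<^sub>m 0 0)"
    unfolding idem_mat_equiv_refl by (simp add: idempotent_mat_def)
  then show "\<exists>e :: 'a mat. idem_mat_equiv e e" by blast
qed (auto intro!: sympI transpI intro: idem_mat_equiv_sym idem_mat_equiv_trans)

lemma mat_direct_sum_equiv:
  assumes "idem_mat_equiv e e'" "idem_mat_equiv f f'"
  shows "idem_mat_equiv (mat_direct_sum e f) (mat_direct_sum e' f')"
proof -
  obtain x y where xy: "x \<in> carrier_mat (dim_row e) (dim_row e')" "y \<in> carrier_mat (dim_row e') (dim_row e)"
    "e = x * y" "e' = y * x"
    using assms(1) unfolding idem_mat_equiv_def by blast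
  obtain z w where zw: "z \<in> carrier_mat (dim_row f) (dim_row f')" "w \<in> carrier_mat (dim_row f') (dim_row f)"
    "f = z * w" "f' = w * z"
    using assms(2) unfolding idem_mat_equiv_def by blast
  have "mat_direct_sum e f = mat_direct_sum x z * mat_direct_sum y w"
    "mat_direct_sum e' f' = mat_direct_sum y w * mat_direct_sum x z"
    by (simp_all only: mat_direct_sum_mult[OF xy(1,2) zw(1,2)] mat_direct_sum_mult[OF xy(2,1) zw(2,1)]
        xy(3,4)[symmetric] zw(3,4)[symmetric])
  moreover have "mat_direct_sum x z \<in> carrier_mat (dim_row (mat_direct_sum e f)) (dim_row (mat_direct_sum e' f'))"
    "mat_direct_sum y w \<in> carrier_mat (dim_row (mat_direct_sum e' f')) (dim_row (mat_direct_sum e f))"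
    using mat_direct_sum_carrier[OF xy(1) zw(1)] mat_direct_sum_carrier[OF xy(2) zw(2)]
    by (simp_all add: mat_direct_sum_def)
  moreover have "idempotent_mat (mat_direct_sum e f)" "idempotent_mat (mat_direct_sum e' f')"
    using assms by (auto simp: idem_mat_equiv_def intro: idempotent_mat_direct_sum)
  ultimately show ?thesis unfolding idem_mat_equiv_def by blast
qed

lemma mat_direct_sum_swap:
  fixes e f :: "'a::ring_1 mat"
  assumes "idempotent_mat e" "idempotent_mat f"
  shows "idem_mat_equiv (mat_direct_sum e f) (mat_direct_sum f e)"
proof -
  obtain n m where c: "e \<in> carrier_mat n n" "f \<in> carrier_mat m m"
    using assms[THEN idempotent_mat_carrier] by blast
  have i: "e * e = e" "f * f = f"
    using assms by (auto simp: idempotent_mat_def)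
  let ?x = "four_block_mat (0\<^sub>m n m) e f (0\<^sub>m m n)"
  let ?y = "four_block_mat (0\<^sub>m m n) f e (0\<^sub>m n m)"
  have "?x * ?y = four_block_mat (0\<^sub>m n m * 0\<^sub>m m n + e * e) (0\<^sub>m n m * f + e * 0\<^sub>m n m)
      (f * 0\<^sub>m m n + 0\<^sub>m m n * e) (f * f + 0\<^sub>m m n * 0\<^sub>m n m)"
    by (rule mult_four_block_mat[OF zero_carrier_mat c zero_carrier_mat zero_carrier_mat c(2,1) zero_carrier_mat])
  also have "\<dots> = mat_direct_sum e f"
    using c i by (simp add: mat_direct_sum_def)
  finally have 1: "mat_direct_sum e f = ?x * ?y" ..
  have "?y * ?x = four_block_mat (0\<^sub>m m n * 0\<^sub>m n m + f * f) (0\<^sub>m m n * e + f * 0\<^sub>m m n)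
      (e * 0\<^sub>m n m + 0\<^sub>m n m * f) (e * e + 0\<^sub>m n m * 0\<^sub>m m n)"
    by (rule mult_four_block_mat[OF zero_carrier_mat c(2,1) zero_carrier_mat zero_carrier_mat c zero_carrier_mat])
  also have "\<dots> = mat_direct_sum f e"
    using c i by (simp add: mat_direct_sum_def)
  finally have 2: "mat_direct_sum f e = ?y * ?x" ..
  have "?x \<in> carrier_mat (n + m) (m + n)" "?y \<in> carrier_mat (m + n) (n + m)"
    using c by (auto intro!: carrier_matI)
  then have "?x \<in> carrier_mat (dim_row (mat_direct_sum e f)) (dim_row (mat_direct_sum f e))"
    "?y \<in> carrier_mat (dim_row (mat_direct_sum f e)) (dim_row (mat_direct_sum e f))"
    using c by (simp_all add: mat_direct_sum_def)
  with 1 2 idempotent_mat_direct_sum[OF assms] idempotent_mat_direct_sum[OF assms(2,1)]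
  show ?thesis unfolding idem_mat_equiv_def by blast
qed

instantiation idem_class :: (ring_1) comm_monoid_add
begin

lift_definition zero_idem_class :: "'a idem_class" is "0\<^sub>m 0 0"
  by (simp add: idem_mat_equiv_refl idempotent_mat_def)

lift_definition plus_idem_class :: "'a idem_class \<Rightarrow> 'a idem_class \<Rightarrow> 'a idem_class" is mat_direct_sum
  by (rule mat_direct_sum_equiv)

instance
proof
  fix a b c :: "'a idem_class"
  show "a + b + c = a + (b + c)"
  proof transfer
    fix a b c :: "'a mat"
    assume "idem_mat_equiv a a" "idem_mat_equiv b b" "idem_mat_equiv c c"
    moreover have "mat_direct_sum (mat_direct_sum a b) c = mat_direct_sum a (mat_direct_sum b c)"
      using assoc_four_block_mat[of a b c] by (simp add: mat_direct_sum_def)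
    ultimately show "idem_mat_equiv (mat_direct_sum (mat_direct_sum a b) c) (mat_direct_sum a (mat_direct_sum b c))"
      by (simp add: mat_direct_sum_equiv)
  qed
  show "a + b = b + a"
    by transfer (simp add: idem_mat_equiv_refl mat_direct_sum_swap)
  show "0 + a = a"
  proof transfer
    fix a :: "'a mat"
    assume "idem_mat_equiv a a"
    moreover have "mat_direct_sum (0\<^sub>m 0 0) a = a"
      by (rule eq_matI) (auto simp: mat_direct_sum_def)
    ultimately show "idem_mat_equiv (mat_direct_sum (0\<^sub>m 0 0) a) a" by simp
  qed
qed

end

quotient_type (overloaded) 'm grothendieck = "'m::comm_monoid_add \<times> 'm"
  / "\<lambda>(a, b) (c, d). \<exists>g. a + d + g = c + b + g"
proof (rule equivpI)
  show "reflp (\<lambda>(a, b) (c, d). \<exists>g :: 'm. a + d + g = c + b + g)"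
    by (auto intro!: reflpI)
  show "symp (\<lambda>(a, b) (c, d). \<exists>g :: 'm. a + d + g = c + b + g)"
  proof (rule sympI, clarify)
    fix a b c d g :: 'm
    assume "a + d + g = c + b + g"
    from this[symmetric] show "\<exists>g. c + b + g = a + d + g" by blast
  qed
  show "transp (\<lambda>(a, b) (c, d). \<exists>g :: 'm. a + d + g = c + b + g)"
  proof (rule transpI, clarify)
    fix a b c d e f g h :: 'm
    assume 1: "a + d + g = c + b + g" and 2: "c + f + h = e + d + h"
    have "a + f + (g + h + d + c) = (a + d + g) + (c + f + h)" by (simp add: ac_simps)
    also have "\<dots> = e + b + (g + h + d + c)" unfolding 1 2 by (simp add: ac_simps)
    finally show "\<exists>g. a + f + g = e + b + g" by blast
  qed
qed

instantiation grothendieck :: (comm_monoid_add) ab_group_add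
begin

lift_definition zero_grothendieck :: "'a grothendieck" is "(0, 0)" .

lift_definition plus_grothendieck :: "'a grothendieck \<Rightarrow> 'a grothendieck \<Rightarrow> 'a grothendieck"
  is "\<lambda>(a, b) (c, d). (a + c, b + d)"
proof clarsimp
  fix a b c d a' b' c' d' g h :: 'a
  assume 1: "a + d + g = c + b + g" and 2: "a' + d' + h = c' + b' + h"
  have "a + a' + (d + d') + (g + h) = (a + d + g) + (a' + d' + h)" by (simp add: ac_simps)
  also have "\<dots> = c + c' + (b + b') + (g + h)" unfolding 1 2 by (simp add: ac_simps)
  finally show "\<exists>g. a + a' + (d + d') + g = c + c' + (b + b') + g" by blast
qed

lift_definition uminus_grothendieck :: "'a grothendieck \<Rightarrow> 'a grothendieck" is "\<lambda>(a, b). (b, a)"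
  by (clarsimp, metis add.commute)

definition minus_grothendieck :: "'a grothendieck \<Rightarrow> 'a grothendieck \<Rightarrow> 'a grothendieck"
  where "minus_grothendieck x y = x + - y"

instance
proof
  fix x y z :: "'a grothendieck"
  show "x + y + z = x + (y + z)" by transfer (auto simp: ac_simps)
  show "x + y = y + x" by transfer (auto simp: ac_simps)
  show "0 + x = x" by transfer auto
  show "- x + x = 0" by transfer (auto simp: ac_simps)
  show "x - y = x + - y" by (rule minus_grothendieck_def)
qed

end

type_synonym 'a K0 = "'a idem_class grothendieck"

definition K0_class_mat :: "'a::ring_1 mat \<Rightarrow> 'a K0"
  where "K0_class_mat e = abs_grothendieck (abs_idem_class e, 0)"

definition K0_class :: "'a::ring_1 \<Rightarrow> 'a K0"
  where "K0_class e = K0_class_mat (mat 1 1 (\<lambda>_. e))"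

section \<open>Extended metric spaces\<close>

definition extended_metric :: "('x \<Rightarrow> 'x \<Rightarrow> ennreal) \<Rightarrow> bool"
  where "extended_metric d \<longleftrightarrow>
    (\<forall>x y. d x y = 0 \<longleftrightarrow> x = y) \<and> (\<forall>x y. d x y = d y x) \<and> (\<forall>x y z. d x z \<le> d x y + d y z)"

definition metric_ball :: "('x \<Rightarrow> 'x \<Rightarrow> ennreal) \<Rightarrow> real \<Rightarrow> 'x \<Rightarrow> 'x set"
  where "metric_ball d R x = {y. d x y \<le> ennreal R}"

definition bounded_geometry :: "('x \<Rightarrow> 'x \<Rightarrow> ennreal) \<Rightarrow> bool"
  where "bounded_geometry d \<longleftrightarrow>
    (\<exists>C::real. C > 0 \<and> (\<forall>x y. x \<noteq> y \<longrightarrow> ennreal C \<le> d x y)) \<and>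
    (\<forall>R::real. R > 0 \<longrightarrow> (\<exists>N. \<forall>x. finite (metric_ball d R x) \<and> card (metric_ball d R x) \<le> N))"

text \<open>The infimum of the empty set in \<^typ>\<open>ennreal\<close> is \<open>\<infinity>\<close>.\<close>

definition dist_to_set :: "('x \<Rightarrow> 'x \<Rightarrow> ennreal) \<Rightarrow> 'x \<Rightarrow> 'x set \<Rightarrow> ennreal"
  where "dist_to_set d x A = (INF y\<in>A. d x y)"

definition metric_boundary :: "('x \<Rightarrow> 'x \<Rightarrow> ennreal) \<Rightarrow> real \<Rightarrow> 'x set \<Rightarrow> 'x set"
  where "metric_boundary d R A = {x. dist_to_set d x A \<le> ennreal R \<and> dist_to_set d x (- A) \<le> ennreal R}"

definition amenable_metric :: "('x \<Rightarrow> 'x \<Rightarrow> ennreal) \<Rightarrow> bool"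
  where "amenable_metric d \<longleftrightarrow>
    (\<forall>R::real. \<forall>\<epsilon>::real. R > 0 \<and> \<epsilon> > 0 \<longrightarrow>
      (\<exists>F. finite F \<and> F \<noteq> {} \<and> finite (metric_boundary d R F) \<and>
        real (card (metric_boundary d R F)) \<le> \<epsilon> * real (card F)))"

section \<open>The translation algebra and the algebraic uniform Roe algebra\<close>

definition partial_translation :: "('x \<Rightarrow> 'x \<Rightarrow> ennreal) \<Rightarrow> 'x set \<Rightarrow> 'x set \<Rightarrow> ('x \<Rightarrow> 'x) \<Rightarrow> bool"
  where "partial_translation d A B t \<longleftrightarrow> bij_betw t A B \<and> (SUP x\<in>A. d x (t x)) < \<infinity>"

definition partial_isometry :: "'x set \<Rightarrow> ('x \<Rightarrow> 'x) \<Rightarrow> 'x ell2_op"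
  where "partial_isometry A t =
    (THE V. \<forall>x. op_apply V (ell2_delta x) = (if x \<in> A then ell2_delta (t x) else 0))"

lemma ell2_op_eq_on_deltaI:
  fixes S T :: "'x ell2_op"
  assumes "\<And>x. op_apply S (ell2_delta x) = op_apply T (ell2_delta x)"
  shows "S = T"
proof (rule ell2_op_eqI)
  fix f :: "'x ell2"
  have "((\<lambda>x. op_apply U (ell2_fun f x *\<^sub>C ell2_delta x)) has_sum op_apply U f) UNIV" for U :: "'x ell2_op"
    by (rule has_sum_bounded_linear[OF op_apply_bounded_linear ell2_has_sum_delta])
  from this[of S] this[of T] show "op_apply S f = op_apply T f"
    unfolding op_apply_scaleC assms by (rule has_sum_unique)
qed

lemma partial_isometry_exists:
  assumes t: "inj_on t A"
  shows "\<exists>V :: 'x ell2_op. \<forall>x. op_apply V (ell2_delta x) = (if x \<in> A then ell2_delta (t x) else 0)"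
proof -
  define v where "v f = (\<lambda>y. if y \<in> t ` A then ell2_fun f (inv_into A t y) else 0)" for f :: "'x ell2"
  have vt: "v f (t x) = ell2_fun f x" if "x \<in> A" for f x
    using that t by (simp add: v_def)
  have sA: "(\<lambda>x. (cmod (ell2_fun f x))\<^sup>2) summable_on A" for f
    by (rule summable_on_subset_banach[OF ell2_fun[of f, simplified]]) simp
  then have "(\<lambda>y. (cmod (v f y))\<^sup>2) summable_on t ` A" for f
    unfolding summable_on_reindex[OF t] o_def
    by (rule summable_on_cong[THEN iffD1, rotated]) (simp add: vt)
  then have "(\<lambda>y. (cmod (v f y))\<^sup>2) summable_on UNIV" for f
    by (rule summable_on_cong_neutral[THEN iffD1, rotated -1]) (auto simp: v_def)
  then have S: "ell2_fun (Abs_ell2 (v f)) = v f" for f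
    by (simp add: Abs_ell2_inverse)
  have "(norm (Abs_ell2 (v f)))\<^sup>2 \<le> (norm f)\<^sup>2" for f
  proof -
    have "(norm (Abs_ell2 (v f)))\<^sup>2 = (\<Sum>\<^sub>\<infinity>y\<in>t ` A. (cmod (v f y))\<^sup>2)"
      unfolding norm_ell2_square S by (rule infsum_cong_neutral) (auto simp: v_def)
    also have "\<dots> = (\<Sum>\<^sub>\<infinity>x\<in>A. (cmod (ell2_fun f x))\<^sup>2)"
      unfolding infsum_reindex[OF t] o_def by (rule infsum_cong) (simp add: vt)
    also have "\<dots> \<le> (norm f)\<^sup>2"
      unfolding norm_ell2_square by (rule infsum_mono_neutral) (use sA ell2_fun[of f] in auto)
    finally show ?thesis .
  qed
  then have n: "norm (Abs_ell2 (v f)) \<le> norm f * 1" for f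
    using power2_le_imp_le[of _ "norm f"] by simp
  have va: "v (f + g) y = v f y + v g y" and vc: "v (c *\<^sub>C f) y = c * v f y" for f g c y
    by (simp_all add: v_def plus_ell2.rep_eq scaleC_ell2.rep_eq)
  have "bounded_linear (\<lambda>f. Abs_ell2 (v f))"
    by (rule bounded_linear_intro[OF _ _ n])
       (auto intro!: ell2_eqI simp: S va vc plus_ell2.rep_eq scaleR_ell2_scaleC scaleC_ell2.rep_eq)
  moreover have "Abs_ell2 (v (c *\<^sub>C f)) = c *\<^sub>C Abs_ell2 (v f)" for c f
    by (rule ell2_eqI) (simp add: S vc scaleC_ell2.rep_eq)
  ultimately have op: "op_apply (Abs_ell2_op (\<lambda>f. Abs_ell2 (v f))) = (\<lambda>f. Abs_ell2 (v f))"
    by (intro Abs_ell2_op_inverse) auto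
  have "Abs_ell2 (v (ell2_delta x)) = (if x \<in> A then ell2_delta (t x) else 0)" for x
  proof (rule ell2_eqI)
    fix y
    show "ell2_fun (Abs_ell2 (v (ell2_delta x))) y = ell2_fun (if x \<in> A then ell2_delta (t x) else 0) y"
      unfolding S using t by (auto simp: v_def ell2_delta.rep_eq zero_ell2.rep_eq inj_on_eq_iff)
  qed
  with op show ?thesis by metis
qed

lemma partial_isometry_delta:
  assumes "inj_on t A"
  shows "op_apply (partial_isometry A t) (ell2_delta x) = (if x \<in> A then ell2_delta (t x) else 0)"
proof -
  have "\<exists>!V. \<forall>x. op_apply V (ell2_delta x) = (if x \<in> A then ell2_delta (t x) else 0)"
    by (rule ex_ex1I[OF partial_isometry_exists[OF assms]], rule ell2_op_eq_on_deltaI) metis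
  from theI'[OF this] show ?thesis unfolding partial_isometry_def by blast
qed

definition star_subalgebra :: "'b::complex_star_algebra set \<Rightarrow> bool"
  where "star_subalgebra S \<longleftrightarrow>
    csubspace S \<and> (\<forall>a\<in>S. \<forall>b\<in>S. a * b \<in> S) \<and> (\<forall>a\<in>S. adj a \<in> S)"

definition unital_star_subalgebra :: "'b::complex_star_algebra set \<Rightarrow> bool"
  where "unital_star_subalgebra S \<longleftrightarrow> star_subalgebra S \<and> 1 \<in> S"

definition translation_algebra :: "('x \<Rightarrow> 'x \<Rightarrow> ennreal) \<Rightarrow> 'x ell2_op set"
  where "translation_algebra d =
    star_subalgebra hull {partial_isometry A t |A B t. partial_translation d A B t}"

definition diagonal_ops :: "'x ell2_op set"
  where "diagonal_ops =
    {D. \<exists>a::'x \<Rightarrow> complex. bounded (range a) \<and> (\<forall>f x. ell2_fun (op_apply D f) x = a x * ell2_fun f x)}"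

definition algebraic_uniform_roe_algebra :: "('x \<Rightarrow> 'x \<Rightarrow> ennreal) \<Rightarrow> 'x ell2_op set"
  where "algebraic_uniform_roe_algebra d =
    unital_star_subalgebra hull (translation_algebra d \<union> diagonal_ops)"

section \<open>Algebraic amenability\<close>

definition algebraically_amenable :: "'b::complex_star_algebra set \<Rightarrow> bool"
  where "algebraically_amenable B \<longleftrightarrow>
    (\<forall>\<epsilon>::real. \<forall>\<F>. \<epsilon> > 0 \<and> finite \<F> \<and> \<F> \<subseteq> B \<longrightarrow>
      (\<exists>W. W \<subseteq> B \<and> csubspace W \<and> (\<exists>S. finite S \<and> cspan S = W) \<and> W \<noteq> {0} \<and>
        (\<forall>a\<in>\<F>. real (cdim {a * w + w' |w w'. w \<in> W \<and> w' \<in> W}) \<le> (1 + \<epsilon>) * real (cdim W))))"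

section \<open>Positivity, tracial states and the Folner property\<close>

definition positive_cone :: "'a::pre_cstar_algebra set"
  where "positive_cone = {a. \<exists>y :: 'a cstar_completion. completion_embed a = adj y * y}"

definition tracial_state :: "('a::pre_cstar_algebra \<Rightarrow> complex) \<Rightarrow> bool"
  where "tracial_state \<tau> \<longleftrightarrow>
    clinear \<tau> \<and> (\<forall>a\<in>positive_cone. \<tau> a \<in> \<real>\<^sub>\<ge>\<^sub>0) \<and> \<tau> 1 = 1 \<and> (\<forall>a b. \<tau> (a * b) = \<tau> (b * a))"

definition matrix_positive_cone :: "nat \<Rightarrow> 'a::pre_cstar_algebra mat set"
  where "matrix_positive_cone m =
    {mat m m (\<lambda>(i, j). \<Sum>l<r. adj (X l i) * A l * X l j) |(r::nat) A X. \<forall>l<r. A l \<in> positive_cone}"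

definition positive_mat :: "nat \<Rightarrow> complex mat \<Rightarrow> bool"
  where "positive_mat n P \<longleftrightarrow> P \<in> carrier_mat n n \<and> (\<forall>v\<in>carrier_vec n. (P *\<^sub>v v) \<bullet>c v \<in> \<real>\<^sub>\<ge>\<^sub>0)"

text \<open>The entrywise map into \<open>M\<^sub>m(M\<^sub>k(\<complex>))\<close>, the latter identified with \<open>M\<^sub>m\<^sub>k(\<complex>)\<close> by erasing
  the inner brackets.\<close>

definition entrywise_mat :: "nat \<Rightarrow> nat \<Rightarrow> ('a \<Rightarrow> complex mat) \<Rightarrow> 'a mat \<Rightarrow> complex mat"
  where "entrywise_mat m k \<phi> M =
    mat (m * k) (m * k) (\<lambda>(p, q). \<phi> (M $$ (p div k, q div k)) $$ (p mod k, q mod k))"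

definition completely_positive :: "nat \<Rightarrow> ('a::pre_cstar_algebra \<Rightarrow> complex mat) \<Rightarrow> bool"
  where "completely_positive k \<phi> \<longleftrightarrow>
    (\<forall>m\<ge>1. \<forall>M\<in>matrix_positive_cone m. positive_mat (m * k) (entrywise_mat m k \<phi> M))"

definition unital_completely_positive :: "nat \<Rightarrow> ('a::pre_cstar_algebra \<Rightarrow> complex mat) \<Rightarrow> bool"
  where "unital_completely_positive k \<phi> \<longleftrightarrow>
    (\<forall>a. \<phi> a \<in> carrier_mat k k) \<and>
    (\<forall>a b. \<phi> (a + b) = \<phi> a + \<phi> b) \<and> (\<forall>c a. \<phi> (c *\<^sub>C a) = c \<cdot>\<^sub>m \<phi> a) \<and>
    \<phi> 1 = 1\<^sub>m k \<and> completely_positive k \<phi>"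

definition normalized_trace :: "complex mat \<Rightarrow> complex"
  where "normalized_trace F = (\<Sum>i<dim_row F. F $$ (i, i)) / of_nat (dim_row F)"

definition norm_2_tr :: "complex mat \<Rightarrow> real"
  where "norm_2_tr F = sqrt (Re (normalized_trace (mat_adjoint F * F)))"

text \<open>Nets are rendered as filters; lemma \<open>folnerI_net\<close> below recovers directed index sets
  of arbitrary type.\<close>

definition folner_pre_cstar_algebra :: "'a::pre_cstar_algebra itself \<Rightarrow> bool"
  where "folner_pre_cstar_algebra _ \<longleftrightarrow>
    (\<exists>N :: (nat \<times> ('a \<Rightarrow> complex mat)) filter. N \<noteq> bot \<and>
      (\<forall>\<^sub>F (k, \<phi>) in N. k \<ge> 1 \<and> unital_completely_positive k \<phi>) \<and>
      (\<forall>a b. ((\<lambda>(k, \<phi>). norm_2_tr (\<phi> (a * b) - \<phi> a * \<phi> b)) \<longlongrightarrow> 0) N))"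

lemma folnerI_net:
  fixes le :: "'i \<Rightarrow> 'i \<Rightarrow> bool" and I :: "'i set" and \<phi> :: "'i \<Rightarrow> 'a::pre_cstar_algebra \<Rightarrow> complex mat"
  assumes I: "I \<noteq> {}" and refl: "\<And>i. i \<in> I \<Longrightarrow> le i i"
    and trans: "\<And>i j l. i \<in> I \<Longrightarrow> j \<in> I \<Longrightarrow> l \<in> I \<Longrightarrow> le i j \<Longrightarrow> le j l \<Longrightarrow> le i l"
    and directed: "\<And>i j. i \<in> I \<Longrightarrow> j \<in> I \<Longrightarrow> \<exists>l\<in>I. le i l \<and> le j l"
    and ucp: "\<And>i. i \<in> I \<Longrightarrow> k i \<ge> 1 \<and> unital_completely_positive (k i) (\<phi> i)"
    and lim: "\<And>a b \<epsilon>. \<epsilon> > 0 \<Longrightarrow> \<exists>i\<in>I. \<forall>j\<in>I. le i j \<longrightarrow> \<bar>norm_2_tr (\<phi> j (a * b) - \<phi> j a * \<phi> j b)\<bar> < \<epsilon>"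
  shows "folner_pre_cstar_algebra TYPE('a)"
proof -
  define G where "G = (INF i\<in>I. principal {j \<in> I. le i j})"
  have ev: "eventually P G \<longleftrightarrow> (\<exists>i\<in>I. \<forall>j\<in>I. le i j \<longrightarrow> P j)" for P
    unfolding G_def
  proof (subst eventually_INF_base[OF I])
    fix i j assume ij: "i \<in> I" "j \<in> I"
    with directed obtain l where l: "l \<in> I" "le i l" "le j l" by blast
    have "{m \<in> I. le l m} \<subseteq> {m \<in> I. le i m} \<inter> {m \<in> I. le j m}"
      using trans ij l by blast
    with l(1) show "\<exists>l\<in>I. principal {m \<in> I. le l m} \<le> inf (principal {m \<in> I. le i m}) (principal {m \<in> I. le j m})"
      by auto
  qed (auto simp: eventually_principal)
  let ?N = "filtermap (\<lambda>i. (k i, \<phi> i)) G"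
  have "G \<noteq> bot" using refl by (auto simp: trivial_limit_def ev)
  then have "?N \<noteq> bot" by (simp add: filtermap_bot_iff)
  moreover have "\<forall>\<^sub>F (k, \<phi>) in ?N. k \<ge> 1 \<and> unital_completely_positive k \<phi>"
    using I ucp by (auto simp: eventually_filtermap ev)
  moreover have "((\<lambda>(k, \<phi>). norm_2_tr (\<phi> (a * b) - \<phi> a * \<phi> b)) \<longlongrightarrow> 0) ?N" for a b
    using lim[of _ a b] by (auto simp: tendsto_iff eventually_filtermap ev)
  ultimately show ?thesis unfolding folner_pre_cstar_algebra_def by blast
qed

section \<open>Proper infiniteness\<close>

definition idempotent_equiv :: "('b, 'm) ring_scheme \<Rightarrow> 'b \<Rightarrow> 'b \<Rightarrow> bool"
  where "idempotent_equiv R e f \<longleftrightarrow>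
    (\<exists>x\<in>carrier R. \<exists>y\<in>carrier R. e = x \<otimes>\<^bsub>R\<^esub> y \<and> f = y \<otimes>\<^bsub>R\<^esub> x)"

definition properly_infinite :: "('b, 'm) ring_scheme \<Rightarrow> bool"
  where "properly_infinite R \<longleftrightarrow> \<one>\<^bsub>R\<^esub> \<noteq> \<zero>\<^bsub>R\<^esub> \<and>
    (\<exists>e\<^sub>1\<in>carrier R. \<exists>e\<^sub>2\<in>carrier R.
      e\<^sub>1 \<otimes>\<^bsub>R\<^esub> e\<^sub>1 = e\<^sub>1 \<and> e\<^sub>2 \<otimes>\<^bsub>R\<^esub> e\<^sub>2 = e\<^sub>2 \<and> e\<^sub>1 \<otimes>\<^bsub>R\<^esub> e\<^sub>2 = \<zero>\<^bsub>R\<^esub> \<and> e\<^sub>2 \<otimes>\<^bsub>R\<^esub> e\<^sub>1 = \<zero>\<^bsub>R\<^esub> \<and>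
      idempotent_equiv R e\<^sub>1 \<one>\<^bsub>R\<^esub> \<and> idempotent_equiv R \<one>\<^bsub>R\<^esub> e\<^sub>2)"

section \<open>*-homomorphisms\<close>

record 'b star_algebra = "'b ring" +
  scal :: "complex \<Rightarrow> 'b \<Rightarrow> 'b"
  star :: "'b \<Rightarrow> 'b"

definition star_algebra_on :: "'b::complex_star_algebra set \<Rightarrow> 'b star_algebra"
  where "star_algebra_on S =
    \<lparr>carrier = S, monoid.mult = (*), one = 1, zero = 0, add = (+), scal = (*\<^sub>C), star = adj\<rparr>"

definition star_hom :: "('b, 'm) star_algebra_scheme \<Rightarrow> ('c, 'n) star_algebra_scheme \<Rightarrow> ('b \<Rightarrow> 'c) set"
  where "star_hom A B = {h \<in> carrier A \<rightarrow> carrier B.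
    (\<forall>x\<in>carrier A. \<forall>y\<in>carrier A. h (x \<oplus>\<^bsub>A\<^esub> y) = h x \<oplus>\<^bsub>B\<^esub> h y \<and> h (x \<otimes>\<^bsub>A\<^esub> y) = h x \<otimes>\<^bsub>B\<^esub> h y) \<and>
    (\<forall>c. \<forall>x\<in>carrier A. h (scal A c x) = scal B c (h x)) \<and>
    (\<forall>x\<in>carrier A. h (star A x) = star B (h x))}"

definition contains_unital_star_subalgebra ::
  "('c, 'n) star_algebra_scheme \<Rightarrow> ('b, 'm) star_algebra_scheme \<Rightarrow> bool"
  where "contains_unital_star_subalgebra B A \<longleftrightarrow>
    (\<exists>h\<in>star_hom A B. h \<one>\<^bsub>A\<^esub> = \<one>\<^bsub>B\<^esub> \<and> inj_on h (carrier A))"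

section \<open>Leavitt algebras\<close>

datatype leavitt_gen = LX nat | LY nat

primrec gen_star :: "leavitt_gen \<Rightarrow> leavitt_gen"
  where "gen_star (LX i) = LY i" | "gen_star (LY i) = LX i"

text \<open>Words form the free monoid, written additively so that finitely supported functions on words
  carry the convolution product of \<^theory>\<open>HOL-Library.Poly_Mapping\<close>; this is the free algebra.\<close>

datatype free_word = FWord (letters: "leavitt_gen list")

instantiation free_word :: monoid_add
begin
definition zero_free_word :: free_word where "zero_free_word = FWord []"
definition plus_free_word :: "free_word \<Rightarrow> free_word \<Rightarrow> free_word"
  where "plus_free_word u v = FWord (letters u @ letters v)"
instance by standard (simp_all add: zero_free_word_def plus_free_word_def)
end

definition word_star :: "free_word \<Rightarrow> free_word"
  where "word_star w = FWord (rev (map gen_star (letters w)))"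

type_synonym free_poly = "free_word \<Rightarrow>\<^sub>0 complex"

definition poly_star :: "free_poly \<Rightarrow> free_poly"
  where "poly_star p = (\<Sum>w\<in>Poly_Mapping.keys p. Poly_Mapping.single (word_star w) (cnj (Poly_Mapping.lookup p w)))"

definition free_gen :: "leavitt_gen \<Rightarrow> free_poly"
  where "free_gen g = Poly_Mapping.single (FWord [g]) 1"

text \<open>The free *-algebra on the generators with indices in \<open>I\<close>.\<close>

definition free_star_algebra :: "nat set \<Rightarrow> free_poly star_algebra"
  where "free_star_algebra I =
    \<lparr>carrier = {p. \<forall>w\<in>Poly_Mapping.keys p. set (letters w) \<subseteq> LX ` I \<union> LY ` I},
     monoid.mult = (*), one = 1, zero = 0, add = (+),
     scal = (\<lambda>c p. Poly_Mapping.single 0 c * p), star = poly_star\<rparr>"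

text \<open>The quotient by a *-invariant two-sided ideal \<open>J\<close>: for each coset \<open>C\<close>, all cosets in the
  unions below coincide.\<close>

definition quotient_star_algebra :: "('b, 'm) star_algebra_scheme \<Rightarrow> 'b set \<Rightarrow> 'b set star_algebra"
  where "quotient_star_algebra R J =
    \<lparr>carrier = carrier (R Quot J), monoid.mult = monoid.mult (R Quot J), one = one (R Quot J),
     zero = zero (R Quot J), add = add (R Quot J),
     scal = (\<lambda>c C. \<Union>p\<in>C. J +>\<^bsub>R\<^esub> scal R c p), star = (\<lambda>C. \<Union>p\<in>C. J +>\<^bsub>R\<^esub> star R p)\<rparr>"

definition leavitt_orthogonality :: "nat set \<Rightarrow> free_poly set"
  where "leavitt_orthogonality I =
    {free_gen (LY i) * free_gen (LX j) - (if i = j then 1 else 0) |i j. i \<in> I \<and> j \<in> I}"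

definition leavitt_algebra :: "nat \<Rightarrow> free_poly set star_algebra"
  where "leavitt_algebra n = (let F = free_star_algebra {..<n} in
    quotient_star_algebra F (genideal F
      (insert ((\<Sum>j<n. free_gen (LX j) * free_gen (LY j)) - 1) (leavitt_orthogonality {..<n}))))"

definition leavitt_algebra_infinity :: "free_poly set star_algebra"
  where "leavitt_algebra_infinity = (let F = free_star_algebra UNIV in
    quotient_star_algebra F (genideal F (leavitt_orthogonality UNIV)))"

end

theory Submission
  imports
    Defs
    "HOL-Analysis.Function_Topology"
    "HOL-Analysis.Convex"
    "HOL-Library.Sublist"
begin

text \<open>If \<open>X\<close> is not amenable, all large neighbourhoods of finite sets at least double, and infinite
  marriage with a Cantor--Bernstein argument splits \<open>X\<close> into two translated copies of itself.
  This gives isometries \<open>s, t\<close> in the translation algebra with \<open>s s\<^sup>* + t t\<^sup>* = 1\<close>, which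
  generate Leavitt algebras and contradict (2)--(8).

  If \<open>X\<close> is amenable, the point is that every C*-norm on the translation algebra dominates the
  operator norm, because \<open>\<delta>\<^sub>c\<close> spans the range of a projection \<open>p\<close> with \<open>p a p \<in> \<complex> p\<close>. So \<open>\<A>\<close> is
  represented on \<open>\<ell>\<^sup>2(X)\<close>. Compressing to Folner sets yields the Folner property and a trace, and
  counting dimensions on Folner sets shows that no \<open>q \<times> p\<close> matrix over \<open>\<A>\<close> with \<open>q < p\<close> has a left
  inverse, which rules out proper infiniteness, Leavitt algebras and \<open>[1]\<^sub>0 = [0]\<^sub>0\<close>.\<close>

section \<open>Infinite marriage and paradoxical decompositions\<close>

text \<open>Two features of the setting shape the arguments. Distances may be infinite, so
  \<open>X\<close> falls into components, and no matrix unit between different components lies in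
  the translation algebra. A Folner set may meet many components, while rank-one operators are
  available only inside one; hence a base point is fixed in every component and estimates are glued
  along orthogonal sums. Moreover the norm of the pre-C*-algebra is arbitrary, and finite
  propagation holds only on the dense translation algebra, so every count on a Folner set carries an
  approximation error, controlled because the operator norm is dominated. Positivity is tested in
  the completion, which is why the representation has to extend there.

  The factor 2 in the expansion comes from the two copies of \<open>X\<close>: the marriage theorem
  is applied to \<open>X \<times> bool\<close>. For the Leavitt algebras injectivity is checked on
  normal words, which are separated by multiplying with isometries on both sides. This needs a tail
  of letters that overlaps no shifted copy of itself; L(1,n) and L_infinity differ in the choice of
  the tail and in the normal form.\<close>

text \<open>Rado's proof: the set \<open>M\<close> of deleted pairs is maximal subject to Hall's condition, and
  submodularity of \<open>J \<mapsto> card (\<Union>j\<in>J. B j)\<close> then leaves only one candidate for each index.\<close>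

lemma hall_infinite:
  fixes A :: "'i \<Rightarrow> 'x set"
  assumes fin: "\<And>i. finite (A i)"
    and hall: "\<And>J. finite J \<Longrightarrow> card J \<le> card (\<Union>j\<in>J. A j)"
  obtains f where "inj f" "\<And>i. f i \<in> A i"
proof -
  define B where "B M i = {x \<in> A i. (i, x) \<notin> M}" for M i
  define H where "H = {M. M \<subseteq> Sigma UNIV A \<and> (\<forall>J. finite J \<longrightarrow> card J \<le> card (\<Union>j\<in>J. B M j))}"
  have finB: "finite (B M i)" for M i using fin by (simp add: B_def)
  have "\<exists>M\<in>H. \<forall>X\<in>H. M \<subseteq> X \<longrightarrow> X = M"
  proof (rule subset_Zorn_nonempty)
    have "B {} = A" by (auto simp: B_def)
    with hall have "{} \<in> H" by (simp add: H_def)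
    then show "H \<noteq> {}" by blast
    fix C assume C: "C \<noteq> {}" "subset.chain H C"
    then have CH: "C \<subseteq> H" by (simp add: subset.chain_def)
    have "card J \<le> card (\<Union>j\<in>J. B (\<Union>C) j)" if J: "finite J" for J
    proof -
      \<comment> \<open>Only finitely many pairs lie over \<open>J\<close>, so a single member of
        the chain already contains all those that were deleted.\<close>
      have "finite (\<Union>C \<inter> Sigma J A)" using J fin by auto
      then obtain M where M: "M \<in> C" "\<Union>C \<inter> Sigma J A \<subseteq> M"
        using finite_subset_Union_chain[OF _ _ C(1,2), of "\<Union>C \<inter> Sigma J A"] by auto
      then have "B (\<Union>C) j = B M j" if "j \<in> J" for j using that by (auto simp: B_def)
      moreover have "M \<in> H" using M CH by auto
      ultimately show ?thesis using J by (simp add: H_def)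
    qed
    then show "\<Union>C \<in> H" using CH by (auto simp: H_def)
  qed
  then obtain M where M: "M \<in> H" and max: "\<And>X. X \<in> H \<Longrightarrow> M \<subseteq> X \<Longrightarrow> X = M" by blast
  have MS: "M \<subseteq> Sigma UNIV A" and hM: "\<And>J. finite J \<Longrightarrow> card J \<le> card (\<Union>j\<in>J. B M j)"
    using M by (auto simp: H_def)
  \<comment> \<open>Deleting one more pair \<open>(i, x)\<close> breaks Hall's condition at some
    finite set. That set must contain \<open>i\<close>, since nothing changes at the other indices;
    removing \<open>i\<close> from it turns the strict inequality into \<open>\<le>\<close>.\<close>
  have rem: "\<exists>J. finite J \<and> card ((\<Union>j\<in>J. B M j) \<union> (B M i - {x})) \<le> card J \<and> i \<notin> J"
    if x: "x \<in> B M i" for i x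
  proof -
    let ?M = "insert (i, x) M"
    have "?M \<notin> H" using max[of ?M] x by (auto simp: B_def)
    moreover have "?M \<subseteq> Sigma UNIV A" using MS x by (auto simp: B_def)
    ultimately obtain J where J: "finite J" "card (\<Union>j\<in>J. B ?M j) < card J"
      by (auto simp: H_def not_le)
    have B': "B ?M j = (if j = i then B M i - {x} else B M j)" for j by (auto simp: B_def)
    have "i \<in> J"
    proof (rule ccontr)
      assume "i \<notin> J"
      then have "(\<Union>j\<in>J. B ?M j) = (\<Union>j\<in>J. B M j)" by (intro SUP_cong) (auto simp: B')
      with J hM show False by fastforce
    qed
    then have "(\<Union>j\<in>J. B ?M j) = (\<Union>j\<in>J - {i}. B M j) \<union> (B M i - {x})"
      by (auto simp: B' split: if_splits)
    with J \<open>i \<in> J\<close> show ?thesis by (intro exI[of _ "J - {i}"]) auto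
  qed
  have single: "x = y" if x: "x \<in> B M i" and y: "y \<in> B M i" for i x y
  proof (rule ccontr)
    assume "x \<noteq> y"
    obtain J where J: "finite J" "card ((\<Union>j\<in>J. B M j) \<union> (B M i - {x})) \<le> card J" "i \<notin> J"
      using rem[OF x] by blast
    obtain K where K: "finite K" "card ((\<Union>j\<in>K. B M j) \<union> (B M i - {y})) \<le> card K" "i \<notin> K"
      using rem[OF y] by blast
    let ?U = "(\<Union>j\<in>J. B M j) \<union> (B M i - {x})" and ?V = "(\<Union>j\<in>K. B M j) \<union> (B M i - {y})"
    have f: "finite ?U" "finite ?V" using J K finB by auto
    \<comment> \<open>Since \<open>x \<noteq> y\<close>, the two punctured sets together recover all
      of \<open>B M i\<close>. So the index \<open>i\<close> counts for the union, and Hall's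
      condition gives one more element than the two bounds on \<open>?U\<close> and
      \<open>?V\<close> allow.\<close>
    have un: "?U \<union> ?V = (\<Union>j\<in>insert i (J \<union> K). B M j)" using \<open>x \<noteq> y\<close> by auto
    have "Suc (card (J \<union> K)) \<le> card (?U \<union> ?V)"
      unfolding un using hM[of "insert i (J \<union> K)"] J K by simp
    moreover have "card (J \<inter> K) \<le> card (?U \<inter> ?V)"
    proof -
      have "card (J \<inter> K) \<le> card (\<Union>j\<in>J \<inter> K. B M j)" using hM J by auto
      also have "\<dots> \<le> card (?U \<inter> ?V)" by (intro card_mono) (use f in auto)
      finally show ?thesis .
    qed
    moreover have "card ?U + card ?V = card (?U \<union> ?V) + card (?U \<inter> ?V)"
      by (rule card_Un_Int[OF f])
    moreover have "card J + card K = card (J \<union> K) + card (J \<inter> K)"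
      by (rule card_Un_Int) (use J K in auto)
    ultimately show False using J(2) K(2) by linarith
  qed
  have ne: "B M i \<noteq> {}" for i using hM[of "{i}"] by auto
  define f where "f i = (SOME x. x \<in> B M i)" for i
  have f: "f i \<in> B M i" for i using ne by (simp add: f_def some_in_eq)
  have "B M i = {f i}" for i using f single by blast
  have "inj f"
  proof (rule injI, rule ccontr)
    fix i j assume ij: "f i = f j" "i \<noteq> j"
    have "(\<Union>k\<in>{i, j}. B M k) = {f i}" using \<open>\<And>i. B M i = {f i}\<close> ij by simp
    then show False using hM[of "{i, j}"] ij by simp
  qed
  moreover have "f i \<in> A i" for i using f[of i] by (simp add: B_def)
  ultimately show ?thesis using that by blast
qed

text \<open>The bijection is pieced together from \<open>f\<close> and the inverse of
  \<open>g\<close> along a Knaster-Tarski fixed point, so each value is one of the two. This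
  pointwise control is what keeps displacements bounded later.\<close>

lemma cantor_bernstein_pointwise:
  fixes f :: "'a \<Rightarrow> 'b" and g :: "'b \<Rightarrow> 'a"
  assumes f: "inj f" and g: "inj g"
  obtains h where "bij h" "\<And>x. h x = f x \<or> g (h x) = x"
proof -
  define \<Phi> where "\<Phi> X = - g ` (- f ` X)" for X
  have "mono \<Phi>" by (auto simp: \<Phi>_def mono_def)
  define X where "X = lfp \<Phi>"
  have X: "X = - g ` (- f ` X)" unfolding X_def by (subst lfp_unfold[OF \<open>mono \<Phi>\<close>]) (simp add: \<Phi>_def)
  define h where "h x = (if x \<in> X then f x else inv_into UNIV g x)" for x
  have out: "\<exists>y. y \<notin> f ` X \<and> x = g y" if "x \<notin> X" for x using that X by blast
  have gh: "g (h x) = x" "h x \<notin> f ` X" if "x \<notin> X" for x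
    using out[OF that] that g by (auto simp: h_def)
  have "inj h"
  proof (rule injI)
    fix x y assume xy: "h x = h y"
    show "x = y"
    proof (cases "x \<in> X"; cases "y \<in> X")
      assume "x \<in> X" "y \<in> X" with xy f show ?thesis by (auto simp: h_def inj_def)
    next
      assume "x \<in> X" "y \<notin> X" with xy gh(2)[of y] show ?thesis by (metis h_def imageI)
    next
      assume "x \<notin> X" "y \<in> X" with xy gh(2)[of x] show ?thesis by (metis h_def imageI)
    next
      assume "x \<notin> X" "y \<notin> X" with xy gh(1) show ?thesis by metis
    qed
  qed
  moreover have "surj h"
  proof -
    have "y \<in> range h" for y
    proof (cases "y \<in> f ` X")
      case True then show ?thesis by (auto simp: h_def)
    next
      case False
      then have "g y \<notin> X" using X g by (auto simp: inj_image_mem_iff)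
      then have "h (g y) = y" using gh(1) g by (auto simp: inj_def)
      then show ?thesis by (metis rangeI)
    qed
    then show ?thesis by auto
  qed
  ultimately have "bij h" by (simp add: bij_def)
  moreover have "h x = f x \<or> g (h x) = x" for x using gh(1) by (cases "x \<in> X") (auto simp: h_def)
  ultimately show ?thesis using that by blast
qed

section \<open>Neighbourhoods of finite sets, and expansion when the Folner condition fails\<close>

definition nbhd :: "('x \<Rightarrow> 'x \<Rightarrow> ennreal) \<Rightarrow> real \<Rightarrow> 'x set \<Rightarrow> 'x set"
  where "nbhd d R F = (\<Union>x\<in>F. metric_ball d R x)"

text \<open>The infimum is not assumed to be attained, so a witness costs some slack; 1 is an
  arbitrary choice.\<close>

lemma dist_to_setD: "\<exists>y\<in>A. d x y \<le> ennreal (R + 1)" if "dist_to_set d x A \<le> ennreal R" "R > 0"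
proof -
  have "dist_to_set d x A < ennreal (R + 1)"
    using that by (intro le_less_trans[OF that(1)]) (simp add: ennreal_less_iff)
  then obtain y where "y \<in> A" "d x y < ennreal (R + 1)"
    unfolding dist_to_set_def Inf_less_iff by auto
  then show ?thesis by (auto intro: less_imp_le)
qed

locale bdd_geometry =
  fixes d :: "'x \<Rightarrow> 'x \<Rightarrow> ennreal"
  assumes emetric: "extended_metric d" and bgeom: "bounded_geometry d"
begin

lemma d_sym: "d x y = d y x" and d_self [simp]: "d x x = 0" and d_triangle: "d x z \<le> d x y + d y z"
  using emetric by (auto simp: extended_metric_def)

lemma d_triangle_le:
  assumes "d x y \<le> ennreal R" "d y z \<le> ennreal S" "R \<ge> 0" "S \<ge> 0"
  shows "d x z \<le> ennreal (R + S)"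
  using d_triangle[of x z y] add_mono[OF assms(1,2)] assms(3,4) by (auto intro: order_trans)

lemma ball_bound: "R > 0 \<Longrightarrow> \<exists>N. \<forall>x. finite (metric_ball d R x) \<and> card (metric_ball d R x) \<le> N"
  using bgeom by (simp add: bounded_geometry_def)

lemma finite_ball: "finite (metric_ball d R x)"
proof -
  have "metric_ball d R x \<subseteq> metric_ball d (max R 1) x"
    by (auto simp: metric_ball_def intro: order_trans ennreal_leI)
  moreover have "finite (metric_ball d (max R 1) x)"
    using ball_bound[of "max R 1"] by (force simp: less_max_iff_disj)
  ultimately show ?thesis by (rule finite_subset)
qed

lemma finite_nbhd: "finite F \<Longrightarrow> finite (nbhd d R F)"
  using finite_ball by (auto simp: nbhd_def)

lemma subset_nbhd: "R \<ge> 0 \<Longrightarrow> F \<subseteq> nbhd d R F"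
  by (force simp: nbhd_def metric_ball_def)

lemma nbhd_nbhd: "R \<ge> 0 \<Longrightarrow> S \<ge> 0 \<Longrightarrow> nbhd d R (nbhd d S F) \<subseteq> nbhd d (S + R) F"
  using d_triangle_le by (fastforce simp: nbhd_def metric_ball_def)

lemma metric_boundary_finite:
  assumes "finite F" "R > 0"
  shows "finite (metric_boundary d R F)"
proof (rule finite_subset)
  show "metric_boundary d R F \<subseteq> nbhd d (R + 1) F"
    using dist_to_setD[OF _ assms(2), of d _ F]
    by (auto simp: metric_boundary_def nbhd_def metric_ball_def d_sym)
qed (use assms finite_nbhd in auto)

lemma nbhd_diff_subset_boundary: "nbhd d R F - F \<subseteq> metric_boundary d R F"
proof
  fix x assume x: "x \<in> nbhd d R F - F"
  then obtain y where "y \<in> F" "d x y \<le> ennreal R"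
    by (auto simp: nbhd_def metric_ball_def d_sym)
  then have "dist_to_set d x F \<le> ennreal R"
    unfolding dist_to_set_def by (rule INF_lower2)
  moreover have "dist_to_set d x (- F) \<le> d x x"
    unfolding dist_to_set_def by (rule INF_lower) (use x in auto)
  ultimately show "x \<in> metric_boundary d R F" by (auto simp: metric_boundary_def)
qed

lemma in_boundaryI:
  assumes "x \<in> F" "y \<notin> F" "d x y \<le> ennreal R"
  shows "x \<in> metric_boundary d R F"
proof -
  have "dist_to_set d x F \<le> d x x"
    unfolding dist_to_set_def by (rule INF_lower) (fact assms)
  moreover have "dist_to_set d x (- F) \<le> d x y"
    unfolding dist_to_set_def by (rule INF_lower) (use assms in auto)
  ultimately show ?thesis using assms(3) by (auto simp: metric_boundary_def)
qed

text \<open>Whatever a neighbourhood adds to \<open>F\<close> lies in the boundary. This is the form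
  of amenability used for counting dimensions.\<close>

lemma card_nbhd_le:
  assumes "amenable_metric d" "R > 0" "\<epsilon> > 0"
  obtains F where "finite F" "F \<noteq> {}" "real (card (nbhd d R F)) \<le> (1 + \<epsilon>) * real (card F)"
proof -
  obtain F where F: "finite F" "F \<noteq> {}" "finite (metric_boundary d R F)"
      "real (card (metric_boundary d R F)) \<le> \<epsilon> * real (card F)"
    using assms unfolding amenable_metric_def by blast
  have "card (nbhd d R F) \<le> card (F \<union> metric_boundary d R F)"
    using F nbhd_diff_subset_boundary[of R F] by (intro card_mono) auto
  also have "\<dots> \<le> card F + card (metric_boundary d R F)" by (rule card_Un_le)
  finally have "real (card (nbhd d R F)) \<le> (1 + \<epsilon>) * real (card F)"
    using F(4) by (simp add: algebra_simps)
  with F that show ?thesis by blast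
qed

text \<open>A failing pair \<open>R\<close>, \<open>\<epsilon>\<close> gives a growth factor
  \<open>q > 1\<close> for one fixed radius; passing to \<open>m\<close>-fold neighbourhoods raises
  it to \<open>q ^ m\<close>, which exceeds 2 for large \<open>m\<close>.\<close>

lemma nonamenable_expansion:
  assumes "\<not> amenable_metric d"
  obtains R where "R > 0" "\<And>F. finite F \<Longrightarrow> 2 * card F \<le> card (nbhd d R F)"
proof -
  obtain R \<epsilon> :: real where R: "R > 0" and \<epsilon>: "\<epsilon> > 0"
    and na: "\<And>F. finite F \<Longrightarrow> F \<noteq> {} \<Longrightarrow> \<epsilon> * real (card F) < real (card (metric_boundary d R F))"
    using assms metric_boundary_finite unfolding amenable_metric_def by (metis not_le)
  define S where "S = R + 1"
  have S: "S > 0" using R by (simp add: S_def)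
  obtain N where N: "\<And>x. card (metric_ball d S x) \<le> N"
    using ball_bound[OF S] by blast
  \<comment> \<open>Every boundary point is within \<open>S\<close> of a point of the neighbourhood
    outside \<open>F\<close>: of itself if it lies outside \<open>F\<close>, otherwise of a witness
    in the complement. So the boundary is covered by \<open>card ?D\<close> balls with at most
    \<open>N\<close> points each. Using \<open>N + 1\<close> keeps the denominator positive.\<close>
  have grow: "(1 + \<epsilon> / (N + 1)) * real (card F) \<le> real (card (nbhd d S F))" if F: "finite F" for F
  proof (cases "F = {}")
    case False
    let ?D = "nbhd d S F - F"
    have "metric_boundary d R F \<subseteq> (\<Union>y\<in>?D. metric_ball d S y)"
    proof
      fix x assume x: "x \<in> metric_boundary d R F"
      obtain y where y: "y \<in> F" "d x y \<le> ennreal S"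
        using x dist_to_setD[OF _ R, of d x F] by (auto simp: metric_boundary_def S_def)
      obtain z where z: "z \<notin> F" "d x z \<le> ennreal S"
        using x dist_to_setD[OF _ R, of d x "- F"] by (auto simp: metric_boundary_def S_def)
      show "x \<in> (\<Union>y\<in>?D. metric_ball d S y)"
      proof (cases "x \<in> F")
        case True
        then have "z \<in> ?D" using z by (auto simp: nbhd_def metric_ball_def)
        moreover have "x \<in> metric_ball d S z" using z by (simp add: metric_ball_def d_sym)
        ultimately show ?thesis by blast
      next
        case False
        then have "x \<in> ?D" using y by (auto simp: nbhd_def metric_ball_def d_sym)
        moreover have "x \<in> metric_ball d S x" by (simp add: metric_ball_def)
        ultimately show ?thesis by blast
      qed
    qed
    then have "card (metric_boundary d R F) \<le> card (\<Union>y\<in>?D. metric_ball d S y)"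
      by (intro card_mono) (use F finite_nbhd finite_ball in auto)
    also have "\<dots> \<le> (\<Sum>y\<in>?D. card (metric_ball d S y))"
      by (rule card_UN_le) (use F finite_nbhd in auto)
    also have "\<dots> \<le> card ?D * N" using sum_bounded_above[of ?D "\<lambda>y. card (metric_ball d S y)" N] N by simp
    also have "\<dots> \<le> card ?D * (N + 1)" by simp
    finally have "real (card (metric_boundary d R F)) \<le> real (card ?D * (N + 1))"
      by (simp only: of_nat_le_iff)
    also have "\<dots> = real (card ?D) * (real N + 1)" by (simp add: algebra_simps)
    finally have "real (card (metric_boundary d R F)) \<le> real (card ?D) * (real N + 1)" .
    then have "\<epsilon> * real (card F) \<le> real (card ?D) * (real N + 1)" using na[OF F False] by linarith
    then have "\<epsilon> / (N + 1) * real (card F) \<le> real (card ?D)" by (simp add: field_simps)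
    moreover have "card ?D + card F = card (nbhd d S F)"
      using card_Diff_subset[OF F, of "nbhd d S F"] subset_nbhd[of S F] S
        card_mono[OF finite_nbhd[OF F, of S], of F] by simp
    ultimately show ?thesis by (simp add: algebra_simps flip: of_nat_add)
  qed simp
  define q where "q = 1 + \<epsilon> / (N + 1)"
  have q: "q > 1" using \<epsilon> by (simp add: q_def)
  have iter: "q ^ m * real (card F) \<le> real (card (nbhd d (real m * S) F))" if "finite F" for m F
  proof (induction m)
    case 0
    then show ?case using card_mono[OF finite_nbhd[OF that, of 0] subset_nbhd[of 0 F]] by simp
  next
    case (Suc m)
    let ?G = "nbhd d (real m * S) F"
    have "q ^ Suc m * real (card F) \<le> q * real (card ?G)" using Suc q by simp
    also have "\<dots> \<le> real (card (nbhd d S ?G))"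
      using grow[OF finite_nbhd[OF that]] by (simp add: q_def)
    also have "\<dots> \<le> real (card (nbhd d (real (Suc m) * S) F))"
      using nbhd_nbhd[of S "real m * S" F] S finite_nbhd[OF that]
      by (auto intro!: card_mono simp: algebra_simps)
    finally show ?case .
  qed
  obtain m where m: "2 < q ^ m" using real_arch_pow[OF q] by blast
  then have "m \<noteq> 0" by (intro notI) simp
  show ?thesis
  proof (rule that)
    show "real m * S > 0" using \<open>m \<noteq> 0\<close> S by simp
    fix F assume F: "finite (F :: 'x set)"
    have "real (2 * card F) \<le> q ^ m * real (card F)" using m by (simp add: mult_right_mono)
    with iter[OF F, of m] show "2 * card F \<le> card (nbhd d (real m * S) F)"
      by (metis of_nat_le_iff order_trans)
  qed
qed

text \<open>Doubling is Hall's condition when \<open>(x, b)\<close> may choose any point of the ball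
  around \<open>x\<close>, so \<open>X \<times> bool\<close> injects into \<open>X\<close>. The map
  \<open>x \<mapsto> (x, False)\<close> injects back without moving points, and Cantor-Bernstein
  yields a bijection of bounded displacement whose two halves are \<open>s\<close> and
  \<open>t\<close>.\<close>

lemma nonamenable_paradoxical:
  assumes "\<not> amenable_metric d"
  obtains s t R where "inj s" "inj t" "range s \<inter> range t = {}" "range s \<union> range t = UNIV"
    "\<And>x. d x (s x) \<le> ennreal R" "\<And>x. d x (t x) \<le> ennreal R"
proof -
  obtain R where R: "R > 0" "\<And>F. finite F \<Longrightarrow> 2 * card F \<le> card (nbhd d R F)"
    using nonamenable_expansion[OF assms] by blast
  obtain \<phi> :: "'x \<times> bool \<Rightarrow> 'x" where \<phi>: "inj \<phi>" "\<And>p. \<phi> p \<in> metric_ball d R (fst p)"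
  proof (rule hall_infinite[of "\<lambda>p :: 'x \<times> bool. metric_ball d R (fst p)"])
    show "finite (metric_ball d R (fst p))" for p :: "'x \<times> bool" by (rule finite_ball)
    fix J :: "('x \<times> bool) set" assume J: "finite J"
    have "card J \<le> card (fst ` J \<times> (UNIV :: bool set))"
      by (intro card_mono finite_cartesian_product) (use J in \<open>auto intro: rev_image_eqI\<close>)
    also have "\<dots> = 2 * card (fst ` J)" by (simp add: card_cartesian_product)
    also have "\<dots> \<le> card (nbhd d R (fst ` J))" using R J by simp
    also have "nbhd d R (fst ` J) = (\<Union>p\<in>J. metric_ball d R (fst p))" by (auto simp: nbhd_def)
    finally show "card J \<le> card (\<Union>p\<in>J. metric_ball d R (fst p))" .
  qed blast
  obtain h where h: "bij h" "\<And>p. h p = \<phi> p \<or> (h p, False) = p"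
    using cantor_bernstein_pointwise[OF \<phi>(1), of "\<lambda>x. (x, False)"] by (auto simp: inj_def)
  have hd: "d (fst p) (h p) \<le> ennreal R" for p
    using h(2)[of p]
  proof
    assume "h p = \<phi> p" with \<phi>(2)[of p] show ?thesis by (simp add: metric_ball_def)
  next
    assume "(h p, False) = p"
    then have "fst p = h p" by (metis fst_conv)
    then show ?thesis by simp
  qed
  show ?thesis
  proof (rule that[of "\<lambda>x. h (x, False)" "\<lambda>x. h (x, True)"])
    show "inj (\<lambda>x. h (x, False))" "inj (\<lambda>x. h (x, True))"
      "range (\<lambda>x. h (x, False)) \<inter> range (\<lambda>x. h (x, True)) = {}"
      using bij_is_inj[OF h(1)] by (auto simp: inj_def)
    show "range (\<lambda>x. h (x, False)) \<union> range (\<lambda>x. h (x, True)) = UNIV"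
    proof -
      have "y \<in> range (\<lambda>x. h (x, False)) \<union> range (\<lambda>x. h (x, True))" for y
      proof -
        obtain x b where "y = h (x, b)" using bij_is_surj[OF h(1)] by (metis surjD surj_pair)
        then show ?thesis by (cases b) auto
      qed
      then show ?thesis by auto
    qed
    show "d x (h (x, False)) \<le> ennreal R" "d x (h (x, True)) \<le> ennreal R" for x
      using hd[of "(x, False)"] hd[of "(x, True)"] by simp_all
  qed
qed

end

section \<open>The Hilbert space and its operators\<close>

lemmas ell2_simps = plus_ell2.rep_eq uminus_ell2.rep_eq ell2_fun_diff scaleC_ell2.rep_eq
  zero_ell2.rep_eq ell2_delta.rep_eq ell2_fun_sum

lemmas op_simps = plus_ell2_op.rep_eq uminus_ell2_op.rep_eq times_ell2_op.rep_eq
  scaleC_ell2_op.rep_eq zero_ell2_op.rep_eq one_ell2_op.rep_eq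

lemma op_apply_zero [simp]: "op_apply T 0 = 0"
  by (rule linear_0[OF bounded_linear.linear[OF op_apply_bounded_linear]])

lemma op_apply_sum: "op_apply T (sum f F) = (\<Sum>x\<in>F. op_apply T (f x))"
  by (rule linear_sum[OF bounded_linear.linear[OF op_apply_bounded_linear]])

lemma sum_op_apply: "op_apply (sum h G) f = (\<Sum>i\<in>G. op_apply (h i) f)"
  by (induction G rule: infinite_finite_induct) (simp_all add: op_simps)

lemma op_apply_minus_op: "op_apply (S - T) f = op_apply S f - op_apply T f"
  unfolding minus_ell2_op_def op_simps by simp

lemma norm_ell2_delta [simp]: "norm (ell2_delta x) = 1"
proof -
  have "complex_of_real ((norm (ell2_delta x))\<^sup>2) = 1"
    unfolding cinner_self_norm[symmetric] cinner_delta_left by (simp add: ell2_simps)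
  then have "(norm (ell2_delta x))\<^sup>2 = 1" by (metis of_real_eq_1_iff)
  then have "norm (ell2_delta x) = 1 \<or> norm (ell2_delta x) = - 1" by (simp add: power2_eq_1_iff)
  then show ?thesis using norm_ge_zero[of "ell2_delta x"] by linarith
qed

lemma scaleC_zero [simp]: "0 *\<^sub>C a = 0" "c *\<^sub>C (0 :: 'a) = 0" for a :: "'a::complex_vector"
  by (simp_all only: complex_vector.scale_zero_left complex_vector.scale_zero_right)

lemma cinner_zero [simp]: "cinner 0 f = 0" "cinner f 0 = 0"
  by (simp_all add: cinner_def ell2_simps)

lemma cinner_sum_right: "cinner f (sum g F) = (\<Sum>x\<in>F. cinner f (g x))"
  by (induction F rule: infinite_finite_induct) (auto simp: cinner_add_right)

lemma cinner_sum_left: "cinner (sum g F) f = (\<Sum>x\<in>F. cinner (g x) f)"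
  by (induction F rule: infinite_finite_induct) (auto simp: cinner_add_left)

lemma cmod_ell2_fun_le: "cmod (ell2_fun f x) \<le> norm f"
  using cmod_cinner_le[of "ell2_delta x" f] by (simp add: cinner_delta_left)

lemma ell2_finite_sum:
  assumes "finite F" "\<And>x. x \<notin> F \<Longrightarrow> ell2_fun f x = 0"
  shows "f = (\<Sum>x\<in>F. ell2_fun f x *\<^sub>C ell2_delta x)"
proof (rule ell2_eqI)
  fix y
  have "(\<Sum>x\<in>F. ell2_fun f x * (if y = x then 1 else 0)) = (if y \<in> F then ell2_fun f y else 0)"
    using assms(1) by (simp add: if_distrib[of "\<lambda>z. _ * z"] sum.delta cong: if_cong)
  then show "ell2_fun f y = ell2_fun (\<Sum>x\<in>F. ell2_fun f x *\<^sub>C ell2_delta x) y"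
    using assms(2) by (simp add: ell2_simps)
qed

lemma ell2_sum_le_norm:
  assumes "finite F"
  shows "(\<Sum>x\<in>F. (cmod (ell2_fun f x))\<^sup>2) \<le> (norm f)\<^sup>2"
  unfolding norm_ell2_square
  by (rule finite_sum_le_infsum) (use assms ell2_fun[of f] in auto)

lemma ell2_norm_le_finite_sums:
  assumes "\<And>F. finite F \<Longrightarrow> (\<Sum>x\<in>F. (cmod (ell2_fun f x))\<^sup>2) \<le> B\<^sup>2" "B \<ge> 0"
  shows "norm f \<le> B"
proof -
  have "(norm f)\<^sup>2 \<le> B\<^sup>2"
    unfolding norm_ell2_square
    by (rule infsum_le_finite_sums) (use assms ell2_fun[of f] in auto)
  then show ?thesis by (rule power2_le_imp_le[OF _ assms(2)])
qed

text \<open>The pointwise limit is the norm limit by Fatou's inequality on finite sets.\<close>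

lemma ell2_Cauchy_convergent:
  fixes X :: "nat \<Rightarrow> 'x ell2"
  assumes "Cauchy X"
  shows "convergent X"
proof -
  have "Cauchy (\<lambda>n. ell2_fun (X n) x)" for x
  proof (rule Cauchy_norm_le[OF assms, where K = 1])
    fix m n
    show "norm (ell2_fun (X m) x - ell2_fun (X n) x) \<le> 1 * norm (X m - X n)"
      using cmod_ell2_fun_le[of "X m - X n" x] by (simp add: ell2_fun_diff)
  qed
  then have "\<exists>l. (\<lambda>n. ell2_fun (X n) x) \<longlonglongrightarrow> l" for x
    using Cauchy_convergent convergent_def by blast
  then obtain g where g: "\<And>x. (\<lambda>n. ell2_fun (X n) x) \<longlonglongrightarrow> g x" by metis
  have fatou: "(\<Sum>x\<in>F. (cmod (g x - ell2_fun h x))\<^sup>2) \<le> B\<^sup>2"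
    if F: "finite F" and bd: "\<And>n. n \<ge> N \<Longrightarrow> norm (X n - h) \<le> B" for F h B N
  proof -
    have lim: "(\<lambda>n. \<Sum>x\<in>F. (cmod (ell2_fun (X n) x - ell2_fun h x))\<^sup>2)
        \<longlonglongrightarrow> (\<Sum>x\<in>F. (cmod (g x - ell2_fun h x))\<^sup>2)"
      by (intro tendsto_sum tendsto_power tendsto_norm tendsto_diff tendsto_const g)
    have le: "(\<Sum>x\<in>F. (cmod (ell2_fun (X n) x - ell2_fun h x))\<^sup>2) \<le> B\<^sup>2" if n: "n \<ge> N" for n
    proof -
      have "(\<Sum>x\<in>F. (cmod (ell2_fun (X n - h) x))\<^sup>2) \<le> (norm (X n - h))\<^sup>2"
        by (rule ell2_sum_le_norm[OF F])
      also have "\<dots> \<le> B\<^sup>2" by (rule power_mono[OF bd[OF n]]) simp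
      finally show ?thesis by (simp add: ell2_fun_diff)
    qed
    show ?thesis by (rule LIMSEQ_le_const2[OF lim]) (use le in blast)
  qed
  obtain B where B: "\<And>n. norm (X n) \<le> B" using Cauchy_Bseq[OF assms] by (auto simp: Bseq_def)
  \<comment> \<open>The instance \<open>h = 0\<close> of the Fatou bound: the pointwise limit is
    square-summable, so it defines an element of the space.\<close>
  have "(\<Sum>x\<in>F. (cmod (g x))\<^sup>2) \<le> B\<^sup>2" if "finite F" for F
    using fatou[OF that, of 0 0 B] B by (simp add: ell2_simps)
  then have "(\<lambda>x. (cmod (g x))\<^sup>2) summable_on UNIV"
    by (intro nonneg_bdd_above_summable_on) (auto intro!: bdd_aboveI2)
  then have gl: "ell2_fun (Abs_ell2 g) = g" by (simp add: Abs_ell2_inverse)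
  have "X \<longlonglongrightarrow> Abs_ell2 g"
    unfolding LIMSEQ_iff
  proof (intro allI impI)
    fix e :: real assume e: "e > 0"
    then obtain N where N: "\<And>m n. m \<ge> N \<Longrightarrow> n \<ge> N \<Longrightarrow> norm (X m - X n) < e / 2"
      using CauchyD[OF assms half_gt_zero[OF e]] by blast
    have "norm (X n - Abs_ell2 g) < e" if n: "n \<ge> N" for n
    proof -
      have "norm (Abs_ell2 g - X n) \<le> e / 2"
      proof (rule ell2_norm_le_finite_sums)
        fix F :: "'x set" assume "finite F"
        from fatou[OF this less_imp_le[OF N[OF _ n]]]
        show "(\<Sum>x\<in>F. (cmod (ell2_fun (Abs_ell2 g - X n) x))\<^sup>2) \<le> (e / 2)\<^sup>2"
          by (simp add: ell2_fun_diff gl)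
      qed (use e in simp)
      with e show ?thesis by (simp add: norm_minus_commute)
    qed
    then show "\<exists>N. \<forall>n\<ge>N. norm (X n - Abs_ell2 g) < e" by blast
  qed
  then show ?thesis by (auto simp: convergent_def)
qed

section \<open>Matrix coefficients and operators of finite propagation\<close>

definition coef :: "'x ell2_op \<Rightarrow> 'x \<Rightarrow> 'x \<Rightarrow> complex"
  where "coef T x y = ell2_fun (op_apply T (ell2_delta y)) x"

lemma coef_adj: "coef (adj T) x y = cnj (coef T y x)"
proof -
  have "coef (adj T) x y = cinner (op_apply T (ell2_delta x)) (ell2_delta y)"
    by (simp add: coef_def cinner_delta_left[symmetric] cinner_adj_right)
  also have "\<dots> = cnj (cinner (ell2_delta y) (op_apply T (ell2_delta x)))" by (rule cinner_commute)
  finally show ?thesis by (simp add: cinner_delta_left coef_def)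
qed

lemma coef_simps:
  "coef (S + T) x y = coef S x y + coef T x y" "coef (S - T) x y = coef S x y - coef T x y"
  "coef (c *\<^sub>C T) x y = c * coef T x y" "coef 0 x y = 0" "coef 1 x y = (if x = y then 1 else 0)"
  by (simp_all add: coef_def op_simps op_apply_minus_op ell2_simps)

lemma coef_eqI: "(\<And>x y. coef S x y = coef T x y) \<Longrightarrow> S = T"
  by (intro ell2_op_eq_on_deltaI ell2_eqI) (simp add: coef_def)

definition matrix_unit :: "'x \<Rightarrow> 'x \<Rightarrow> 'x ell2_op"
  where "matrix_unit x y = partial_isometry {y} (\<lambda>_. x)"

lemma matrix_unit_delta: "op_apply (matrix_unit x y) (ell2_delta z) = (if z = y then ell2_delta x else 0)"
  by (simp add: matrix_unit_def partial_isometry_delta)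

text \<open>\<open>R \<ge> 0\<close> is included because \<open>ennreal\<close> sends negative reals
  to 0, which would spoil adding radii in products.\<close>

definition propagation_le :: "('x \<Rightarrow> 'x \<Rightarrow> ennreal) \<Rightarrow> real \<Rightarrow> 'x ell2_op \<Rightarrow> bool"
  where "propagation_le d R T \<longleftrightarrow> R \<ge> 0 \<and> (\<forall>x y. coef T x y \<noteq> 0 \<longrightarrow> d x y \<le> ennreal R)"

lemma propagation_le_mono: "propagation_le d R T \<Longrightarrow> R \<le> S \<Longrightarrow> propagation_le d S T"
proof -
  assume a: "propagation_le d R T" "R \<le> S"
  then have "ennreal R \<le> ennreal S" by (intro ennreal_leI)
  with a show ?thesis unfolding propagation_le_def by (metis order_trans)
qed

lemma star_subalgebra_hull: "star_subalgebra (star_subalgebra hull S)"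
  by (rule hull_in) (auto simp: star_subalgebra_def complex_vector.subspace_def)

lemma unital_star_subalgebra_hull: "unital_star_subalgebra (unital_star_subalgebra hull S)"
  by (rule hull_in) (auto simp: unital_star_subalgebra_def star_subalgebra_def complex_vector.subspace_def)

lemma star_subalgebraD:
  assumes "star_subalgebra S"
  shows "0 \<in> S" "a \<in> S \<Longrightarrow> b \<in> S \<Longrightarrow> a + b \<in> S" "a \<in> S \<Longrightarrow> c *\<^sub>C a \<in> S"
    "a \<in> S \<Longrightarrow> b \<in> S \<Longrightarrow> a * b \<in> S" "a \<in> S \<Longrightarrow> adj a \<in> S"
    "a \<in> S \<Longrightarrow> b \<in> S \<Longrightarrow> a - b \<in> S"
    "(\<And>i. i \<in> I \<Longrightarrow> h i \<in> S) \<Longrightarrow> sum h I \<in> S"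
proof -
  have S: "csubspace S" using assms by (simp add: star_subalgebra_def)
  show "0 \<in> S" "a \<in> S \<Longrightarrow> b \<in> S \<Longrightarrow> a + b \<in> S" "a \<in> S \<Longrightarrow> c *\<^sub>C a \<in> S"
    "a \<in> S \<Longrightarrow> b \<in> S \<Longrightarrow> a - b \<in> S"
    by (fact complex_vector.subspace_0[OF S] complex_vector.subspace_add[OF S]
        complex_vector.subspace_scale[OF S] complex_vector.subspace_diff[OF S])+
  show "(\<And>i. i \<in> I \<Longrightarrow> h i \<in> S) \<Longrightarrow> sum h I \<in> S"
    by (rule complex_vector.subspace_sum[OF S])
  show "a \<in> S \<Longrightarrow> b \<in> S \<Longrightarrow> a * b \<in> S" "a \<in> S \<Longrightarrow> adj a \<in> S"
    using assms by (auto simp: star_subalgebra_def)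
qed

context bdd_geometry begin

lemma propagation_apply:
  assumes "propagation_le d R T"
  shows "op_apply T (ell2_delta y) = (\<Sum>z\<in>metric_ball d R y. coef T z y *\<^sub>C ell2_delta z)"
  unfolding coef_def
proof (rule ell2_finite_sum[OF finite_ball])
  fix x assume "x \<notin> metric_ball d R y"
  then have "\<not> d x y \<le> ennreal R" by (simp add: metric_ball_def d_sym[of x y])
  then show "ell2_fun (op_apply T (ell2_delta y)) x = 0"
    using assms unfolding propagation_le_def coef_def by blast
qed

lemma coef_mult:
  assumes "propagation_le d R T"
  shows "coef (S * T) x y = (\<Sum>z\<in>metric_ball d R y. coef S x z * coef T z y)"
proof -
  have "coef (S * T) x y = ell2_fun (op_apply S (op_apply T (ell2_delta y))) x"
    by (simp add: coef_def op_simps)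
  also have "\<dots> = (\<Sum>z\<in>metric_ball d R y. coef T z y * coef S x z)"
    by (subst propagation_apply[OF assms])
       (simp add: op_apply_sum op_apply_scaleC ell2_simps coef_def[of S])
  finally show ?thesis by (simp add: mult.commute)
qed

lemma propagation_mult:
  assumes "propagation_le d R S" "propagation_le d R' T"
  shows "propagation_le d (R + R') (S * T)"
  unfolding propagation_le_def
proof (intro conjI allI impI)
  fix x y assume "coef (S * T) x y \<noteq> 0"
  then have "(\<Sum>z\<in>metric_ball d R' y. coef S x z * coef T z y) \<noteq> 0"
    by (simp add: coef_mult[OF assms(2)])
  then obtain z where "coef S x z * coef T z y \<noteq> 0"
    by (rule sum.not_neutral_contains_not_neutral)
  then have "d x z \<le> ennreal R" "d z y \<le> ennreal R'"
    using assms by (simp_all add: propagation_le_def)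
  then show "d x y \<le> ennreal (R + R')"
    using assms by (intro d_triangle_le[of x z]) (simp_all add: propagation_le_def)
qed (use assms in \<open>simp add: propagation_le_def\<close>)

definition finite_propagation :: "'x ell2_op set"
  where "finite_propagation = {T. \<exists>R. propagation_le d R T}"

lemma unital_star_subalgebra_finite_propagation: "unital_star_subalgebra finite_propagation"
proof -
  have add: "S + T \<in> finite_propagation" if S: "S \<in> finite_propagation" and T: "T \<in> finite_propagation" for S T
  proof -
    obtain R R' where R: "propagation_le d R S" "propagation_le d R' T"
      using S T unfolding finite_propagation_def by blast
    have "propagation_le d (max R R') S" "propagation_le d (max R R') T"
      by (rule propagation_le_mono[OF R(1)], simp, rule propagation_le_mono[OF R(2)], simp)
    then have "d x y \<le> ennreal (max R R')" if "coef (S + T) x y \<noteq> 0" for x y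
      using that by (cases "coef S x y = 0") (simp_all add: propagation_le_def coef_simps)
    then have "propagation_le d (max R R') (S + T)"
      using \<open>propagation_le d (max R R') S\<close> by (simp add: propagation_le_def)
    then show ?thesis unfolding finite_propagation_def by blast
  qed
  have "propagation_le d 0 0" "propagation_le d 0 1"
    by (simp_all add: propagation_le_def coef_simps)
  then have zero: "0 \<in> finite_propagation" "1 \<in> finite_propagation"
    unfolding finite_propagation_def by blast+
  have scale: "c *\<^sub>C T \<in> finite_propagation" if T: "T \<in> finite_propagation" for c T
  proof -
    obtain R where R: "propagation_le d R T" using T unfolding finite_propagation_def by blast
    then have "propagation_le d R (c *\<^sub>C T)" by (simp add: propagation_le_def coef_simps)
    then show ?thesis unfolding finite_propagation_def by blast
  qed
  have mult: "S * T \<in> finite_propagation" if S: "S \<in> finite_propagation" and T: "T \<in> finite_propagation" for S T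
  proof -
    obtain R R' where "propagation_le d R S" "propagation_le d R' T"
      using S T unfolding finite_propagation_def by blast
    from propagation_mult[OF this] show ?thesis unfolding finite_propagation_def by blast
  qed
  have adj: "adj T \<in> finite_propagation" if T: "T \<in> finite_propagation" for T
  proof -
    obtain R where R: "propagation_le d R T" using T unfolding finite_propagation_def by blast
    have "d x y \<le> ennreal R" if "coef (adj T) x y \<noteq> 0" for x y
      using R that by (simp add: propagation_le_def coef_adj d_sym[of x y])
    with R have "propagation_le d R (adj T)" by (simp add: propagation_le_def)
    then show ?thesis unfolding finite_propagation_def by blast
  qed
  show ?thesis
    unfolding unital_star_subalgebra_def star_subalgebra_def complex_vector.subspace_def
    by (intro conjI ballI allI) (erule (1) add scale mult adj zero | rule add scale mult adj zero; assumption?)+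
qed

lemma partial_isometry_finite_propagation:
  assumes "partial_translation d A B t"
  shows "partial_isometry A t \<in> finite_propagation"
proof -
  let ?s = "SUP x\<in>A. d x (t x)"
  have t: "inj_on t A" "?s < \<infinity>" using assms by (auto simp: partial_translation_def bij_betw_def)
  have "propagation_le d (enn2real ?s) (partial_isometry A t)"
    unfolding propagation_le_def
  proof (intro conjI allI impI)
    fix x y assume "coef (partial_isometry A t) x y \<noteq> 0"
    then have "y \<in> A" "x = t y"
      by (auto simp: coef_def partial_isometry_delta[OF t(1)] ell2_simps split: if_splits)
    then have "d x y \<le> ?s" using SUP_upper[of y A "\<lambda>x. d x (t x)"] by (simp add: d_sym[of "t y" y])
    with t(2) show "d x y \<le> ennreal (enn2real ?s)" by simp
  qed simp
  then show ?thesis by (auto simp: finite_propagation_def)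
qed

lemma translation_algebra_finite_propagation: "translation_algebra d \<subseteq> finite_propagation"
  unfolding translation_algebra_def
  by (rule hull_minimal)
     (use partial_isometry_finite_propagation unital_star_subalgebra_finite_propagation
      in \<open>auto simp: unital_star_subalgebra_def\<close>)

lemma roe_finite_propagation: "algebraic_uniform_roe_algebra d \<subseteq> finite_propagation"
  unfolding algebraic_uniform_roe_algebra_def
proof (rule hull_minimal)
  have "D \<in> finite_propagation" if "D \<in> diagonal_ops" for D
  proof -
    obtain a where "\<And>f x. ell2_fun (op_apply D f) x = a x * ell2_fun f x"
      using \<open>D \<in> diagonal_ops\<close> by (auto simp: diagonal_ops_def)
    then have "propagation_le d 0 D" by (auto simp: propagation_le_def coef_def ell2_simps split: if_splits)
    then show ?thesis unfolding finite_propagation_def by blast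
  qed
  then show "translation_algebra d \<union> diagonal_ops \<subseteq> finite_propagation"
    using translation_algebra_finite_propagation by auto
qed (fact unital_star_subalgebra_finite_propagation)

lemma translation_subset_roe: "translation_algebra d \<subseteq> algebraic_uniform_roe_algebra d"
  unfolding algebraic_uniform_roe_algebra_def using hull_subset[of "translation_algebra d \<union> diagonal_ops"] by blast

lemma partial_isometry_mem: "partial_translation d A B t \<Longrightarrow> partial_isometry A t \<in> translation_algebra d"
  unfolding translation_algebra_def by (rule hull_inc) auto

lemma star_subalgebra_translation: "star_subalgebra (translation_algebra d)"
  unfolding translation_algebra_def by (rule star_subalgebra_hull)

lemmas transl_closed = star_subalgebraD[OF star_subalgebra_translation]

lemma total_translation_mem:
  assumes "inj t" "\<And>x. d x (t x) \<le> ennreal R"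
  shows "partial_isometry UNIV t \<in> translation_algebra d"
proof (rule partial_isometry_mem)
  have "(SUP x. d x (t x)) \<le> ennreal R" by (rule SUP_least) (rule assms)
  then show "partial_translation d UNIV (range t) t"
    using assms(1) by (auto simp: partial_translation_def bij_betw_def intro: le_less_trans)
qed

lemma one_mem_translation: "1 \<in> translation_algebra d"
proof -
  have "partial_isometry UNIV (\<lambda>x. x) = (1 :: 'x ell2_op)"
    by (rule ell2_op_eq_on_deltaI) (simp add: partial_isometry_delta op_simps)
  then show ?thesis using total_translation_mem[of "\<lambda>x. x" 0] by simp
qed

lemma matrix_unit_mem: "d x y < \<infinity> \<Longrightarrow> matrix_unit x y \<in> translation_algebra d"
  unfolding matrix_unit_def
  by (rule partial_isometry_mem[of _ "{x}"]) (auto simp: partial_translation_def bij_betw_def d_sym)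

text \<open>The set of points at finite distance is the same for all points of a component, so the
  choice yields one common representative per component.\<close>

definition base :: "'x \<Rightarrow> 'x"
  where "base x = (SOME y. d x y < \<infinity>)"

lemma base_dist: "d x (base x) < \<infinity>"
  unfolding base_def by (rule someI[of _ x]) simp

lemma base_eq:
  assumes "d x y < \<infinity>"
  shows "base x = base y"
proof -
  have tr: "d a c < \<infinity>" if "d a b < \<infinity>" "d b c < \<infinity>" for a b c
  proof -
    have "d a c \<le> d a b + d b c" by (rule d_triangle)
    also have "\<dots> < \<infinity>" using that by (simp add: ennreal_add_less_top)
    finally show ?thesis .
  qed
  have "d y x < \<infinity>" using assms by (simp add: d_sym[of y x])
  then have "d x z < \<infinity> \<longleftrightarrow> d y z < \<infinity>" for z
    using tr[OF assms] tr by blast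
  then show ?thesis by (simp add: base_def)
qed

end

section \<open>The representation on \<open>\<ell>\<^sup>2(X)\<close> induced by an arbitrary C*-norm\<close>

lemma tendsto_null_comparison:
  fixes f :: "'b \<Rightarrow> 'a::real_normed_vector"
  assumes "\<forall>\<^sub>F x in G. norm (f x) \<le> g x" "(g \<longlongrightarrow> (0 :: real)) G"
  shows "(f \<longlongrightarrow> 0) G"
proof (rule tendsto_0_le[OF assms(2), where K = 1])
  show "\<forall>\<^sub>F x in G. norm (f x) \<le> norm (g x) * 1"
    using assms(1) by (rule eventually_mono) simp
qed

lemma bounded_linear_scaleC: "bounded_linear (\<lambda>a :: 'a::pre_cstar_algebra. c *\<^sub>C a)"
  by (rule bounded_linear_intro[where K = "cmod c"])
     (simp_all add: scaleC_add_right scaleR_scaleC scaleC_scaleC norm_scaleC mult.commute)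

lemma bounded_linear_adj: "bounded_linear (adj :: 'a::pre_cstar_algebra \<Rightarrow> 'a)"
  by (rule bounded_linear_intro[where K = 1]) (simp_all add: adj_add scaleR_scaleC adj_scaleC norm_adj)

text \<open>No relation between the norm on the target and the operator norm is assumed, and
  unitality of \<open>\<iota>\<close> is derived.\<close>

locale roe_rep = bdd_geometry d
  for d :: "'x \<Rightarrow> 'x \<Rightarrow> ennreal" +
  fixes \<iota> :: "'x ell2_op \<Rightarrow> 'a::pre_cstar_algebra"
  assumes hom: "\<iota> \<in> star_hom (star_algebra_on (translation_algebra d)) (star_algebra_on (UNIV :: 'a set))"
    and inj: "inj_on \<iota> (translation_algebra d)"
    and dense: "closure (\<iota> ` translation_algebra d) = (UNIV :: 'a set)"
begin

abbreviation "CU \<equiv> translation_algebra d"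

lemma \<iota>_add: "S \<in> CU \<Longrightarrow> T \<in> CU \<Longrightarrow> \<iota> (S + T) = \<iota> S + \<iota> T"
  and \<iota>_mult: "S \<in> CU \<Longrightarrow> T \<in> CU \<Longrightarrow> \<iota> (S * T) = \<iota> S * \<iota> T"
  and \<iota>_scaleC: "T \<in> CU \<Longrightarrow> \<iota> (c *\<^sub>C T) = c *\<^sub>C \<iota> T"
  and \<iota>_adj: "T \<in> CU \<Longrightarrow> \<iota> (adj T) = adj (\<iota> T)"
  using hom by (auto simp: star_hom_def star_algebra_on_def)

lemma \<iota>_zero: "\<iota> 0 = 0"
  using \<iota>_scaleC[of 0 0] transl_closed(1) by simp

lemma \<iota>_diff: "S \<in> CU \<Longrightarrow> T \<in> CU \<Longrightarrow> \<iota> (S - T) = \<iota> S - \<iota> T"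
  using \<iota>_add[of "S - T" T] transl_closed(6)[of S T] by (simp add: algebra_simps)

lemma approx:
  assumes "e > 0"
  obtains T where "T \<in> CU" "norm (\<iota> T - a) < e"
proof -
  have "a \<in> closure (\<iota> ` CU)" using dense by simp
  then obtain T where "T \<in> CU" "dist (\<iota> T) a < e" using assms unfolding closure_approachable by blast
  then show ?thesis using that by (simp add: dist_norm)
qed

lemma approx_seq:
  obtains T where "\<And>n. T n \<in> CU" "(\<lambda>n. \<iota> (T n)) \<longlonglongrightarrow> a"
proof -
  have "a \<in> closure (\<iota> ` CU)" using dense by simp
  then obtain y where y: "\<And>n. y n \<in> \<iota> ` CU" "y \<longlonglongrightarrow> a" unfolding closure_sequential by blast
  then have "\<exists>T. T \<in> CU \<and> \<iota> T = y n" for n by (metis imageE)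
  then obtain T where "\<And>n. T n \<in> CU" "\<And>n. \<iota> (T n) = y n" by metis
  with y(2) show ?thesis by (intro that[of T]) simp_all
qed

text \<open>By density: \<open>\<iota> 1\<close> is a left unit on the dense range, and a sequence
  from the range converges to 1.\<close>

lemma \<iota>_one: "\<iota> 1 = 1"
proof -
  obtain T where T: "\<And>n. T n \<in> CU" "(\<lambda>n. \<iota> (T n)) \<longlonglongrightarrow> 1" using approx_seq by blast
  have "(\<lambda>n. \<iota> 1 * \<iota> (T n)) \<longlonglongrightarrow> \<iota> 1 * 1" by (intro tendsto_mult tendsto_const T)
  moreover have "\<iota> 1 * \<iota> (T n) = \<iota> (T n)" for n
    using \<iota>_mult[OF one_mem_translation T(1)] by simp
  ultimately show ?thesis using T(2) LIMSEQ_unique by fastforce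
qed

lemma matrix_unit_self_mem: "matrix_unit c c \<in> CU"
  by (rule matrix_unit_mem) simp

text \<open>If \<open>B\<close> is supported on \<open>\<delta>\<^sub>c\<close> then \<open>B*B\<close> is a multiple of a nonzero projection, so every
  C*-norm gives \<open>B\<close> the same value.\<close>

lemma adj_mult_rank_one:
  assumes "\<forall>y. y \<noteq> c \<longrightarrow> op_apply B (ell2_delta y) = 0"
  shows "adj B * B = complex_of_real ((norm (op_apply B (ell2_delta c)))\<^sup>2) *\<^sub>C matrix_unit c c"
proof (rule coef_eqI)
  fix x y
  have "coef (adj B * B) x y = cinner (op_apply B (ell2_delta x)) (op_apply B (ell2_delta y))"
    by (simp add: coef_def op_simps cinner_delta_left[symmetric] cinner_adj_right)
  moreover have "coef (matrix_unit c c) x y = (if x = c \<and> y = c then 1 else 0)"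
    by (simp add: coef_def matrix_unit_delta ell2_simps)
  ultimately show "coef (adj B * B) x y
      = coef (complex_of_real ((norm (op_apply B (ell2_delta c)))\<^sup>2) *\<^sub>C matrix_unit c c) x y"
    using assms by (auto simp: coef_simps cinner_self_norm)
qed

text \<open>For a projection the C*-identity makes the norm equal to its own square, and injectivity
  of \<open>\<iota>\<close> excludes 0.\<close>

lemma norm_matrix_unit: "norm (\<iota> (matrix_unit c c)) = 1"
proof -
  let ?E = "matrix_unit c c"
  have "adj ?E * ?E = ?E"
    using adj_mult_rank_one[of c ?E] by (simp add: matrix_unit_delta scaleC_one)
  then have "norm (\<iota> ?E) = norm (adj (\<iota> ?E) * \<iota> ?E)"
    by (metis \<iota>_adj \<iota>_mult matrix_unit_self_mem transl_closed(5))
  then have "norm (\<iota> ?E) = norm (\<iota> ?E) * norm (\<iota> ?E)"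
    by (simp add: cstar_identity power2_eq_square)
  moreover have "\<iota> ?E \<noteq> 0"
  proof
    assume "\<iota> ?E = 0"
    then have "?E = 0"
      using inj matrix_unit_self_mem transl_closed(1) \<iota>_zero by (metis inj_onD)
    then have "coef ?E c c = 0" by (simp add: coef_simps)
    then show False by (simp add: coef_def matrix_unit_delta ell2_simps)
  qed
  ultimately show ?thesis by simp
qed

lemma norm_rank_one:
  assumes B: "B \<in> CU" "\<forall>y. y \<noteq> c \<longrightarrow> op_apply B (ell2_delta y) = 0"
  shows "norm (\<iota> B) = norm (op_apply B (ell2_delta c))"
proof -
  let ?r = "norm (op_apply B (ell2_delta c))"
  have "(norm (\<iota> B))\<^sup>2 = norm (\<iota> (adj B * B))"
    using B by (simp add: cstar_identity[symmetric] \<iota>_mult \<iota>_adj transl_closed(5))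
  also have "\<iota> (adj B * B) = complex_of_real (?r\<^sup>2) *\<^sub>C \<iota> (matrix_unit c c)"
    unfolding adj_mult_rank_one[OF B(2)] by (rule \<iota>_scaleC[OF matrix_unit_self_mem])
  also have "norm \<dots> = ?r\<^sup>2"
    unfolding norm_scaleC norm_matrix_unit norm_of_real by simp
  finally show ?thesis by simp
qed

text \<open>The rank-one operator \<open>\<Theta>\<close> sending the basis vector at
  \<open>c\<close> to \<open>f\<close> lies in the translation algebra, because the support of
  \<open>f\<close> is at finite distance from \<open>c\<close>. The norms of \<open>f\<close> and of
  \<open>T f\<close> are then the abstract norms of \<open>\<Theta>\<close> and
  \<open>T * \<Theta>\<close>, and submultiplicativity gives the bound.\<close>

lemma norm_apply_le_component:
  assumes T: "T \<in> CU" and F: "finite F" "\<And>x. x \<in> F \<Longrightarrow> base x = c" "\<And>x. x \<notin> F \<Longrightarrow> ell2_fun f x = 0"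
  shows "norm (op_apply T f) \<le> norm (\<iota> T) * norm f"
proof -
  define \<Theta> where "\<Theta> = (\<Sum>x\<in>F. ell2_fun f x *\<^sub>C matrix_unit x c)"
  have mem: "matrix_unit x c \<in> CU" if "x \<in> F" for x
    using matrix_unit_mem[OF base_dist[of x]] F(2)[OF that] by simp
  have \<Theta>: "\<Theta> \<in> CU" unfolding \<Theta>_def by (intro transl_closed mem)
  have app: "op_apply \<Theta> (ell2_delta y) = (\<Sum>x\<in>F. ell2_fun f x *\<^sub>C op_apply (matrix_unit x c) (ell2_delta y))" for y
    unfolding \<Theta>_def by (induction F rule: infinite_finite_induct) (simp_all add: op_simps)
  have c: "op_apply \<Theta> (ell2_delta c) = f"
    unfolding app using ell2_finite_sum[OF F(1,3)] by (simp add: matrix_unit_delta)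
  have nc: "\<forall>y. y \<noteq> c \<longrightarrow> op_apply \<Theta> (ell2_delta y) = 0"
    unfolding app by (simp add: matrix_unit_delta)
  have "norm (op_apply T f) = norm (\<iota> (T * \<Theta>))"
    using norm_rank_one[of "T * \<Theta>" c] T \<Theta> nc by (simp add: transl_closed op_simps c)
  also have "\<dots> \<le> norm (\<iota> T) * norm (\<iota> \<Theta>)"
    using T \<Theta> by (simp add: \<iota>_mult norm_mult_ineq)
  also have "norm (\<iota> \<Theta>) = norm f"
    using norm_rank_one[OF \<Theta> nc] by (simp add: c)
  finally show ?thesis .
qed

text \<open>Finite propagation prevents \<open>T\<close> from mixing components, so the pieces of
  \<open>f\<close> in different components stay orthogonal under \<open>T\<close> and the squared
  norms add up.\<close>

lemma norm_apply_le_finite: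
  assumes T: "T \<in> CU" and F: "finite F" "\<And>x. x \<notin> F \<Longrightarrow> ell2_fun f x = 0"
  shows "norm (op_apply T f) \<le> norm (\<iota> T) * norm f"
proof -
  let ?C = "base ` F"
  define g where "g c = (\<Sum>x\<in>{x\<in>F. base x = c}. ell2_fun f x *\<^sub>C ell2_delta x)" for c
  have g: "ell2_fun (g c) x = (if x \<in> F \<and> base x = c then ell2_fun f x else 0)" for c x
    using F(1) by (simp add: g_def ell2_simps if_distrib[of "\<lambda>z. _ * z"] sum.delta cong: if_cong)
  have f: "f = (\<Sum>c\<in>?C. g c)"
  proof -
    have "f = (\<Sum>x\<in>F. ell2_fun f x *\<^sub>C ell2_delta x)" by (rule ell2_finite_sum[OF F(1)]) (rule F(2))
    also have "\<dots> = (\<Sum>c\<in>?C. g c)"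
      unfolding g_def by (rule sum.group[symmetric]) (use F in auto)
    finally show ?thesis .
  qed
  obtain R where R: "propagation_le d R T"
    using T translation_algebra_finite_propagation unfolding finite_propagation_def by blast
  have Tg: "ell2_fun (op_apply T (g c)) y = 0" if bc: "base y \<noteq> c" for c y
  proof -
    have co: "coef T y x = 0" if bx: "base x = c" for x
    proof (rule ccontr)
      assume "coef T y x \<noteq> 0"
      then have "d y x \<le> ennreal R" using R by (simp add: propagation_le_def)
      then have "d y x < \<infinity>" by (rule le_less_trans) simp
      from base_eq[OF this] bx bc show False by simp
    qed
    show ?thesis
      unfolding g_def op_apply_sum op_apply_scaleC ell2_fun_sum scaleC_ell2.rep_eq coef_def[symmetric]
      by (rule sum.neutral) (use co in simp)
  qed
  have disj: "cinner h h' = 0" if h: "\<And>y. ell2_fun h y = 0 \<or> ell2_fun h' y = 0" for h h' :: "'x ell2"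
  proof -
    have "cnj (ell2_fun h y) * ell2_fun h' y = 0" for y using h[of y] by auto
    then show ?thesis unfolding cinner_def by (simp only: infsum_0)
  qed
  have og: "pairwise (\<lambda>c c'. orthogonal (g c) (g c')) ?C"
    unfolding pairwise_def orthogonal_def inner_ell2_def
  proof (intro ballI impI)
    fix c c' :: 'x assume "c \<noteq> c'"
    then have "cinner (g c) (g c') = 0" by (intro disj) (simp add: g)
    then show "Re (cinner (g c) (g c')) = 0" by simp
  qed
  have oT: "pairwise (\<lambda>c c'. orthogonal (op_apply T (g c)) (op_apply T (g c'))) ?C"
    unfolding pairwise_def orthogonal_def inner_ell2_def
  proof (intro ballI impI)
    fix c c' :: 'x assume "c \<noteq> c'"
    then have "cinner (op_apply T (g c)) (op_apply T (g c')) = 0"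
    proof (intro disj)
      fix y show "ell2_fun (op_apply T (g c)) y = 0 \<or> ell2_fun (op_apply T (g c')) y = 0"
        using Tg[of y c] Tg[of y c'] \<open>c \<noteq> c'\<close> by auto
    qed
    then show "Re (cinner (op_apply T (g c)) (op_apply T (g c'))) = 0" by simp
  qed
  have "(norm (op_apply T f))\<^sup>2 = (norm (\<Sum>c\<in>?C. op_apply T (g c)))\<^sup>2"
    by (simp only: f[symmetric] op_apply_sum[symmetric])
  also have "\<dots> = (\<Sum>c\<in>?C. (norm (op_apply T (g c)))\<^sup>2)"
    by (rule norm_sum_Pythagorean[OF _ oT]) (use F in simp)
  also have "\<dots> \<le> (\<Sum>c\<in>?C. (norm (\<iota> T) * norm (g c))\<^sup>2)"
  proof (intro sum_mono power_mono)
    fix c :: 'x show "norm (op_apply T (g c)) \<le> norm (\<iota> T) * norm (g c)"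
      by (rule norm_apply_le_component[OF T, of "{x\<in>F. base x = c}" c]) (use F g in auto)
  qed simp
  also have "\<dots> = (norm (\<iota> T))\<^sup>2 * (\<Sum>c\<in>?C. (norm (g c))\<^sup>2)"
    by (simp add: power_mult_distrib sum_distrib_left)
  also have "(\<Sum>c\<in>?C. (norm (g c))\<^sup>2) = (norm (\<Sum>c\<in>?C. g c))\<^sup>2"
    by (rule norm_sum_Pythagorean[OF _ og, symmetric]) (use F in simp)
  finally have "(norm (op_apply T f))\<^sup>2 \<le> (norm (\<iota> T) * norm f)\<^sup>2"
    by (simp add: f[symmetric] power_mult_distrib)
  then show ?thesis by (rule power2_le_imp_le) simp
qed

lemma norm_apply_le:
  assumes T: "T \<in> CU"
  shows "norm (op_apply T f) \<le> norm (\<iota> T) * norm f"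
proof -
  define t where "t F = (\<Sum>x\<in>F. ell2_fun f x *\<^sub>C ell2_delta x)" for F
  have t: "(t \<longlongrightarrow> f) (finite_subsets_at_top UNIV)"
    using ell2_has_sum_delta[of f] unfolding has_sum_def t_def[abs_def] .
  have Tt: "((\<lambda>F. op_apply T (t F)) \<longlongrightarrow> op_apply T f) (finite_subsets_at_top UNIV)"
    by (rule bounded_linear.tendsto[OF op_apply_bounded_linear t])
  have le: "norm (op_apply T (t F)) \<le> norm (\<iota> T) * norm (t F)" if "finite F" for F
  proof (rule norm_apply_le_finite[OF T that])
    fix x assume "x \<notin> F"
    then have "ell2_fun f y * (if x = y then 1 else 0) = 0" if "y \<in> F" for y using that by auto
    then show "ell2_fun (t F) x = 0" by (simp add: t_def ell2_simps)
  qed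
  show ?thesis
  proof (rule tendsto_le[OF _ tendsto_mult[OF tendsto_const tendsto_norm[OF t]] tendsto_norm[OF Tt]])
    show "\<forall>\<^sub>F F in finite_subsets_at_top UNIV. norm (op_apply T (t F)) \<le> norm (\<iota> T) * norm (t F)"
      using le by (rule eventually_finite_subsets_at_top_weakI)
  qed simp
qed

lemma \<iota>_Cauchy_apply:
  assumes T: "\<And>n. T n \<in> CU" and a: "(\<lambda>n. \<iota> (T n)) \<longlonglongrightarrow> a"
  shows "convergent (\<lambda>n. op_apply (T n) f)"
proof (rule ell2_Cauchy_convergent, rule Cauchy_norm_le[where K = "norm f"])
  show "Cauchy (\<lambda>n. \<iota> (T n))" by (rule LIMSEQ_imp_Cauchy[OF a])
  fix m n
  have "norm (op_apply (T m - T n) f) \<le> norm (\<iota> (T m - T n)) * norm f"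
    by (rule norm_apply_le) (intro transl_closed T)
  then show "norm (op_apply (T m) f - op_apply (T n) f) \<le> norm f * norm (\<iota> (T m) - \<iota> (T n))"
    by (simp add: op_apply_minus_op \<iota>_diff T mult.commute)
qed

text \<open>The same operator must serve all sequences approximating \<open>a\<close>, so that
  \<open>rep\<close> can be chosen from it: two such sequences differ by a null sequence, which by
  \<open>norm_apply_le\<close> has strong limit 0.\<close>

lemma rep_exists:
  "\<exists>P. \<forall>T. (\<forall>n. T n \<in> CU) \<and> (\<lambda>n. \<iota> (T n)) \<longlonglongrightarrow> a \<longrightarrow>
    (\<forall>f. (\<lambda>n. op_apply (T n) f) \<longlonglongrightarrow> op_apply P f)"
proof -
  obtain T where T: "\<And>n. T n \<in> CU" "(\<lambda>n. \<iota> (T n)) \<longlonglongrightarrow> a" using approx_seq by blast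
  define p where "p f = lim (\<lambda>n. op_apply (T n) f)" for f
  have p: "(\<lambda>n. op_apply (T n) f) \<longlonglongrightarrow> p f" for f
    unfolding p_def using \<iota>_Cauchy_apply[OF T] convergent_LIMSEQ_iff by blast
  have add: "p (f + g) = p f + p g" for f g
    using tendsto_add[OF p[of f] p[of g]] p[of "f + g"]
    by (intro LIMSEQ_unique[of "\<lambda>n. op_apply (T n) (f + g)"]) (simp_all add: op_apply_add)
  have sc: "p (c *\<^sub>C f) = c *\<^sub>C p f" for c f
    using bounded_linear.tendsto[OF bounded_linear_scaleC_ell2 p[of f], of c] p[of "c *\<^sub>C f"]
    by (intro LIMSEQ_unique[of "\<lambda>n. op_apply (T n) (c *\<^sub>C f)"]) (simp_all add: op_apply_scaleC)
  have bd: "norm (p f) \<le> norm f * norm a" for f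
  proof (rule LIMSEQ_le[OF tendsto_norm[OF p] tendsto_mult[OF tendsto_const tendsto_norm[OF T(2)]]])
    show "\<exists>N. \<forall>n\<ge>N. norm (op_apply (T n) f) \<le> norm f * norm (\<iota> (T n))"
      using norm_apply_le[OF T(1)] by (simp add: mult.commute)
  qed
  have bl: "bounded_linear p"
    by (rule bounded_linear_intro[OF add _ bd]) (simp add: scaleR_ell2_scaleC sc)
  have P: "op_apply (Abs_ell2_op p) = p"
    by (intro Abs_ell2_op_inverse) (use bl sc in auto)
  have "(\<lambda>n. op_apply (S n) f) \<longlonglongrightarrow> p f" if S: "\<And>n. S n \<in> CU" "(\<lambda>n. \<iota> (S n)) \<longlonglongrightarrow> a" for S f
  proof -
    have "(\<lambda>n. \<iota> (S n) - \<iota> (T n)) \<longlonglongrightarrow> 0" using tendsto_diff[OF S(2) T(2)] by simp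
    then have z: "(\<lambda>n. norm (\<iota> (S n) - \<iota> (T n)) * norm f) \<longlonglongrightarrow> 0"
      by (rule tendsto_mult_left_zero[OF tendsto_norm_zero])
    have le: "norm (op_apply (S n) f - op_apply (T n) f) \<le> norm (\<iota> (S n) - \<iota> (T n)) * norm f" for n
      using norm_apply_le[of "S n - T n" f] S(1)[of n] T(1)[of n]
      by (simp add: transl_closed op_apply_minus_op \<iota>_diff)
    have "(\<lambda>n. op_apply (S n) f - op_apply (T n) f) \<longlonglongrightarrow> 0"
      by (rule tendsto_null_comparison[OF always_eventually z]) (use le in blast)
    from tendsto_add[OF this p[of f]] show ?thesis by simp
  qed
  with P show ?thesis by (intro exI[of _ "Abs_ell2_op p"]) simp
qed

definition rep :: "'a \<Rightarrow> 'x ell2_op"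
  where "rep a = (SOME P. \<forall>T. (\<forall>n. T n \<in> CU) \<and> (\<lambda>n. \<iota> (T n)) \<longlonglongrightarrow> a \<longrightarrow>
    (\<forall>f. (\<lambda>n. op_apply (T n) f) \<longlonglongrightarrow> op_apply P f))"

lemma rep_tendsto:
  assumes "\<And>n. T n \<in> CU" "(\<lambda>n. \<iota> (T n)) \<longlonglongrightarrow> a"
  shows "(\<lambda>n. op_apply (T n) f) \<longlonglongrightarrow> op_apply (rep a) f"
  using someI_ex[OF rep_exists[of a]] assms unfolding rep_def by blast

lemma rep_\<iota>: "T \<in> CU \<Longrightarrow> rep (\<iota> T) = T"
  using rep_tendsto[of "\<lambda>_. T" "\<iota> T"] by (intro ell2_op_eqI) (simp add: LIMSEQ_const_iff)

lemma rep_one: "rep 1 = 1"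
  using rep_\<iota>[OF one_mem_translation] by (simp add: \<iota>_one)

lemma norm_rep_le: "norm (op_apply (rep a) f) \<le> norm a * norm f"
proof -
  obtain T where T: "\<And>n. T n \<in> CU" "(\<lambda>n. \<iota> (T n)) \<longlonglongrightarrow> a" using approx_seq by blast
  show ?thesis
  proof (rule LIMSEQ_le[OF tendsto_norm[OF rep_tendsto[OF T]] tendsto_mult[OF tendsto_norm[OF T(2)] tendsto_const]])
    show "\<exists>N. \<forall>n\<ge>N. norm (op_apply (T n) f) \<le> norm (\<iota> (T n)) * norm f"
      using norm_apply_le[OF T(1)] by simp
  qed
qed

lemma rep_add: "rep (a + b) = rep a + rep b"
proof (rule ell2_op_eqI)
  fix f
  obtain S where S: "\<And>n. S n \<in> CU" "(\<lambda>n. \<iota> (S n)) \<longlonglongrightarrow> a" using approx_seq by blast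
  obtain T where T: "\<And>n. T n \<in> CU" "(\<lambda>n. \<iota> (T n)) \<longlonglongrightarrow> b" using approx_seq by blast
  have "(\<lambda>n. \<iota> (S n + T n)) \<longlonglongrightarrow> a + b"
    using tendsto_add[OF S(2) T(2)] by (simp add: \<iota>_add S T)
  then have "(\<lambda>n. op_apply (S n + T n) f) \<longlonglongrightarrow> op_apply (rep (a + b)) f"
    by (rule rep_tendsto[rotated]) (intro transl_closed S T)
  moreover have "(\<lambda>n. op_apply (S n + T n) f) \<longlonglongrightarrow> op_apply (rep a + rep b) f"
    using tendsto_add[OF rep_tendsto[OF S] rep_tendsto[OF T]] by (simp add: op_simps)
  ultimately show "op_apply (rep (a + b)) f = op_apply (rep a + rep b) f" by (rule LIMSEQ_unique)
qed

lemma rep_scaleC: "rep (c *\<^sub>C a) = c *\<^sub>C rep a"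
proof (rule ell2_op_eqI)
  fix f
  obtain S where S: "\<And>n. S n \<in> CU" "(\<lambda>n. \<iota> (S n)) \<longlonglongrightarrow> a" using approx_seq by blast
  have "(\<lambda>n. \<iota> (c *\<^sub>C S n)) \<longlonglongrightarrow> c *\<^sub>C a"
    using bounded_linear.tendsto[OF bounded_linear_scaleC S(2)] by (simp add: \<iota>_scaleC S)
  then have "(\<lambda>n. op_apply (c *\<^sub>C S n) f) \<longlonglongrightarrow> op_apply (rep (c *\<^sub>C a)) f"
    by (rule rep_tendsto[rotated]) (intro transl_closed S)
  moreover have "(\<lambda>n. op_apply (c *\<^sub>C S n) f) \<longlonglongrightarrow> op_apply (c *\<^sub>C rep a) f"
    using bounded_linear.tendsto[OF bounded_linear_scaleC_ell2 rep_tendsto[OF S]] by (simp add: op_simps)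
  ultimately show "op_apply (rep (c *\<^sub>C a)) f = op_apply (c *\<^sub>C rep a) f" by (rule LIMSEQ_unique)
qed

lemma rep_mult: "rep (a * b) = rep a * rep b"
proof (rule ell2_op_eqI)
  fix f
  obtain S where S: "\<And>n. S n \<in> CU" "(\<lambda>n. \<iota> (S n)) \<longlonglongrightarrow> a" using approx_seq by blast
  obtain T where T: "\<And>n. T n \<in> CU" "(\<lambda>n. \<iota> (T n)) \<longlonglongrightarrow> b" using approx_seq by blast
  have "(\<lambda>n. \<iota> (S n * T n)) \<longlonglongrightarrow> a * b"
    using tendsto_mult[OF S(2) T(2)] by (simp add: \<iota>_mult S T)
  then have 1: "(\<lambda>n. op_apply (S n * T n) f) \<longlonglongrightarrow> op_apply (rep (a * b)) f"
    by (rule rep_tendsto[rotated]) (intro transl_closed S T)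
  let ?g = "op_apply (rep b) f"
  \<comment> \<open>Multiplication is strongly continuous only along bounded sequences; here the
    \<open>S n\<close> are bounded by the convergent norms of \<open>\<iota> (S n)\<close>.\<close>
  have "(\<lambda>n. op_apply (S n) (op_apply (T n) f - ?g)) \<longlonglongrightarrow> 0"
  proof (rule tendsto_null_comparison)
    show "\<forall>\<^sub>F n in sequentially. norm (op_apply (S n) (op_apply (T n) f - ?g))
        \<le> norm (\<iota> (S n)) * norm (op_apply (T n) f - ?g)"
      using norm_apply_le[OF S(1)] by simp
    have "(\<lambda>n. op_apply (T n) f - ?g) \<longlonglongrightarrow> 0"
      using tendsto_diff[OF rep_tendsto[OF T, of f] tendsto_const[of ?g]] by simp
    from tendsto_mult[OF tendsto_norm[OF S(2)] tendsto_norm[OF this]]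
    show "(\<lambda>n. norm (\<iota> (S n)) * norm (op_apply (T n) f - ?g)) \<longlonglongrightarrow> 0" by simp
  qed
  from tendsto_add[OF this rep_tendsto[OF S, of ?g]]
  have "(\<lambda>n. op_apply (S n * T n) f) \<longlonglongrightarrow> op_apply (rep a * rep b) f"
    by (simp add: op_simps op_apply_diff)
  with 1 show "op_apply (rep (a * b)) f = op_apply (rep a * rep b) f" by (rule LIMSEQ_unique)
qed

text \<open>Taking adjoints is not strongly continuous in general, but here \<open>adj (S n)\<close>
  converges strongly by itself, as \<open>\<iota> (adj (S n))\<close> tends to \<open>adj a\<close>.
  Comparing inner products identifies the limit.\<close>

lemma rep_adj: "rep (adj a) = adj (rep a)"
proof (rule ell2_op_adj_eqI[symmetric])
  fix f g
  obtain S where S: "\<And>n. S n \<in> CU" "(\<lambda>n. \<iota> (S n)) \<longlonglongrightarrow> a" using approx_seq by blast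
  have "(\<lambda>n. \<iota> (adj (S n))) \<longlonglongrightarrow> adj a"
    using bounded_linear.tendsto[OF bounded_linear_adj S(2)] by (simp add: \<iota>_adj S)
  then have "(\<lambda>n. op_apply (adj (S n)) g) \<longlonglongrightarrow> op_apply (rep (adj a)) g"
    by (rule rep_tendsto[rotated]) (intro transl_closed S)
  from bounded_linear.tendsto[OF bounded_linear_cinner_right this, of f]
  have 1: "(\<lambda>n. cinner (op_apply (S n) f) g) \<longlonglongrightarrow> cinner f (op_apply (rep (adj a)) g)"
    by (simp add: cinner_adj_right)
  have "(\<lambda>n. cnj (cinner g (op_apply (S n) f))) \<longlonglongrightarrow> cnj (cinner g (op_apply (rep a) f))"
    by (intro tendsto_cnj bounded_linear.tendsto[OF bounded_linear_cinner_right] rep_tendsto S)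
  then have "(\<lambda>n. cinner (op_apply (S n) f) g) \<longlonglongrightarrow> cinner (op_apply (rep a) f) g"
    by (simp add: cinner_commute[of _ g])
  from LIMSEQ_unique[OF 1 this]
  show "cinner f (op_apply (rep (adj a)) g) = cinner (op_apply (rep a) f) g" .
qed

lemma rep_diff: "rep (a - b) = rep a - rep b"
  using rep_add[of "a - b" b] by (simp add: algebra_simps)

lemma rep_zero: "rep 0 = 0"
  using rep_diff[of 0 0] by simp

lemma rep_sum: "rep (sum h I) = (\<Sum>i\<in>I. rep (h i))"
  by (induction I rule: infinite_finite_induct) (simp_all add: rep_add rep_zero)

end

section \<open>Algebraic amenability and the rank condition\<close>

context bdd_geometry begin

text \<open>The span of the matrix units from the base point of the component of \<open>x\<close> to \<open>x\<close>, for \<open>x\<close>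
  in a Folner set, is almost invariant; using one base point per component makes its dimension
  \<open>card F\<close> even if \<open>F\<close> meets several components.\<close>

lemma amenable_imp_algebraically_amenable:
  assumes am: "amenable_metric d"
  shows "algebraically_amenable (algebraic_uniform_roe_algebra d)"
  unfolding algebraically_amenable_def
proof (intro allI impI)
  fix \<epsilon> :: real and \<F> :: "'x ell2_op set"
  assume "\<epsilon> > 0 \<and> finite \<F> \<and> \<F> \<subseteq> algebraic_uniform_roe_algebra d"
  then have \<epsilon>: "\<epsilon> > 0" and fin: "finite \<F>" and sub: "\<F> \<subseteq> algebraic_uniform_roe_algebra d" by auto
  have "\<forall>a\<in>\<F>. \<exists>r. propagation_le d r a"
    using sub roe_finite_propagation unfolding finite_propagation_def by blast
  from bchoice[OF this] obtain r where r: "\<And>a. a \<in> \<F> \<Longrightarrow> propagation_le d (r a) a" by blast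
  \<comment> \<open>A common propagation bound; inserting 1 makes it positive and covers the empty
    family.\<close>
  define R where "R = Max (insert 1 (r ` \<F>))"
  have "1 \<le> R" unfolding R_def by (rule Max_ge) (use fin in auto)
  then have R: "R > 0" by simp
  have Ra: "propagation_le d R a" if "a \<in> \<F>" for a
  proof (rule propagation_le_mono[OF r[OF that]])
    show "r a \<le> R" unfolding R_def by (rule Max_ge) (use fin that in auto)
  qed
  obtain F where F: "finite F" "F \<noteq> {}" "real (card (nbhd d R F)) \<le> (1 + \<epsilon>) * real (card F)"
    using card_nbhd_le[OF am R \<epsilon>] by blast
  define E where "E x = matrix_unit x (base x)" for x
  have E: "op_apply (E x) (ell2_delta y) = (if y = base x then ell2_delta x else 0)" for x y
    by (simp add: E_def matrix_unit_delta)
  have cE: "coef (E x) z y = (if y = base x \<and> z = x then 1 else 0)" for x y z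
    by (simp add: coef_def E ell2_simps)
  have Emem: "E x \<in> algebraic_uniform_roe_algebra d" for x
    unfolding E_def using matrix_unit_mem[OF base_dist] translation_subset_roe by blast
  have injE: "inj E"
  proof (rule injI)
    fix x y assume "E x = E y"
    then have "coef (E x) x (base x) = coef (E y) x (base x)" by simp
    then show "x = y" by (simp add: cE split: if_splits)
  qed
  have ind: "\<not> cdependent (E ` F)"
  proof
    assume "cdependent (E ` F)"
    then obtain u where u: "\<exists>v\<in>E ` F. u v \<noteq> 0" "(\<Sum>v\<in>E ` F. u v *\<^sub>C v) = 0"
      using complex_vector.dependent_finite[of "E ` F"] F(1) by auto
    then obtain x where x: "x \<in> F" "u (E x) \<noteq> 0" by auto
    have cs: "coef (sum h G) z y = (\<Sum>i\<in>G. coef (h i) z y)" for h :: "'x \<Rightarrow> 'x ell2_op" and G z y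
      by (induction G rule: infinite_finite_induct) (simp_all add: coef_simps)
    have "0 = coef (\<Sum>v\<in>E ` F. u v *\<^sub>C v) x (base x)" unfolding u(2) by (simp add: coef_simps)
    also have "(\<Sum>v\<in>E ` F. u v *\<^sub>C v) = (\<Sum>y\<in>F. u (E y) *\<^sub>C E y)"
      by (subst sum.reindex) (use injE in \<open>auto intro: inj_on_subset\<close>)
    also have "coef \<dots> x (base x) = (\<Sum>y\<in>F. if y = x then u (E x) else 0)"
      unfolding cs by (rule sum.cong) (auto simp: coef_simps cE)
    finally show False using x F(1) by simp
  qed
  define W where "W = cspan (E ` F)"
  have dimW: "cdim W = card F"
    unfolding W_def using complex_vector.dim_span_eq_card_independent[OF ind] card_image[of E F] injE
    by (simp add: inj_on_subset)
  show "\<exists>W. W \<subseteq> algebraic_uniform_roe_algebra d \<and> csubspace W \<and> (\<exists>S. finite S \<and> cspan S = W) \<and> W \<noteq> {0} \<and>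
      (\<forall>a\<in>\<F>. real (cdim {a * w + w' |w w'. w \<in> W \<and> w' \<in> W}) \<le> (1 + \<epsilon>) * real (cdim W))"
  proof (rule exI[of _ W], intro conjI ballI)
    have sr: "csubspace (algebraic_uniform_roe_algebra d)"
      using unital_star_subalgebra_hull
      unfolding algebraic_uniform_roe_algebra_def unital_star_subalgebra_def star_subalgebra_def by blast
    show "W \<subseteq> algebraic_uniform_roe_algebra d"
      unfolding W_def by (rule complex_vector.span_minimal[OF _ sr]) (use Emem in auto)
    show "csubspace W" unfolding W_def by (rule complex_vector.subspace_span)
    show "\<exists>S. finite S \<and> cspan S = W" using F(1) W_def by blast
    show "W \<noteq> {0}"
    proof
      assume "W = {0}"
      then have "W = cspan {}" by (simp add: complex_vector.span_empty)
      then have "cdim W = 0"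
        using complex_vector.dim_span_eq_card_independent[OF complex_vector.independent_empty] by simp
      with dimW F(1,2) show False by simp
    qed
    fix a assume a: "a \<in> \<F>"
    let ?N = "cspan (E ` nbhd d R F)"
    have aE: "a * E x \<in> ?N" if x: "x \<in> F" for x
    proof -
      \<comment> \<open>Left multiplication changes only the target of the matrix unit. The result
        is again a combination of the \<open>E z\<close> because every \<open>z\<close> in the ball
        has the same base point as \<open>x\<close>.\<close>
      have "a * E x = (\<Sum>z\<in>metric_ball d R x. coef a z x *\<^sub>C E z)"
      proof (rule ell2_op_eq_on_deltaI)
        fix y
        have bz: "base z = base x" if "z \<in> metric_ball d R x" for z
        proof -
          have "d x z < \<infinity>" using that by (auto simp: metric_ball_def intro: le_less_trans)
          from base_eq[OF this] show ?thesis by simp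
        qed
        have "op_apply (\<Sum>z\<in>metric_ball d R x. coef a z x *\<^sub>C E z) (ell2_delta y)
            = (\<Sum>z\<in>metric_ball d R x. if y = base x then coef a z x *\<^sub>C ell2_delta z else 0)"
          unfolding sum_op_apply by (rule sum.cong) (auto simp: op_simps E bz)
        also have "\<dots> = op_apply (a * E x) (ell2_delta y)"
          by (simp add: op_simps E propagation_apply[OF Ra[OF a], of x, symmetric])
        finally show "op_apply (a * E x) (ell2_delta y)
            = op_apply (\<Sum>z\<in>metric_ball d R x. coef a z x *\<^sub>C E z) (ell2_delta y)" by simp
      qed
      moreover have "E z \<in> ?N" if "z \<in> metric_ball d R x" for z
        by (rule complex_vector.span_base) (use that x in \<open>auto simp: nbhd_def\<close>)
      ultimately show ?thesis
        by (simp add: complex_vector.span_sum complex_vector.span_scale)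
    qed
    have "csubspace {w. a * w \<in> ?N}"
      unfolding complex_vector.subspace_def
      by (auto simp: distrib_left mult_scaleC_right complex_vector.span_zero
          intro: complex_vector.span_add complex_vector.span_scale)
    then have "W \<subseteq> {w. a * w \<in> ?N}"
      unfolding W_def by (rule complex_vector.span_minimal[rotated]) (use aE in auto)
    moreover have "W \<subseteq> ?N"
      unfolding W_def by (rule complex_vector.span_mono) (use subset_nbhd[of R F] R in auto)
    ultimately have "{a * w + w' |w w'. w \<in> W \<and> w' \<in> W} \<subseteq> ?N"
      by (auto intro: complex_vector.span_add)
    then have "cdim {a * w + w' |w w'. w \<in> W \<and> w' \<in> W} \<le> card (E ` nbhd d R F)"
      by (rule complex_vector.dim_le_card) (use finite_nbhd F(1) in auto)
    also have "\<dots> \<le> card (nbhd d R F)" by (rule card_image_le) (use finite_nbhd F(1) in auto)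
    finally have "real (cdim {a * w + w' |w w'. w \<in> W \<and> w' \<in> W}) \<le> real (card (nbhd d R F))" by simp
    with F(3) dimW show "real (cdim {a * w + w' |w w'. w \<in> W \<and> w' \<in> W}) \<le> (1 + \<epsilon>) * real (cdim W)"
      by simp
  qed
qed

end

text \<open>Gaussian elimination, one equation and one unknown per induction step. Equations and
  unknowns are indexed by arbitrary finite sets because they will be pairs of a matrix index and a
  point of \<open>X\<close>.\<close>

lemma homogeneous_system:
  fixes A :: "'n \<Rightarrow> 'm \<Rightarrow> 'a::field"
  assumes "finite N" "finite M" "card N < card M"
  obtains c where "\<exists>m\<in>M. c m \<noteq> 0" "\<And>n. n \<in> N \<Longrightarrow> (\<Sum>m\<in>M. A n m * c m) = 0"
proof -
  have "\<exists>c. (\<exists>m\<in>M. c m \<noteq> 0) \<and> (\<forall>n\<in>N. (\<Sum>m\<in>M. A n m * c m) = 0)"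
    using assms
  proof (induction N arbitrary: M A rule: finite_induct)
    case empty
    then have "M \<noteq> {}" by auto
    then show ?case by (intro exI[of _ "\<lambda>_. 1"]) auto
  next
    case (insert n N)
    show ?case
    proof (cases "\<forall>m\<in>M. A n m = 0")
      case True
      have "card N < card M" using insert.hyps insert.prems by simp
      from insert.IH[OF insert.prems(1) this, of A]
      obtain c where "\<exists>m\<in>M. c m \<noteq> 0" "\<forall>n\<in>N. (\<Sum>m\<in>M. A n m * c m) = 0" by blast
      with True show ?thesis by (intro exI[of _ c]) auto
    next
      case False
      then obtain m0 where m0: "m0 \<in> M" "A n m0 \<noteq> 0" by blast
      let ?M = "M - {m0}" and ?A = "\<lambda>i m. A i m - A i m0 * A n m / A n m0"
      have "card N < card ?M" using insert.hyps insert.prems m0 by simp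
      from insert.IH[OF _ this, of ?A] insert.prems(1)
      obtain c where c: "\<exists>m\<in>?M. c m \<noteq> 0" "\<forall>i\<in>N. (\<Sum>m\<in>?M. ?A i m * c m) = 0" by blast
      define c' where "c' m = (if m = m0 then - (\<Sum>m\<in>?M. A n m * c m) / A n m0 else c m)" for m
      have split: "(\<Sum>m\<in>M. A i m * c' m) = A i m0 * c' m0 + (\<Sum>m\<in>?M. A i m * c m)" for i
        using insert.prems(1) m0(1) by (subst sum.remove[of _ m0]) (auto simp: c'_def)
      have "(\<Sum>m\<in>M. A n m * c' m) = 0" unfolding split using m0 by (simp add: c'_def)
      moreover have "(\<Sum>m\<in>M. A i m * c' m) = 0" if "i \<in> N" for i
      proof -
        have "(\<Sum>m\<in>?M. ?A i m * c m) = (\<Sum>m\<in>?M. A i m * c m) - A i m0 / A n m0 * (\<Sum>m\<in>?M. A n m * c m)"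
          by (simp add: sum_subtractf sum_distrib_left algebra_simps)
        then show ?thesis unfolding split using c(2) that by (simp add: c'_def algebra_simps)
      qed
      moreover have "\<exists>m\<in>M. c' m \<noteq> 0" using c(1) by (auto simp: c'_def)
      ultimately show ?thesis by blast
    qed
  qed
  then show ?thesis using that by blast
qed

context roe_rep begin

text \<open>If \<open>S\<close> approximates \<open>X\<close> inside the translation algebra, then \<open>S\<close> maps functions on a
  Folner set \<open>F\<close> to functions on a neighbourhood of nearly the same size, hence has a kernel
  vector there by counting dimensions; but \<open>Y S\<close> is close to the identity.\<close>

lemma rank_condition:
  fixes X Y :: "nat \<Rightarrow> nat \<Rightarrow> 'a"
  assumes am: "amenable_metric d" and "q < p"
    and YX: "\<And>i j. i < p \<Longrightarrow> j < p \<Longrightarrow> (\<Sum>l<q. Y i l * X l j) = (if i = j then 1 else 0)"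
  shows False
proof -
  define K where "K = (\<Sum>i<p. \<Sum>l<q. norm (Y i l))"
  have K: "K \<ge> 0" unfolding K_def by (intro sum_nonneg) auto
  \<comment> \<open>The tolerance is such that \<open>K * e < 1\<close>: replacing \<open>X\<close>
    by an approximation changes the product with \<open>Y\<close> by a strict contraction for the
    sum of the norms.\<close>
  define e where "e = 1 / (K + 1)"
  have e: "e > 0" "K * e < 1" using K by (auto simp: e_def field_simps)
  have "\<exists>T. T \<in> CU \<and> norm (\<iota> T - X l j) < e" for l j using approx[OF e(1), of "X l j"] by blast
  then obtain S where S: "\<And>l j. S l j \<in> CU" "\<And>l j. norm (\<iota> (S l j) - X l j) < e" by metis
  have "\<exists>r. propagation_le d r (S l j)" for l j
    using S(1) translation_algebra_finite_propagation unfolding finite_propagation_def by blast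
  then obtain r where r: "\<And>l j. propagation_le d (r l j) (S l j)" by metis
  define R where "R = Max (insert 1 ((\<lambda>(l, j). r l j) ` ({..<q} \<times> {..<p})))"
  have "1 \<le> R" unfolding R_def by (rule Max_ge) auto
  then have R: "R > 0" by simp
  have RS: "propagation_le d R (S l j)" if "l < q" "j < p" for l j
  proof (rule propagation_le_mono[OF r])
    show "r l j \<le> R" unfolding R_def by (rule Max_ge) (use that in auto)
  qed
  \<comment> \<open>With this tolerance \<open>q\<close> copies of the neighbourhood have fewer
    points than \<open>q + 1 \<le> p\<close> copies of \<open>F\<close>, since
    \<open>q * (1 + 1 / (q + 1)) < q + 1\<close>.\<close>
  have "1 / (real q + 1) > 0" by simp
  then obtain F where F: "finite F" "F \<noteq> {}"
      "real (card (nbhd d R F)) \<le> (1 + 1 / (real q + 1)) * real (card F)"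
    using card_nbhd_le[OF am R] by blast
  have cF: "real (card F) > 0" using F by (simp add: card_gt_0_iff)
  have "real q * real (card (nbhd d R F)) \<le> real q * ((1 + 1 / (real q + 1)) * real (card F))"
    using F(3) by (intro mult_left_mono) auto
  also have "\<dots> = (real q + real q / (real q + 1)) * real (card F)" by (simp add: algebra_simps)
  also have "\<dots> < (real q + 1) * real (card F)"
    using cF by (intro mult_strict_right_mono add_strict_left_mono) (auto simp: field_simps)
  also have "\<dots> \<le> real p * real (card F)" using \<open>q < p\<close> by (intro mult_right_mono) auto
  finally have card: "q * card (nbhd d R F) < p * card F"
    unfolding of_nat_mult[symmetric] of_nat_less_iff .
  have "finite ({..<q} \<times> nbhd d R F)" "finite ({..<p} \<times> F)"
    "card ({..<q} \<times> nbhd d R F) < card ({..<p} \<times> F)"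
    using F(1) finite_nbhd card by (auto simp: card_cartesian_product)
  then obtain c where c: "\<exists>m\<in>{..<p} \<times> F. c m \<noteq> 0"
      "\<And>n. n \<in> {..<q} \<times> nbhd d R F \<Longrightarrow>
        (\<Sum>m\<in>{..<p} \<times> F. coef (S (fst n) (fst m)) (snd n) (snd m) * c m) = 0"
    using homogeneous_system[of "{..<q} \<times> nbhd d R F" "{..<p} \<times> F"
        "\<lambda>n m. coef (S (fst n) (fst m)) (snd n) (snd m)"] by blast
  define v where "v j = (\<Sum>x\<in>F. c (j, x) *\<^sub>C ell2_delta x)" for j
  have v: "ell2_fun (v j) x = (if x \<in> F then c (j, x) else 0)" for j x
    using F(1) by (simp add: v_def ell2_simps if_distrib[of "\<lambda>z. _ * z"] sum.delta cong: if_cong)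
  have Sv: "(\<Sum>j<p. op_apply (S l j) (v j)) = 0" if l: "l < q" for l
  proof (rule ell2_eqI)
    fix y
    have "ell2_fun (\<Sum>j<p. op_apply (S l j) (v j)) y = (\<Sum>j<p. \<Sum>x\<in>F. coef (S l j) y x * c (j, x))"
      unfolding v_def op_apply_sum op_apply_scaleC ell2_fun_sum scaleC_ell2.rep_eq coef_def
      by (simp add: mult.commute)
    also have "\<dots> = (\<Sum>m\<in>{..<p} \<times> F. coef (S l (fst m)) y (snd m) * c m)"
      by (simp add: sum.cartesian_product split_beta)
    also have "\<dots> = 0"
    proof (cases "y \<in> nbhd d R F")
      case True
      with c(2)[of "(l, y)"] l show ?thesis by simp
    next
      case False
      have "coef (S l j) y x = 0" if "j < p" "x \<in> F" for j x
      proof (rule ccontr)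
        assume "coef (S l j) y x \<noteq> 0"
        then have "d y x \<le> ennreal R" using RS[OF l that(1)] by (simp add: propagation_le_def)
        then have "y \<in> nbhd d R F" using that(2) by (auto simp: nbhd_def metric_ball_def d_sym[of y x])
        with False show False by simp
      qed
      then show ?thesis by (intro sum.neutral) auto
    qed
    finally show "ell2_fun (\<Sum>j<p. op_apply (S l j) (v j)) y = ell2_fun 0 y" by (simp add: ell2_simps)
  qed
  define V where "V = (\<Sum>j<p. norm (v j))"
  have "norm (v i) \<le> (\<Sum>l<q. norm (Y i l)) * (e * V)" if i: "i < p" for i
  proof -
    have "v i = (\<Sum>j<p. if i = j then v j else 0)" using i by simp
    also have "\<dots> = (\<Sum>j<p. op_apply (rep (\<Sum>l<q. Y i l * X l j)) (v j))"
      by (rule sum.cong) (use i YX in \<open>auto simp: rep_one rep_zero op_simps\<close>)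
    also have "\<dots> = (\<Sum>j<p. \<Sum>l<q. op_apply (rep (Y i l)) (op_apply (rep (X l j)) (v j)))"
      by (simp add: rep_sum rep_mult sum_op_apply op_simps)
    also have "\<dots> = (\<Sum>l<q. op_apply (rep (Y i l)) (\<Sum>j<p. op_apply (rep (X l j)) (v j)))"
      unfolding op_apply_sum by (rule sum.swap)
    \<comment> \<open>The approximating matrix \<open>S\<close> kills \<open>v\<close>, so
      subtracting it costs nothing and leaves only the small error \<open>X - S\<close>.\<close>
    also have "\<dots> = (\<Sum>l<q. op_apply (rep (Y i l)) (\<Sum>j<p. op_apply (rep (X l j - \<iota> (S l j))) (v j)))"
      by (rule sum.cong) (auto simp: rep_diff rep_\<iota> S op_apply_minus_op sum_subtractf Sv)
    finally have "norm (v i) = norm (\<Sum>l<q. op_apply (rep (Y i l)) (\<Sum>j<p. op_apply (rep (X l j - \<iota> (S l j))) (v j)))"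
      by (rule arg_cong)
    also have "\<dots> \<le> (\<Sum>l<q. norm (op_apply (rep (Y i l)) (\<Sum>j<p. op_apply (rep (X l j - \<iota> (S l j))) (v j))))"
      by (rule norm_sum)
    also have "\<dots> \<le> (\<Sum>l<q. norm (Y i l) * (e * V))"
    proof (rule sum_mono)
      fix l
      have "norm (\<Sum>j<p. op_apply (rep (X l j - \<iota> (S l j))) (v j)) \<le> (\<Sum>j<p. e * norm (v j))"
      proof (rule sum_norm_le)
        fix j
        have "norm (op_apply (rep (X l j - \<iota> (S l j))) (v j)) \<le> norm (X l j - \<iota> (S l j)) * norm (v j)"
          by (rule norm_rep_le)
        also have "\<dots> \<le> e * norm (v j)"
          using S(2)[of l j] by (intro mult_right_mono) (auto simp: norm_minus_commute)
        finally show "norm (op_apply (rep (X l j - \<iota> (S l j))) (v j)) \<le> e * norm (v j)" .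
      qed
      then have "norm (\<Sum>j<p. op_apply (rep (X l j - \<iota> (S l j))) (v j)) \<le> e * V"
        by (simp add: V_def sum_distrib_left)
      then show "norm (op_apply (rep (Y i l)) (\<Sum>j<p. op_apply (rep (X l j - \<iota> (S l j))) (v j)))
          \<le> norm (Y i l) * (e * V)"
        by (intro order_trans[OF norm_rep_le] mult_left_mono) auto
    qed
    also have "\<dots> = (\<Sum>l<q. norm (Y i l)) * (e * V)" by (rule sum_distrib_right[symmetric])
    finally show ?thesis .
  qed
  \<comment> \<open>Summing over \<open>i\<close> gives \<open>V \<le> K * e * V\<close> with
    \<open>K * e < 1\<close>, which forces the kernel vector to vanish.\<close>
  then have "V \<le> (\<Sum>i<p. (\<Sum>l<q. norm (Y i l)) * (e * V))" unfolding V_def by (intro sum_mono) auto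
  also have "\<dots> = (K * e) * V" by (simp add: K_def sum_distrib_right mult.assoc)
  finally have "(1 - K * e) * V \<le> 0" by (simp add: algebra_simps)
  then have "V \<le> 0" using e(2) by (simp add: mult_le_0_iff)
  obtain j x where jx: "j < p" "x \<in> F" "c (j, x) \<noteq> 0" using c(1) by auto
  have "norm (v j) \<le> V" unfolding V_def by (rule member_le_sum) (use jx in auto)
  with \<open>V \<le> 0\<close> have "norm (v j) \<le> 0" by linarith
  then have "v j = 0" by simp
  then have "ell2_fun (v j) x = 0" by (simp add: ell2_simps)
  with v[of j x] jx show False by simp
qed

end

section \<open>Folner approximation and traces\<close>

text \<open>A square in place of a disc: as a continuous image of a product of intervals it is
  compact at once.\<close>

definition complex_box :: "real \<Rightarrow> complex set"
  where "complex_box r = (\<lambda>p. complex_of_real (fst p) + \<i> * complex_of_real (snd p)) ` ({-r..r} \<times> {-r..r})"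

lemma compact_complex_box: "compact (complex_box r)"
  unfolding complex_box_def
  by (intro compact_continuous_image compact_Times compact_Icc continuous_intros)

lemma mem_complex_box: "cmod z \<le> r \<Longrightarrow> z \<in> complex_box r"
  unfolding complex_box_def
  using abs_Re_le_cmod[of z] abs_Im_le_cmod[of z]
  by (intro image_eqI[of _ _ "(Re z, Im z)"]) (simp_all add: complex_eq[symmetric] abs_le_iff)

lemma closed_nonneg_Reals: "closed (\<real>\<^sub>\<ge>\<^sub>0 :: complex set)"
proof -
  have "(\<real>\<^sub>\<ge>\<^sub>0 :: complex set) = {z. 0 \<le> Re z} \<inter> {z. Im z = 0}"
    by (auto simp: complex_nonneg_Reals_iff)
  also have "closed \<dots>"
    by (intro closed_Int closed_Collect_le closed_Collect_eq continuous_intros)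
  finally show ?thesis .
qed

section \<open>The normalized Hilbert-Schmidt norm and the normalized trace\<close>

lemma norm_2_tr_eq:
  assumes "M \<in> carrier_mat k k"
  shows "norm_2_tr M = sqrt ((\<Sum>i<k. \<Sum>j<k. (cmod (M $$ (j, i)))\<^sup>2) / real k)"
proof -
  have e: "(mat_adjoint M * M) $$ (i, i) = complex_of_real (\<Sum>j<k. (cmod (M $$ (j, i)))\<^sup>2)" if "i < k" for i
  proof -
    have "(mat_adjoint M * M) $$ (i, i) = (\<Sum>j<k. cnj (M $$ (j, i)) * M $$ (j, i))"
      using assms that by (simp add: mat_adjoint_def scalar_prod_def lessThan_atLeast0)
    also have "\<dots> = (\<Sum>j<k. complex_of_real ((cmod (M $$ (j, i)))\<^sup>2))"
      by (simp add: complex_norm_square mult.commute del: of_real_power)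
    finally show ?thesis by simp
  qed
  have d: "dim_row (mat_adjoint M * M) = k" using assms by (simp add: mat_adjoint_def)
  have "normalized_trace (mat_adjoint M * M)
      = complex_of_real ((\<Sum>i<k. \<Sum>j<k. (cmod (M $$ (j, i)))\<^sup>2) / real k)"
    unfolding normalized_trace_def d by (simp add: e)
  then show ?thesis by (simp only: norm_2_tr_def Re_complex_of_real)
qed

lemma norm_2_tr_square:
  assumes "M \<in> carrier_mat k k"
  shows "(norm_2_tr M)\<^sup>2 = (\<Sum>i<k. \<Sum>j<k. (cmod (M $$ (j, i)))\<^sup>2) / real k"
  unfolding norm_2_tr_eq[OF assms] by (simp add: sum_nonneg)

lemma norm_2_tr_nonneg: "M \<in> carrier_mat k k \<Longrightarrow> norm_2_tr M \<ge> 0"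
  by (simp add: norm_2_tr_eq sum_nonneg)

text \<open>Cauchy-Schwarz against the identity matrix. For \<open>k = 0\<close> both sides are 0
  because division by 0 yields 0.\<close>

lemma cmod_normalized_trace_le:
  assumes M: "M \<in> carrier_mat k k"
  shows "cmod (normalized_trace M) \<le> norm_2_tr M"
proof (rule power2_le_imp_le[OF _ norm_2_tr_nonneg[OF M]])
  show "(cmod (normalized_trace M))\<^sup>2 \<le> (norm_2_tr M)\<^sup>2"
  proof (cases "k = 0")
    case True
    then show ?thesis using M by (simp add: normalized_trace_def)
  next
    case False
    have "cmod (\<Sum>i<k. M $$ (i, i)) \<le> (\<Sum>i<k. 1 * cmod (M $$ (i, i)))"
      by (simp add: norm_sum)
    then have "(cmod (\<Sum>i<k. M $$ (i, i)))\<^sup>2 \<le> (\<Sum>i<k. 1 * cmod (M $$ (i, i)))\<^sup>2"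
      by (rule power_mono) simp
    also have "\<dots> \<le> (\<Sum>i<k. 1\<^sup>2) * (\<Sum>i<k. (cmod (M $$ (i, i)))\<^sup>2)"
      by (rule Cauchy_Schwarz_ineq_sum)
    also have "\<dots> \<le> real k * (\<Sum>i<k. \<Sum>j<k. (cmod (M $$ (j, i)))\<^sup>2)"
    proof -
      have "(cmod (M $$ (i, i)))\<^sup>2 \<le> (\<Sum>j<k. (cmod (M $$ (j, i)))\<^sup>2)" if "i < k" for i
        by (rule member_le_sum[of i "{..<k}" "\<lambda>j. (cmod (M $$ (j, i)))\<^sup>2"]) (use that in auto)
      then have "(\<Sum>i<k. (cmod (M $$ (i, i)))\<^sup>2) \<le> (\<Sum>i<k. \<Sum>j<k. (cmod (M $$ (j, i)))\<^sup>2)"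
        by (intro sum_mono) auto
      then show ?thesis by (simp add: mult_left_mono)
    qed
    finally have "(cmod (\<Sum>i<k. M $$ (i, i)))\<^sup>2 / (real k)\<^sup>2
        \<le> real k * (\<Sum>i<k. \<Sum>j<k. (cmod (M $$ (j, i)))\<^sup>2) / (real k)\<^sup>2"
      by (rule divide_right_mono) simp
    also have "\<dots> = (norm_2_tr M)\<^sup>2"
      using False unfolding norm_2_tr_square[OF M] by (simp add: power2_eq_square)
    also have "(cmod (\<Sum>i<k. M $$ (i, i)))\<^sup>2 / (real k)\<^sup>2 = (cmod (normalized_trace M))\<^sup>2"
      using M by (simp add: normalized_trace_def norm_divide power_divide)
    finally show ?thesis .
  qed
qed

lemma normalized_trace_comm:
  assumes "A \<in> carrier_mat k k" "B \<in> carrier_mat k k"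
  shows "normalized_trace (A * B) = normalized_trace (B * A)"
proof -
  have "(\<Sum>i<k. (A * B) $$ (i, i)) = (\<Sum>i<k. \<Sum>j<k. A $$ (i, j) * B $$ (j, i))"
    using assms by (simp add: scalar_prod_def lessThan_atLeast0)
  also have "\<dots> = (\<Sum>j<k. \<Sum>i<k. B $$ (j, i) * A $$ (i, j))"
    by (subst sum.swap) (simp add: mult.commute)
  also have "\<dots> = (\<Sum>i<k. (B * A) $$ (i, i))"
    using assms by (simp add: scalar_prod_def lessThan_atLeast0)
  finally show ?thesis using assms by (simp add: normalized_trace_def)
qed

lemma normalized_trace_diff:
  assumes "A \<in> carrier_mat k k" "B \<in> carrier_mat k k"
  shows "normalized_trace (A - B) = normalized_trace A - normalized_trace B"
  using assms by (simp add: normalized_trace_def sum_subtractf diff_divide_distrib)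

text \<open>The trace of \<open>\<phi> a * \<phi> b\<close> is symmetric in \<open>a\<close> and
  \<open>b\<close>, so only the two multiplicativity errors remain. Hence Folner maps have
  asymptotically tracial traces.\<close>

lemma asymptotic_trace:
  fixes \<phi> :: "'a::pre_cstar_algebra \<Rightarrow> complex mat"
  assumes "\<And>a. \<phi> a \<in> carrier_mat k k"
  shows "cmod (normalized_trace (\<phi> (a * b)) - normalized_trace (\<phi> (b * a)))
    \<le> norm_2_tr (\<phi> (a * b) - \<phi> a * \<phi> b) + norm_2_tr (\<phi> (b * a) - \<phi> b * \<phi> a)"
proof -
  let ?A = "normalized_trace (\<phi> (a * b) - \<phi> a * \<phi> b)" and ?B = "normalized_trace (\<phi> (b * a) - \<phi> b * \<phi> a)"
  have c: "\<phi> x * \<phi> y \<in> carrier_mat k k" for x y by (rule mult_carrier_mat[OF assms assms])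
  have "normalized_trace (\<phi> (a * b)) - normalized_trace (\<phi> (b * a)) = ?A - ?B"
    using normalized_trace_comm[OF assms assms, of a b]
    by (simp add: normalized_trace_diff[OF assms c])
  also have "cmod \<dots> \<le> cmod ?A + cmod ?B" by (rule norm_triangle_ineq4)
  also have "\<dots> \<le> norm_2_tr (\<phi> (a * b) - \<phi> a * \<phi> b) + norm_2_tr (\<phi> (b * a) - \<phi> b * \<phi> a)"
    by (intro add_mono cmod_normalized_trace_le[where k = k] minus_carrier_mat c)
  finally show ?thesis .
qed

section \<open>Compression to finite sets\<close>

definition cut :: "'x set \<Rightarrow> 'x ell2 \<Rightarrow> 'x ell2"
  where "cut F f = (\<Sum>x\<in>F. ell2_fun f x *\<^sub>C ell2_delta x)"

lemma cut_fun: "finite F \<Longrightarrow> ell2_fun (cut F f) x = (if x \<in> F then ell2_fun f x else 0)"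
  by (simp add: cut_def ell2_simps if_distrib[of "\<lambda>z. _ * z"] sum.delta cong: if_cong)

lemma norm_diff_cut_le:
  assumes "finite F"
  shows "norm (f - cut F f) \<le> norm f"
proof (rule ell2_norm_le_finite_sums)
  fix G :: "'a set" assume "finite G"
  have "(\<Sum>x\<in>G. (cmod (ell2_fun (f - cut F f) x))\<^sup>2) \<le> (\<Sum>x\<in>G. (cmod (ell2_fun f x))\<^sup>2)"
    by (rule sum_mono) (simp add: ell2_fun_diff cut_fun[OF assms])
  also have "\<dots> \<le> (norm f)\<^sup>2" by (rule ell2_sum_le_norm) fact
  finally show "(\<Sum>x\<in>G. (cmod (ell2_fun (f - cut F f) x))\<^sup>2) \<le> (norm f)\<^sup>2" .
qed simp

lemma norm_add_square_le: "(norm (u + v))\<^sup>2 \<le> 2 * (norm u)\<^sup>2 + 2 * (norm v)\<^sup>2"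
proof -
  have "(norm (u + v))\<^sup>2 \<le> (norm u + norm v)\<^sup>2" by (rule power_mono[OF norm_triangle_ineq]) simp
  also have "\<dots> \<le> 2 * (norm u)\<^sup>2 + 2 * (norm v)\<^sup>2"
    using sum_squares_bound[of "norm u" "norm v"] by (simp add: power2_sum)
  finally show ?thesis .
qed

context roe_rep begin

text \<open>The completion is itself a pre-C*-algebra containing the translation algebra densely, so
  the representation extends to it; positive elements become squares there.\<close>

lemma roe_rep_completion: "roe_rep d (\<lambda>T. completion_embed (\<iota> T))"
proof (intro roe_rep.intro bdd_geometry_axioms roe_rep_axioms.intro)
  show "(\<lambda>T. completion_embed (\<iota> T))
      \<in> star_hom (star_algebra_on CU) (star_algebra_on (UNIV :: 'a cstar_completion set))"
    by (simp add: star_hom_def star_algebra_on_def \<iota>_add \<iota>_mult \<iota>_scaleC \<iota>_adj completion_embed_add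
        completion_embed_mult completion_embed_scaleC completion_embed_adj)
  have ie: "inj (completion_embed :: 'a \<Rightarrow> _)"
  proof (rule injI)
    fix a b :: 'a assume "completion_embed a = completion_embed b"
    then have "norm (completion_embed (a - b)) = 0" by (simp add: completion_embed_diff)
    then show "a = b" by (simp add: norm_completion_embed)
  qed
  show "inj_on (\<lambda>T. completion_embed (\<iota> T)) CU"
    by (rule inj_onI) (rule inj_onD[OF inj injD[OF ie]])
  have "y \<in> closure ((\<lambda>T. completion_embed (\<iota> T)) ` CU)" for y :: "'a cstar_completion"
    unfolding closure_approachable
  proof (intro allI impI)
    fix e :: real assume e: "e > 0"
    have "y \<in> closure (range completion_embed)" by (simp add: completion_embed_dense)
    then have "\<forall>e>0. \<exists>z\<in>range completion_embed. dist z y < e" by (simp only: closure_approachable)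
    from this[rule_format, OF half_gt_zero[OF e]]
    obtain a where a: "dist (completion_embed a) y < e / 2" by auto
    obtain T where T: "T \<in> CU" "norm (\<iota> T - a) < e / 2" using approx[OF half_gt_zero[OF e]] by blast
    have "dist (completion_embed (\<iota> T)) y \<le> dist (completion_embed (\<iota> T)) (completion_embed a) + dist (completion_embed a) y"
      by (rule dist_triangle)
    also have "dist (completion_embed (\<iota> T)) (completion_embed a) = norm (\<iota> T - a)"
      by (simp add: dist_norm completion_embed_diff[symmetric] norm_completion_embed)
    finally have "dist (completion_embed (\<iota> T)) y < e" using a T(2) by simp
    with T(1) show "\<exists>z\<in>(\<lambda>T. completion_embed (\<iota> T)) ` CU. dist z y < e"
      by (intro bexI[of _ "completion_embed (\<iota> T)"]) simp_all
  qed
  then show "closure ((\<lambda>T. completion_embed (\<iota> T)) ` CU) = UNIV" by (intro UNIV_eq_I[symmetric])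
qed

lemma rep_positive:
  assumes "a \<in> positive_cone"
  shows "cinner f (op_apply (rep a) f) \<in> \<real>\<^sub>\<ge>\<^sub>0"
proof -
  interpret C: roe_rep d "\<lambda>T. completion_embed (\<iota> T)" by (rule roe_rep_completion)
  obtain y where y: "completion_embed a = adj y * y" using assms by (auto simp: positive_cone_def)
  obtain T where T: "\<And>n. T n \<in> CU" "(\<lambda>n. \<iota> (T n)) \<longlonglongrightarrow> a" using approx_seq by blast
  have "(\<lambda>n. norm (\<iota> (T n) - a)) \<longlonglongrightarrow> 0"
    using tendsto_norm_zero[OF LIM_zero[OF T(2)]] .
  then have "(\<lambda>n. norm (completion_embed (\<iota> (T n)) - completion_embed a)) \<longlonglongrightarrow> 0"
    by (simp add: completion_embed_diff[symmetric] norm_completion_embed)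
  then have "(\<lambda>n. completion_embed (\<iota> (T n))) \<longlonglongrightarrow> completion_embed a"
    by (rule LIM_zero_cancel[OF tendsto_norm_zero_cancel])
  \<comment> \<open>Both representations are strong limits of the same sequence \<open>T n\<close>,
    so they agree on \<open>a\<close>; in the completion \<open>a\<close> is the square
    \<open>adj y * y\<close>.\<close>
  from C.rep_tendsto[OF T(1) this, of f]
  have "op_apply (rep a) f = op_apply (C.rep (adj y * y)) f"
    unfolding y[symmetric] by (rule LIMSEQ_unique[OF rep_tendsto[OF T]])
  then have "cinner f (op_apply (rep a) f) = complex_of_real ((norm (op_apply (C.rep y) f))\<^sup>2)"
    by (simp add: C.rep_mult C.rep_adj op_simps cinner_adj_right cinner_self_norm del: of_real_power)
  then show ?thesis by (simp only: nonneg_Reals_of_real_iff) simp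
qed

definition compression :: "nat \<Rightarrow> (nat \<Rightarrow> 'x) \<Rightarrow> 'a \<Rightarrow> complex mat"
  where "compression k e a = mat k k (\<lambda>(i, j). coef (rep a) (e i) (e j))"

text \<open>The quadratic form of the block matrix at \<open>v\<close> collapses to the sum over
  \<open>l\<close> of the values of \<open>rep (A l)\<close> at the vectors \<open>h l\<close>,
  which collect the coordinates of \<open>v\<close> after applying the \<open>X l\<close>.\<close>

lemma compression_ucp:
  assumes e: "inj_on e {..<k}"
  shows "unital_completely_positive k (compression k e)"
  unfolding unital_completely_positive_def
proof (intro conjI allI)
  show "compression k e a \<in> carrier_mat k k" for a by (simp add: compression_def)
  show "compression k e (a + b) = compression k e a + compression k e b" for a b
    by (rule eq_matI) (auto simp: compression_def rep_add coef_simps)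
  show "compression k e (c *\<^sub>C a) = c \<cdot>\<^sub>m compression k e a" for c a
    by (rule eq_matI) (auto simp: compression_def rep_scaleC coef_simps)
  show "compression k e 1 = 1\<^sub>m k"
    by (rule eq_matI) (use e in \<open>auto simp: compression_def rep_one coef_simps inj_on_def\<close>)
  show "completely_positive k (compression k e)"
    unfolding completely_positive_def positive_mat_def
  proof (intro allI impI ballI conjI)
    fix m :: nat and M :: "'a mat"
    assume "m \<ge> 1" and "M \<in> matrix_positive_cone m"
    from this(2) obtain r :: nat and A X where M: "M = mat m m (\<lambda>(i, j). \<Sum>l<r. adj (X l i) * A l * X l j)"
      and A: "\<forall>l<r. A l \<in> positive_cone"
      unfolding matrix_positive_cone_def by blast
    let ?P = "entrywise_mat m k (compression k e) M" and ?n = "m * k"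
    show P: "?P \<in> carrier_mat ?n ?n" by (simp add: entrywise_mat_def)
    fix v :: "complex vec" assume v: "v \<in> carrier_vec ?n"
    define g where "g p = (ell2_delta (e (p mod k)) :: 'x ell2)" for p
    define h where "h l = (\<Sum>q<?n. v $ q *\<^sub>C op_apply (rep (X l (q div k))) (g q))" for l
    have Ppq: "?P $$ (p, q) = (\<Sum>l<r. cinner (op_apply (rep (X l (p div k))) (g p))
        (op_apply (rep (A l)) (op_apply (rep (X l (q div k))) (g q))))" if "p < ?n" "q < ?n" for p q
    proof -
      have "k > 0" using that(1) by (cases k) auto
      then have b: "p div k < m" "q div k < m" "p mod k < k" "q mod k < k"
        using that by (auto simp: less_mult_imp_div_less)
      have "?P $$ (p, q) = coef (rep (\<Sum>l<r. adj (X l (p div k)) * A l * X l (q div k))) (e (p mod k)) (e (q mod k))"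
        using that b by (simp add: entrywise_mat_def M compression_def)
      also have "\<dots> = cinner (g p) (\<Sum>l<r. op_apply (rep (adj (X l (p div k)) * A l * X l (q div k))) (g q))"
        by (simp add: coef_def g_def cinner_delta_left[symmetric] rep_sum sum_op_apply)
      also have "\<dots> = (\<Sum>l<r. cinner (op_apply (rep (X l (p div k))) (g p))
          (op_apply (rep (A l)) (op_apply (rep (X l (q div k))) (g q))))"
        by (simp add: cinner_sum_right rep_mult rep_adj op_simps cinner_adj_right)
      finally show ?thesis .
    qed
    have "(?P *\<^sub>v v) \<bullet>c v = (\<Sum>p<?n. (\<Sum>q<?n. ?P $$ (p, q) * v $ q) * cnj (v $ p))"
      using P v by (simp add: scalar_prod_def mult_mat_vec_def lessThan_atLeast0)
    also have "\<dots> = (\<Sum>p<?n. \<Sum>q<?n. \<Sum>l<r. cnj (v $ p) * (v $ q * cinner (op_apply (rep (X l (p div k))) (g p))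
        (op_apply (rep (A l)) (op_apply (rep (X l (q div k))) (g q)))))"
      by (simp add: Ppq sum_distrib_right sum_distrib_left mult.commute mult.left_commute)
    also have "\<dots> = (\<Sum>l<r. \<Sum>p<?n. \<Sum>q<?n. cnj (v $ p) * (v $ q * cinner (op_apply (rep (X l (p div k))) (g p))
        (op_apply (rep (A l)) (op_apply (rep (X l (q div k))) (g q)))))"
      by (subst sum.swap[of _ "{..<r}"], subst sum.swap[of _ "{..<r}"]) simp
    also have "\<dots> = (\<Sum>l<r. cinner (h l) (op_apply (rep (A l)) (h l)))"
      unfolding h_def op_apply_sum op_apply_scaleC cinner_sum_left cinner_sum_right
        cinner_scaleC_left cinner_scaleC_right
      by (rule sum.cong[OF refl], subst sum.swap) (simp add: sum_distrib_left mult.left_commute)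
    also have "\<dots> \<in> \<real>\<^sub>\<ge>\<^sub>0"
    proof -
      have "(\<Sum>l\<in>L. cinner (h l) (op_apply (rep (A l)) (h l))) \<in> \<real>\<^sub>\<ge>\<^sub>0" if "L \<subseteq> {..<r}" for L
        using finite_subset[OF that finite_lessThan] that
      proof (induction L rule: finite_induct)
        case (insert l L)
        then have "A l \<in> positive_cone" using A by auto
        then have "cinner (h l) (op_apply (rep (A l)) (h l)) \<in> \<real>\<^sub>\<ge>\<^sub>0" by (rule rep_positive)
        with insert show ?case by simp
      qed simp
      then show ?thesis by blast
    qed
    finally show "(?P *\<^sub>v v) \<bullet>c v \<in> \<real>\<^sub>\<ge>\<^sub>0" .
  qed
qed

text \<open>With \<open>P\<close> the projection onto functions on \<open>F\<close>, this is the
  squared normalized Hilbert-Schmidt norm of \<open>(1 - P) * rep b * P\<close>: the part of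
  \<open>b\<close> that leaves \<open>F\<close>.\<close>

definition defect :: "'x set \<Rightarrow> 'a \<Rightarrow> real"
  where "defect F b = (\<Sum>z\<in>F. (norm (op_apply (rep b) (ell2_delta z) - cut F (op_apply (rep b) (ell2_delta z))))\<^sup>2)
    / real (card F)"

text \<open>The error of multiplicativity is the corner of \<open>rep a * (1 - P) * rep b\<close>
  for the projection \<open>P\<close> onto functions on \<open>F\<close>. The left factor is bounded
  by the norm of \<open>a\<close>, the rest is the defect.\<close>

lemma compression_mult_defect:
  assumes e: "bij_betw e {..<k} F"
  shows "(norm_2_tr (compression k e (a * b) - compression k e a * compression k e b))\<^sup>2 \<le> (norm a)\<^sup>2 * defect F b"
proof -
  let ?\<phi> = "compression k e"
  define u where "u z = op_apply (rep b) (ell2_delta z) - cut F (op_apply (rep b) (ell2_delta z))" for z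
  have fF: "finite F" and kF: "card F = k"
    using bij_betw_finite[OF e] bij_betw_same_card[OF e] by simp_all
  let ?M = "?\<phi> (a * b) - ?\<phi> a * ?\<phi> b"
  have M: "?M \<in> carrier_mat k k" by (simp add: compression_def minus_mat_def)
  have ent: "?M $$ (j, i) = ell2_fun (op_apply (rep a) (u (e i))) (e j)" if "i < k" "j < k" for i j
  proof -
    have "(?\<phi> a * ?\<phi> b) $$ (j, i) = (\<Sum>l<k. coef (rep a) (e j) (e l) * coef (rep b) (e l) (e i))"
      using that by (simp add: compression_def scalar_prod_def lessThan_atLeast0)
    also have "\<dots> = (\<Sum>y\<in>F. coef (rep a) (e j) y * coef (rep b) y (e i))"
      by (rule sum.reindex_bij_betw[OF e])
    also have "\<dots> = ell2_fun (op_apply (rep a) (cut F (op_apply (rep b) (ell2_delta (e i))))) (e j)"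
      unfolding cut_def op_apply_sum op_apply_scaleC ell2_fun_sum scaleC_ell2.rep_eq coef_def
      by (simp add: mult.commute)
    finally have "(?\<phi> a * ?\<phi> b) $$ (j, i) = ell2_fun (op_apply (rep a) (cut F (op_apply (rep b) (ell2_delta (e i))))) (e j)" .
    moreover have "?\<phi> (a * b) $$ (j, i) = ell2_fun (op_apply (rep a) (op_apply (rep b) (ell2_delta (e i)))) (e j)"
      using that by (simp add: compression_def rep_mult coef_def op_simps)
    moreover have "?M $$ (j, i) = ?\<phi> (a * b) $$ (j, i) - (?\<phi> a * ?\<phi> b) $$ (j, i)"
      by (rule index_minus_mat) (use that in \<open>simp_all add: compression_def\<close>)
    ultimately show ?thesis by (simp add: u_def op_apply_diff ell2_fun_diff)
  qed
  have "(\<Sum>i<k. \<Sum>j<k. (cmod (?M $$ (j, i)))\<^sup>2) = (\<Sum>i<k. \<Sum>j<k. (cmod (ell2_fun (op_apply (rep a) (u (e i))) (e j)))\<^sup>2)"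
    by (intro sum.cong refl) (use ent in simp)
  also have "\<dots> = (\<Sum>i<k. \<Sum>x\<in>F. (cmod (ell2_fun (op_apply (rep a) (u (e i))) x))\<^sup>2)"
    by (intro sum.cong refl sum.reindex_bij_betw[OF e])
  also have "\<dots> \<le> (\<Sum>i<k. (norm a)\<^sup>2 * (norm (u (e i)))\<^sup>2)"
  proof (rule sum_mono)
    fix i
    have "(\<Sum>x\<in>F. (cmod (ell2_fun (op_apply (rep a) (u (e i))) x))\<^sup>2) \<le> (norm (op_apply (rep a) (u (e i))))\<^sup>2"
      by (rule ell2_sum_le_norm[OF fF])
    also have "\<dots> \<le> (norm a * norm (u (e i)))\<^sup>2" by (rule power_mono[OF norm_rep_le]) simp
    finally show "(\<Sum>x\<in>F. (cmod (ell2_fun (op_apply (rep a) (u (e i))) x))\<^sup>2) \<le> (norm a)\<^sup>2 * (norm (u (e i)))\<^sup>2"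
      by (simp add: power_mult_distrib)
  qed
  also have "\<dots> = (norm a)\<^sup>2 * (\<Sum>z\<in>F. (norm (u z))\<^sup>2)"
    by (simp add: sum_distrib_left sum.reindex_bij_betw[OF e, of "\<lambda>z. (norm a)\<^sup>2 * (norm (u z))\<^sup>2"])
  finally show ?thesis
    unfolding norm_2_tr_square[OF M] defect_def kF u_def[symmetric]
    by (simp add: divide_right_mono)
qed

text \<open>A column of \<open>T\<close> at a point of \<open>F\<close> can leave \<open>F\<close>
  only if the point lies in the boundary, and each column is bounded by the norm of
  \<open>\<iota> T\<close>.\<close>

lemma defect_translation:
  assumes T: "T \<in> CU" "propagation_le d R T" and F: "finite F" "F \<noteq> {}"
    and bd: "finite (metric_boundary d S F)" "real (card (metric_boundary d S F)) \<le> \<epsilon> * real (card F)" and "R \<le> S"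
  shows "defect F (\<iota> T) \<le> (norm (\<iota> T))\<^sup>2 * \<epsilon>"
proof -
  let ?u = "\<lambda>z. op_apply T (ell2_delta z) - cut F (op_apply T (ell2_delta z))"
  have z: "?u z = 0" if "z \<in> F" "z \<notin> metric_boundary d S F" for z
  proof (rule ell2_eqI)
    fix x
    have "coef T x z = 0" if "x \<notin> F"
    proof (rule ccontr)
      assume "coef T x z \<noteq> 0"
      then have "d x z \<le> ennreal R" using T(2) by (simp add: propagation_le_def)
      also have "\<dots> \<le> ennreal S" by (rule ennreal_leI) fact
      finally have "d z x \<le> ennreal S" by (simp add: d_sym[of z x])
      from in_boundaryI[OF \<open>z \<in> F\<close> that this] \<open>z \<notin> metric_boundary d S F\<close> show False by simp
    qed
    then show "ell2_fun (?u z) x = ell2_fun 0 x"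
      by (simp add: ell2_fun_diff cut_fun[OF F(1)] coef_def zero_ell2.rep_eq)
  qed
  have le: "(norm (?u z))\<^sup>2 \<le> (norm (\<iota> T))\<^sup>2" for z
  proof (rule power_mono)
    have "norm (?u z) \<le> norm (op_apply T (ell2_delta z))" by (rule norm_diff_cut_le[OF F(1)])
    also have "\<dots> \<le> norm (\<iota> T) * norm (ell2_delta z :: 'x ell2)" by (rule norm_apply_le[OF T(1)])
    finally show "norm (?u z) \<le> norm (\<iota> T)" by simp
  qed simp
  have "(\<Sum>z\<in>F. (norm (?u z))\<^sup>2) \<le> (\<Sum>z\<in>F. if z \<in> metric_boundary d S F then (norm (\<iota> T))\<^sup>2 else 0)"
    by (rule sum_mono) (use z le in auto)
  also have "\<dots> = (norm (\<iota> T))\<^sup>2 * real (card (F \<inter> metric_boundary d S F))"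
    by (simp add: sum.inter_restrict[OF F(1), symmetric] mult.commute)
  also have "\<dots> \<le> (norm (\<iota> T))\<^sup>2 * real (card (metric_boundary d S F))"
    by (intro mult_left_mono of_nat_mono card_mono bd(1)) auto
  also have "\<dots> \<le> (norm (\<iota> T))\<^sup>2 * (\<epsilon> * real (card F))" by (rule mult_left_mono[OF bd(2)]) simp
  finally show ?thesis
    using F unfolding defect_def rep_\<iota>[OF T(1)] by (simp add: divide_le_eq card_gt_0_iff mult.assoc)
qed

text \<open>Because the defect averages over \<open>F\<close>, the error is controlled by the norm
  of \<open>b - c\<close> uniformly in \<open>F\<close>. This carries the estimate from the dense
  subalgebra to all of the algebra.\<close>

lemma defect_approx:
  assumes F: "finite F" "F \<noteq> {}"
  shows "defect F b \<le> 2 * defect F c + 2 * (norm (b - c))\<^sup>2"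
proof -
  define u where "u b z = op_apply (rep b) (ell2_delta z) - cut F (op_apply (rep b) (ell2_delta z))" for b z
  have "(norm (u b z))\<^sup>2 \<le> 2 * (norm (u c z))\<^sup>2 + 2 * (norm (b - c))\<^sup>2" for z
  proof -
    have "u b z = u c z + u (b - c) z"
      by (rule ell2_eqI)
         (simp add: u_def ell2_fun_diff plus_ell2.rep_eq cut_fun[OF F(1)] rep_diff op_apply_minus_op)
    then have "(norm (u b z))\<^sup>2 \<le> 2 * (norm (u c z))\<^sup>2 + 2 * (norm (u (b - c) z))\<^sup>2"
      by (simp only: norm_add_square_le)
    moreover have "norm (u (b - c) z) \<le> norm (b - c)"
    proof -
      have "norm (u (b - c) z) \<le> norm (op_apply (rep (b - c)) (ell2_delta z))"
        unfolding u_def by (rule norm_diff_cut_le[OF F(1)])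
      also have "\<dots> \<le> norm (b - c) * norm (ell2_delta z :: 'x ell2)" by (rule norm_rep_le)
      finally show ?thesis by simp
    qed
    then have "(norm (u (b - c) z))\<^sup>2 \<le> (norm (b - c))\<^sup>2" by (rule power_mono) simp
    ultimately show ?thesis by linarith
  qed
  then have "(\<Sum>z\<in>F. (norm (u b z))\<^sup>2) \<le> (\<Sum>z\<in>F. 2 * (norm (u c z))\<^sup>2 + 2 * (norm (b - c))\<^sup>2)"
    by (rule sum_mono)
  also have "\<dots> = 2 * (\<Sum>z\<in>F. (norm (u c z))\<^sup>2) + real (card F) * (2 * (norm (b - c))\<^sup>2)"
    by (simp add: sum.distrib sum_distrib_left)
  finally have "(\<Sum>z\<in>F. (norm (u b z))\<^sup>2) / real (card F)
      \<le> (2 * (\<Sum>z\<in>F. (norm (u c z))\<^sup>2) + real (card F) * (2 * (norm (b - c))\<^sup>2)) / real (card F)"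
    by (rule divide_right_mono) simp
  also have "\<dots> = 2 * ((\<Sum>z\<in>F. (norm (u c z))\<^sup>2) / real (card F)) + 2 * (norm (b - c))\<^sup>2"
    using F by (simp add: add_divide_distrib)
  finally show ?thesis unfolding defect_def u_def[symmetric] .
qed

text \<open>One sequence serves all \<open>a\<close> and \<open>b\<close>: the radius
  \<open>n + 1\<close> eventually exceeds any given propagation while the boundary ratio
  \<open>1 / (n + 1)\<close> tends to 0.\<close>

lemma folner_compressions:
  assumes am: "amenable_metric d"
  obtains k :: "nat \<Rightarrow> nat" and e :: "nat \<Rightarrow> nat \<Rightarrow> 'x"
  where "\<And>n. k n \<ge> 1" "\<And>n. inj_on (e n) {..<k n}"
    "\<And>a b. (\<lambda>n. norm_2_tr (compression (k n) (e n) (a * b) - compression (k n) (e n) a * compression (k n) (e n) b)) \<longlonglongrightarrow> 0"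
proof -
  have "\<forall>n. \<exists>F. finite F \<and> F \<noteq> {} \<and> finite (metric_boundary d (real n + 1) F) \<and>
      real (card (metric_boundary d (real n + 1) F)) \<le> inverse (real (Suc n)) * real (card F)"
  proof
    fix n
    have "real n + 1 > 0 \<and> inverse (real (Suc n)) > 0" by simp
    with am show "\<exists>F. finite F \<and> F \<noteq> {} \<and> finite (metric_boundary d (real n + 1) F) \<and>
        real (card (metric_boundary d (real n + 1) F)) \<le> inverse (real (Suc n)) * real (card F)"
      unfolding amenable_metric_def by blast
  qed
  from choice[OF this] obtain F where F: "\<And>n. finite (F n)" "\<And>n. F n \<noteq> {}"
      "\<And>n. finite (metric_boundary d (real n + 1) (F n))"
      "\<And>n. real (card (metric_boundary d (real n + 1) (F n))) \<le> inverse (real (Suc n)) * real (card (F n))"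
    by blast
  have "\<exists>e. bij_betw e {..<card (F n)} (F n)" for n
    using ex_bij_betw_nat_finite[OF F(1)] by (simp add: lessThan_atLeast0)
  then obtain e where e: "\<And>n. bij_betw (e n) {..<card (F n)} (F n)" by metis
  have lim: "(\<lambda>n. defect (F n) b) \<longlonglongrightarrow> 0" for b
    unfolding LIMSEQ_iff
  proof (intro allI impI)
    fix \<epsilon> :: real assume \<epsilon>: "\<epsilon> > 0"
    \<comment> \<open>The minimum with 1 gives
      \<open>\<eta>\<^sup>2 \<le> \<eta> \<le> \<epsilon> / 4\<close>, so twice the squared
      approximation error is at most half of \<open>\<epsilon>\<close>.\<close>
    define \<eta> where "\<eta> = min 1 (\<epsilon> / 4)"
    have \<eta>: "\<eta> > 0" "\<eta> \<le> 1" "\<eta> \<le> \<epsilon> / 4" using \<epsilon> by (auto simp: \<eta>_def)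
    obtain T where T: "T \<in> CU" "norm (\<iota> T - b) < \<eta>" using approx[OF \<eta>(1)] by blast
    obtain R where R: "propagation_le d R T"
      using T(1) translation_algebra_finite_propagation unfolding finite_propagation_def by blast
    have "(\<lambda>n. 2 * ((norm (\<iota> T))\<^sup>2 * inverse (real (Suc n)))) \<longlonglongrightarrow> 2 * ((norm (\<iota> T))\<^sup>2 * 0)"
      by (intro tendsto_mult tendsto_const LIMSEQ_inverse_real_of_nat)
    then have "\<forall>\<^sub>F n in sequentially. 2 * ((norm (\<iota> T))\<^sup>2 * inverse (real (Suc n))) < \<epsilon> / 2"
      by (rule order_tendstoD(2)) (use \<epsilon> in simp)
    then obtain N where N: "\<And>n. n \<ge> N \<Longrightarrow> 2 * ((norm (\<iota> T))\<^sup>2 * inverse (real (Suc n))) < \<epsilon> / 2"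
      unfolding eventually_sequentially by blast
    have "norm (defect (F n) b - 0) < \<epsilon>" if n: "n \<ge> max N (nat \<lceil>R\<rceil>)" for n
    proof -
      have "R \<le> real n + 1" using n by linarith
      from defect_translation[OF T(1) R F(1,2,3,4) this]
      have "2 * defect (F n) (\<iota> T) < \<epsilon> / 2" using N[of n] n by simp
      moreover have "(norm (b - \<iota> T))\<^sup>2 \<le> \<epsilon> / 4"
      proof -
        have "(norm (b - \<iota> T))\<^sup>2 \<le> \<eta>\<^sup>2" by (rule power_mono) (use T(2) in \<open>auto simp: norm_minus_commute\<close>)
        also have "\<dots> \<le> \<eta>" using \<eta> by (simp add: power2_eq_square mult_left_le)
        finally show ?thesis using \<eta> by simp
      qed
      moreover have "defect (F n) b \<le> 2 * defect (F n) (\<iota> T) + 2 * (norm (b - \<iota> T))\<^sup>2"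
        by (rule defect_approx[OF F(1,2)])
      moreover have "defect (F n) b \<ge> 0" by (simp add: defect_def sum_nonneg)
      ultimately show ?thesis by simp
    qed
    then show "\<exists>no. \<forall>n\<ge>no. norm (defect (F n) b - 0) < \<epsilon>" by blast
  qed
  show ?thesis
  proof (rule that[of "\<lambda>n. card (F n)" e])
    show "card (F n) \<ge> 1" for n using F(1,2)[of n] by (simp add: Suc_le_eq card_gt_0_iff)
    show "inj_on (e n) {..<card (F n)}" for n using e by (simp add: bij_betw_def)
    fix a b
    let ?M = "\<lambda>n. compression (card (F n)) (e n) (a * b) - compression (card (F n)) (e n) a * compression (card (F n)) (e n) b"
    have "(\<lambda>n. (norm a)\<^sup>2 * defect (F n) b) \<longlonglongrightarrow> (norm a)\<^sup>2 * 0"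
      by (intro tendsto_mult tendsto_const lim)
    then have z: "(\<lambda>n. (norm a)\<^sup>2 * defect (F n) b) \<longlonglongrightarrow> 0" by simp
    have "(\<lambda>n. (norm_2_tr (?M n))\<^sup>2) \<longlonglongrightarrow> 0"
      by (rule tendsto_null_comparison[OF always_eventually z]) (use compression_mult_defect[OF e] in simp)
    from tendsto_real_sqrt[OF this]
    have "(\<lambda>n. sqrt ((norm_2_tr (?M n))\<^sup>2)) \<longlonglongrightarrow> 0" by simp
    moreover have "sqrt ((norm_2_tr (?M n))\<^sup>2) = norm_2_tr (?M n)" for n
      using norm_2_tr_nonneg[of "?M n" "card (F n)"] by (simp add: compression_def minus_mat_def)
    ultimately show "(\<lambda>n. norm_2_tr (?M n)) \<longlonglongrightarrow> 0" by simp
  qed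
qed

lemma amenable_imp_folner:
  assumes am: "amenable_metric d"
  shows "folner_pre_cstar_algebra TYPE('a)"
proof -
  obtain k and e :: "nat \<Rightarrow> nat \<Rightarrow> 'x" where k: "\<And>n. k n \<ge> 1" and e: "\<And>n. inj_on (e n) {..<k n}"
    and lim: "\<And>a b. (\<lambda>n. norm_2_tr (compression (k n) (e n) (a * b) - compression (k n) (e n) a * compression (k n) (e n) b)) \<longlonglongrightarrow> 0"
    using folner_compressions[OF am] by blast
  let ?N = "filtermap (\<lambda>n. (k n, compression (k n) (e n))) sequentially"
  have "?N \<noteq> bot" by (simp add: filtermap_bot_iff)
  moreover have "\<forall>\<^sub>F (k, \<phi>) in ?N. k \<ge> 1 \<and> unital_completely_positive k \<phi>"
    using k compression_ucp[OF e] by (simp add: eventually_filtermap)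
  moreover have "((\<lambda>(k, \<phi>). norm_2_tr (\<phi> (a * b) - \<phi> a * \<phi> b)) \<longlongrightarrow> 0) ?N" for a b
    using lim[of a b] by (simp add: filterlim_filtermap)
  ultimately show ?thesis unfolding folner_pre_cstar_algebra_def by blast
qed

text \<open>The normalized traces of the compressions have a cluster point by Tychonov's theorem.\<close>

lemma amenable_imp_tracial_state:
  assumes am: "amenable_metric d"
  shows "\<exists>\<tau> :: 'a \<Rightarrow> complex. tracial_state \<tau>"
proof -
  obtain k and e :: "nat \<Rightarrow> nat \<Rightarrow> 'x" where k: "\<And>n. k n \<ge> 1" and e: "\<And>n. inj_on (e n) {..<k n}"
    and lim: "\<And>a b. (\<lambda>n. norm_2_tr (compression (k n) (e n) (a * b) - compression (k n) (e n) a * compression (k n) (e n) b)) \<longlonglongrightarrow> 0"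
    using folner_compressions[OF am] by blast
  define s where "s n a = normalized_trace (compression (k n) (e n) a)" for n a
  have s: "s n a = (\<Sum>i<k n. coef (rep a) (e n i) (e n i)) / of_nat (k n)" for n a
    by (simp add: s_def normalized_trace_def compression_def)
  have s_add: "s n (a + b) = s n a + s n b" and s_scale: "s n (c *\<^sub>C a) = c * s n a" for n a b c
    by (simp_all add: s rep_add rep_scaleC coef_simps sum.distrib add_divide_distrib sum_distrib_left)
  have s_one: "s n 1 = 1" for n using k[of n] by (simp add: s rep_one coef_simps)
  have s_bd: "cmod (s n a) \<le> norm a" for n a
  proof -
    have "cmod (\<Sum>i<k n. coef (rep a) (e n i) (e n i)) \<le> (\<Sum>i<k n. norm a)"
    proof (rule sum_norm_le)
      fix i
      have "cmod (coef (rep a) (e n i) (e n i)) \<le> norm (op_apply (rep a) (ell2_delta (e n i)))"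
        unfolding coef_def by (rule cmod_ell2_fun_le)
      also have "\<dots> \<le> norm a * norm (ell2_delta (e n i) :: 'x ell2)" by (rule norm_rep_le)
      finally show "cmod (coef (rep a) (e n i) (e n i)) \<le> norm a" by simp
    qed
    then show ?thesis using k[of n] by (simp add: s norm_divide divide_le_eq mult.commute)
  qed
  have s_pos: "s n a \<in> \<real>\<^sub>\<ge>\<^sub>0" if "a \<in> positive_cone" for n a
  proof -
    have "coef (rep a) x x \<in> \<real>\<^sub>\<ge>\<^sub>0" for x
      using rep_positive[OF that, of "ell2_delta x"] by (simp add: coef_def cinner_delta_left)
    then have "(\<Sum>i\<in>L. coef (rep a) (e n i) (e n i)) \<in> \<real>\<^sub>\<ge>\<^sub>0" for L
      by (induction L rule: infinite_finite_induct) auto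
    then show ?thesis by (simp add: s)
  qed
  have s_tr: "(\<lambda>n. s n (a * b) - s n (b * a)) \<longlonglongrightarrow> 0" for a b
  proof (rule tendsto_null_comparison[OF always_eventually])
    show "\<forall>n. norm (s n (a * b) - s n (b * a))
        \<le> norm_2_tr (compression (k n) (e n) (a * b) - compression (k n) (e n) a * compression (k n) (e n) b)
         + norm_2_tr (compression (k n) (e n) (b * a) - compression (k n) (e n) b * compression (k n) (e n) a)"
      unfolding s_def
    proof
      fix n
      show "norm (normalized_trace (compression (k n) (e n) (a * b)) - normalized_trace (compression (k n) (e n) (b * a)))
        \<le> norm_2_tr (compression (k n) (e n) (a * b) - compression (k n) (e n) a * compression (k n) (e n) b)
         + norm_2_tr (compression (k n) (e n) (b * a) - compression (k n) (e n) b * compression (k n) (e n) a)"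
        by (rule asymptotic_trace[where k = "k n"]) (simp add: compression_def)
    qed
    show "(\<lambda>n. norm_2_tr (compression (k n) (e n) (a * b) - compression (k n) (e n) a * compression (k n) (e n) b)
         + norm_2_tr (compression (k n) (e n) (b * a) - compression (k n) (e n) b * compression (k n) (e n) a)) \<longlonglongrightarrow> 0"
      using tendsto_add[OF lim[of a b] lim[of b a]] by simp
  qed
  let ?B = "PiE UNIV (\<lambda>a :: 'a. complex_box (norm a))"
  have "compactin (product_topology (\<lambda>_. euclidean) UNIV) ?B"
    unfolding compactin_PiE by (simp add: compact_complex_box)
  then have cB: "compact ?B" unfolding euclidean_product_topology compactin_euclidean_iff .
  let ?S = "filtermap s sequentially"
  have ev: "\<forall>\<^sub>F f in ?S. f \<in> ?B" using mem_complex_box[OF s_bd] by (simp add: eventually_filtermap PiE_iff)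
  have "?S \<noteq> bot" by (simp add: filtermap_bot_iff)
  from cB[unfolded compact_filter, rule_format, OF this ev]
  obtain \<tau> where \<tau>: "inf (nhds \<tau>) ?S \<noteq> bot" by blast
  \<comment> \<open>A filter refining both the sequence and the neighbourhoods of the cluster point:
    it replaces a convergent subsequence, and whatever holds for all \<open>s n\<close> passes to
    \<open>\<tau>\<close> along it.\<close>
  define H where "H = inf (nhds \<tau>) ?S"
  have H: "H \<noteq> bot" using \<tau> by (simp add: H_def)
  have ev_H: "eventually P H" if "\<And>n. P (s n)" for P
    using that unfolding H_def by (intro filter_leD[OF inf_le2]) (simp add: eventually_filtermap)
  have co: "((\<lambda>f. f a) \<longlongrightarrow> \<tau> a) H" for a
  proof -
    have "((\<lambda>f. f a) \<longlongrightarrow> \<tau> a) (nhds \<tau>)"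
    proof (rule topological_tendstoI)
      fix S :: "complex set" assume "open S" "\<tau> a \<in> S"
      moreover from this have "open ((\<lambda>f :: 'a \<Rightarrow> complex. f a) -` S)"
        by (intro open_vimage continuous_on_product_coordinates)
      ultimately show "\<forall>\<^sub>F f in nhds \<tau>. f a \<in> S" unfolding eventually_nhds by blast
    qed
    then show ?thesis unfolding H_def by (rule tendsto_mono[OF inf_le1])
  qed
  have uniq: "\<tau> a = l" if "((\<lambda>f. f a) \<longlongrightarrow> l) H" for a l by (rule tendsto_unique[OF H co that])
  have "tracial_state \<tau>"
    unfolding tracial_state_def
  proof (intro conjI allI ballI)
    have add: "\<tau> (a + b) = \<tau> a + \<tau> b" for a b
      by (rule uniq, rule Lim_transform_eventually[OF tendsto_add[OF co co]], rule ev_H) (simp add: s_add)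
    have sc: "\<tau> (c *\<^sub>C a) = c * \<tau> a" for c a
      by (rule uniq, rule Lim_transform_eventually[OF tendsto_mult[OF tendsto_const co]], rule ev_H) (simp add: s_scale)
    show "clinear \<tau>" unfolding clinear_def
      by unfold_locales (simp_all add: add sc scaleC_complex_def)
    show "\<tau> 1 = 1"
      by (rule uniq, rule Lim_transform_eventually[OF tendsto_const], rule ev_H) (simp add: s_one)
    show "\<tau> a \<in> \<real>\<^sub>\<ge>\<^sub>0" if "a \<in> positive_cone" for a
      by (rule Lim_in_closed_set[OF closed_nonneg_Reals _ H co], rule ev_H) (rule s_pos[OF that])
    fix a b
    \<comment> \<open>The trace property is only asymptotic for the \<open>s n\<close>, so it is
      transferred as a limit and not as an identity.\<close>
    have "((\<lambda>f. f (a * b) - f (b * a)) \<longlongrightarrow> 0) ?S"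
      using s_tr[of a b] by (simp add: filterlim_filtermap)
    then have "((\<lambda>f. f (a * b) - f (b * a)) \<longlongrightarrow> 0) H"
      unfolding H_def by (rule tendsto_mono[OF inf_le2])
    from tendsto_unique[OF H this tendsto_diff[OF co co]] show "\<tau> (a * b) = \<tau> (b * a)" by simp
  qed
  then show ?thesis by blast
qed

end

section \<open>Consequences of a paradoxical decomposition\<close>

text \<open>For a basis \<open>E\<close> of \<open>W\<close> the left inverses keep the
  \<open>2 * card E\<close> vectors of \<open>s E\<close> and \<open>t E\<close> independent. Yet
  they lie in the span of \<open>E\<close> and at most \<open>1 / 4 + 1 / 4\<close> times
  \<open>card E\<close> further vectors. Any tolerance below one half would do.\<close>

lemma algebraically_amenable_no_isometry_pair:
  fixes s t s' t' :: "'b::complex_star_algebra"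
  assumes am: "algebraically_amenable B" and B: "s \<in> B" "t \<in> B"
    and s: "s' * s = 1" "s' * t = 0" and t: "t' * t = 1" "t' * s = 0"
  shows False
proof -
  have "(1 / 4 :: real) > 0 \<and> finite {s, t} \<and> {s, t} \<subseteq> B" using B by auto
  from am[unfolded algebraically_amenable_def, rule_format, OF this]
  obtain W S where W: "csubspace W" "W \<noteq> {0}" and S: "finite S" "cspan S = W"
    and dim: "\<forall>a\<in>{s, t}. real (cdim {a * w + w' |w w'. w \<in> W \<and> w' \<in> W}) \<le> (1 + 1 / 4) * real (cdim W)"
    by (elim exE conjE)
  obtain E where E: "E \<subseteq> W" "\<not> cdependent E" "W \<subseteq> cspan E" "card E = cdim W"
    using complex_vector.basis_exists[of W] by blast
  have finE: "finite E"
    using complex_vector.independent_span_bound[OF S(1) E(2)] E(1) S(2) by simp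
  have WE: "W = cspan E" using E(1,3) complex_vector.span_minimal[OF E(1) W(1)] by blast
  have "card E > 0"
  proof (rule ccontr)
    assume "\<not> ?thesis"
    then have "E = {}" using finE by simp
    with WE W(2) show False by (simp add: complex_vector.span_empty)
  qed
  \<comment> \<open>A basis of \<open>a W + W\<close> is chosen to extend \<open>E\<close>; its new
    vectors form \<open>C\<close>, and the dimension bound makes them few.\<close>
  have ext: "\<exists>C. finite C \<and> real (card C) \<le> 1 / 4 * real (card E) \<and> (\<lambda>w. a * w) ` E \<subseteq> cspan (E \<union> C)"
    if a: "a \<in> {s, t}" for a
  proof -
    let ?U = "{a * w + w' |w w'. w \<in> W \<and> w' \<in> W}"
    have W0: "0 \<in> W" by (rule complex_vector.subspace_0[OF W(1)])
    have EU: "E \<subseteq> ?U"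
    proof
      fix w assume "w \<in> E"
      then have "w = a * 0 + w" "w \<in> W" using E(1) by auto
      with W0 show "w \<in> ?U" by blast
    qed
    have aEU: "(\<lambda>w. a * w) ` E \<subseteq> ?U"
    proof
      fix v assume "v \<in> (\<lambda>w. a * w) ` E"
      then obtain w where "w \<in> W" "v = a * w + 0" using E(1) by auto
      with W0 show "v \<in> ?U" by blast
    qed
    obtain D where D: "E \<subseteq> D" "D \<subseteq> ?U" "\<not> cdependent D" "?U \<subseteq> cspan D"
      using complex_vector.maximal_independent_subset_extend[OF EU E(2)] by blast
    \<comment> \<open>Finiteness of the basis \<open>D\<close> has to be established: for an
      infinite one \<open>card\<close> and \<open>cdim\<close> would be 0 and the dimension bound
      would say nothing.\<close>
    have "?U \<subseteq> cspan (E \<union> (\<lambda>w. a * w) ` E)"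
    proof
      fix v assume "v \<in> ?U"
      then obtain w w' where v: "v = a * w + w'" "w \<in> cspan E" "w' \<in> cspan E" using WE by auto
      let ?N = "cspan (E \<union> (\<lambda>w. a * w) ` E)"
      have "csubspace {w. a * w \<in> ?N}"
        unfolding complex_vector.subspace_def
        by (auto simp: distrib_left mult_scaleC_right complex_vector.span_zero
            intro: complex_vector.span_add complex_vector.span_scale)
      then have "cspan E \<subseteq> {w. a * w \<in> ?N}"
        by (rule complex_vector.span_minimal[rotated]) (auto intro: complex_vector.span_base)
      moreover have "cspan E \<subseteq> ?N" by (rule complex_vector.span_mono) auto
      ultimately have "a * w \<in> ?N" "w' \<in> ?N" using v by auto
      then show "v \<in> ?N" unfolding v(1) by (rule complex_vector.span_add)
    qed
    then have finD: "finite D"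
      using complex_vector.independent_span_bound[OF _ D(3), of "E \<union> (\<lambda>w. a * w) ` E"] D(2) finE by auto
    have "cdim ?U = card D" by (rule complex_vector.dim_unique[OF D(2,4,3) refl])
    then have "real (card D) \<le> (1 + 1 / 4) * real (card E)" using bspec[OF dim a] E(4) by simp
    moreover have "card (D - E) = card D - card E" by (rule card_Diff_subset[OF finE D(1)])
    moreover have "card E \<le> card D" by (rule card_mono[OF finD D(1)])
    ultimately have "real (card (D - E)) \<le> 1 / 4 * real (card E)" by (simp add: of_nat_diff)
    moreover have "(\<lambda>w. a * w) ` E \<subseteq> cspan (E \<union> (D - E))"
      using aEU D(1,4) by (simp add: Un_absorb1)
    ultimately show ?thesis using finD by blast
  qed
  obtain C where C: "finite C" "real (card C) \<le> 1 / 4 * real (card E)" "(\<lambda>w. s * w) ` E \<subseteq> cspan (E \<union> C)"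
    using ext[of s] by blast
  obtain D where D: "finite D" "real (card D) \<le> 1 / 4 * real (card E)" "(\<lambda>w. t * w) ` E \<subseteq> cspan (E \<union> D)"
    using ext[of t] by blast
  let ?sE = "(\<lambda>w. s * w) ` E" and ?tE = "(\<lambda>w. t * w) ` E"
  have cancel: "s' * (s * w) = w" "s' * (t * w) = 0" "t' * (t * w) = w" "t' * (s * w) = 0" for w
    by (simp_all add: mult.assoc[symmetric] s t)
  have injs: "inj_on (\<lambda>w. s * w) E" and injt: "inj_on (\<lambda>w. t * w) E"
    by (rule inj_on_inverseI[where g = "\<lambda>w. s' * w"], rule cancel(1))
       (rule inj_on_inverseI[where g = "\<lambda>w. t' * w"], rule cancel(3))
  have E0: "0 \<notin> E" using E(2) complex_vector.dependent_zero by blast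
  have disj: "?sE \<inter> ?tE = {}"
  proof (rule ccontr)
    assume "?sE \<inter> ?tE \<noteq> {}"
    then obtain v w where vw: "v \<in> E" "s * v = t * w" by auto
    have "v = s' * (s * v)" by (simp add: cancel)
    also have "\<dots> = 0" by (simp add: vw(2) cancel)
    finally show False using vw(1) E0 by simp
  qed
  have ind: "\<not> cdependent (?sE \<union> ?tE)"
  proof
    assume "cdependent (?sE \<union> ?tE)"
    then obtain u where u: "\<exists>v\<in>?sE \<union> ?tE. u v \<noteq> 0" "(\<Sum>v\<in>?sE \<union> ?tE. u v *\<^sub>C v) = 0"
      using complex_vector.dependent_finite[of "?sE \<union> ?tE"] finE by auto
    have "(\<Sum>v\<in>?sE \<union> ?tE. u v *\<^sub>C v) = (\<Sum>v\<in>?sE. u v *\<^sub>C v) + (\<Sum>v\<in>?tE. u v *\<^sub>C v)"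
      by (rule sum.union_disjoint) (use finE disj in auto)
    then have z: "(\<Sum>w\<in>E. u (s * w) *\<^sub>C (s * w)) + (\<Sum>w\<in>E. u (t * w) *\<^sub>C (t * w)) = 0"
      using u(2) by (simp add: sum.reindex[OF injs] sum.reindex[OF injt])
    have Ezero: "\<forall>w\<in>E. c w = 0" if "(\<Sum>w\<in>E. c w *\<^sub>C w) = 0" for c
      using complex_vector.dependent_finite[OF finE] E(2) that by blast
    have "s' * ((\<Sum>w\<in>E. u (s * w) *\<^sub>C (s * w)) + (\<Sum>w\<in>E. u (t * w) *\<^sub>C (t * w))) = (\<Sum>w\<in>E. u (s * w) *\<^sub>C w)"
      by (simp add: distrib_left sum_distrib_left mult_scaleC_right cancel)
    then have "\<forall>w\<in>E. u (s * w) = 0" unfolding z by (intro Ezero) simp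
    moreover have "t' * ((\<Sum>w\<in>E. u (s * w) *\<^sub>C (s * w)) + (\<Sum>w\<in>E. u (t * w) *\<^sub>C (t * w))) = (\<Sum>w\<in>E. u (t * w) *\<^sub>C w)"
      by (simp add: distrib_left sum_distrib_left mult_scaleC_right cancel)
    then have "\<forall>w\<in>E. u (t * w) = 0" unfolding z by (intro Ezero) simp
    ultimately show False using u(1) by auto
  qed
  have "?sE \<union> ?tE \<subseteq> cspan (E \<union> C \<union> D)"
    using C(3) D(3) complex_vector.span_mono[of "E \<union> C" "E \<union> C \<union> D"]
      complex_vector.span_mono[of "E \<union> D" "E \<union> C \<union> D"] by blast
  then have "card (?sE \<union> ?tE) \<le> card (E \<union> C \<union> D)"
    using complex_vector.independent_span_bound[OF _ ind, of "E \<union> C \<union> D"] finE C(1) D(1) by simp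
  also have "\<dots> \<le> card E + card C + card D"
    using card_Un_le[of "E \<union> C" D] card_Un_le[of E C] by linarith
  finally have "card (?sE \<union> ?tE) \<le> card E + card C + card D" .
  moreover have "card (?sE \<union> ?tE) = 2 * card E"
    using card_Un_disjoint[OF _ _ disj] finE by (simp add: card_image injs injt)
  ultimately have "real (card E) \<le> real (card C) + real (card D)" by linarith
  with C(2) D(2) \<open>card E > 0\<close> show False by simp
qed

text \<open>The relations of the Cuntz algebra O_2.\<close>

locale isometry_pair =
  fixes s t :: "'a::pre_cstar_algebra"
  assumes ss: "adj s * s = 1" and tt: "adj t * t = 1" and st: "adj s * t = 0" and ts: "adj t * s = 0"
    and complete: "s * adj s + t * adj t = 1"
begin

lemma no_tracial_state: "\<not> tracial_state (\<tau> :: 'a \<Rightarrow> complex)"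
proof
  assume \<tau>: "tracial_state \<tau>"
  then have l: "clinear \<tau>" and one: "\<tau> 1 = 1" and tr: "\<And>a b. \<tau> (a * b) = \<tau> (b * a)"
    by (auto simp: tracial_state_def)
  have "\<tau> (s * adj s + t * adj t) = \<tau> (s * adj s) + \<tau> (t * adj t)"
    using l unfolding clinear_def by (rule module_hom.add[OF Vector_Spaces.linear.axioms(3)])
  then have "\<tau> 1 = \<tau> 1 + \<tau> 1" by (simp add: complete tr[of s] tr[of t] ss tt)
  with one show False by simp
qed

text \<open>By completeness the commutator traces of the two isometries add up to exactly 2 - 1 = 1
  under every unital map, while \<open>asymptotic_trace\<close> bounds them by four errors tending
  to 0.\<close>

lemma not_folner: "\<not> folner_pre_cstar_algebra TYPE('a)"
proof
  assume "folner_pre_cstar_algebra TYPE('a)"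
  then obtain N :: "(nat \<times> ('a \<Rightarrow> complex mat)) filter" where N: "N \<noteq> bot"
    and ucp: "\<forall>\<^sub>F (k, \<phi>) in N. k \<ge> 1 \<and> unital_completely_positive k \<phi>"
    and lim: "\<And>a b. ((\<lambda>(k, \<phi>). norm_2_tr (\<phi> (a * b) - \<phi> a * \<phi> b)) \<longlongrightarrow> 0) N"
    unfolding folner_pre_cstar_algebra_def by blast
  define g where "g a b = (\<lambda>(k :: nat, \<phi>). norm_2_tr (\<phi> (a * b) - \<phi> a * \<phi> b))" for a b :: 'a
  have "((\<lambda>p. (g (adj s) s p + g s (adj s) p) + (g (adj t) t p + g t (adj t) p)) \<longlongrightarrow> (0 + 0) + (0 + 0)) N"
    unfolding g_def by (intro tendsto_add lim)
  moreover have "\<forall>\<^sub>F p in N. 1 \<le> (g (adj s) s p + g s (adj s) p) + (g (adj t) t p + g t (adj t) p)"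
    using ucp
  proof (rule eventually_mono, clarify)
    fix k and \<phi> :: "'a \<Rightarrow> complex mat"
    assume k: "1 \<le> k" and u: "unital_completely_positive k \<phi>"
    let ?t = "\<lambda>a. normalized_trace (\<phi> a)"
    have quotient_carrier: "\<And>a. \<phi> a \<in> carrier_mat k k" and add: "\<And>a b. \<phi> (a + b) = \<phi> a + \<phi> b" and one: "\<phi> 1 = 1\<^sub>m k"
      using u by (auto simp: unital_completely_positive_def)
    have t1: "?t 1 = 1" using k by (simp add: one normalized_trace_def)
    have ta: "?t (a + b) = ?t a + ?t b" for a b
      using quotient_carrier[of a] quotient_carrier[of b] by (simp add: add normalized_trace_def sum.distrib add_divide_distrib)
    have "(?t (adj s * s) - ?t (s * adj s)) + (?t (adj t * t) - ?t (t * adj t)) = 1"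
      using ta[of "s * adj s" "t * adj t"] by (simp add: complete ss tt t1 algebra_simps)
    then have "1 = cmod ((?t (adj s * s) - ?t (s * adj s)) + (?t (adj t * t) - ?t (t * adj t)))" by simp
    also have "\<dots> \<le> cmod (?t (adj s * s) - ?t (s * adj s)) + cmod (?t (adj t * t) - ?t (t * adj t))"
      by (rule norm_triangle_ineq)
    also have "\<dots> \<le> (g (adj s) s (k, \<phi>) + g s (adj s) (k, \<phi>)) + (g (adj t) t (k, \<phi>) + g t (adj t) (k, \<phi>))"
      unfolding g_def prod.case by (intro add_mono asymptotic_trace[OF quotient_carrier])
    finally show "1 \<le> (g (adj s) s (k, \<phi>) + g s (adj s) (k, \<phi>)) + (g (adj t) t (k, \<phi>) + g t (adj t) (k, \<phi>))" .
  qed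
  ultimately have "1 \<le> (0 + 0) + (0 + 0 :: real)" by (rule tendsto_lowerbound[OF _ _ N])
  then show False by simp
qed

text \<open>The unital diagonal embedding \<open>D\<close> carries the two orthogonal range
  projections of \<open>s\<close> and \<open>t\<close>, each equivalent to 1, into the
  matrices.\<close>

lemma properly_infinite_mat:
  assumes "k \<ge> 1"
  shows "properly_infinite (ring_mat TYPE('a) k ())"
proof -
  define D :: "'a \<Rightarrow> 'a mat" where "D a = mat k k (\<lambda>(i, j). if i = j then a else 0)" for a
  have Dc: "D a \<in> carrier_mat k k" for a by (simp add: D_def)
  have Dm: "D a * D b = D (a * b)" for a b
    by (rule eq_matI)
       (auto simp: D_def scalar_prod_def if_distrib[of "\<lambda>z. z * _"] if_distrib[of "\<lambda>z. _ * z"] sum.delta cong: if_cong)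
  have D1: "D 1 = 1\<^sub>m k" and D0: "D 0 = 0\<^sub>m k k"
    by (auto simp: D_def intro!: eq_matI)
  have "1\<^sub>m k \<noteq> (0\<^sub>m k k :: 'a mat)"
  proof
    assume "1\<^sub>m k = (0\<^sub>m k k :: 'a mat)"
    then have "1\<^sub>m k $$ (0, 0) = (0\<^sub>m k k :: 'a mat) $$ (0, 0)" by simp
    with assms show False by simp
  qed
  let ?R = "ring_mat TYPE('a) k ()"
  have R: "carrier ?R = carrier_mat k k" "\<one>\<^bsub>?R\<^esub> = 1\<^sub>m k" "\<zero>\<^bsub>?R\<^esub> = 0\<^sub>m k k" "\<And>x y. x \<otimes>\<^bsub>?R\<^esub> y = x * y"
    by (simp_all add: ring_mat_def)
  have orth: "s * adj s * (t * adj t) = 0" "t * adj t * (s * adj s) = 0"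
    "s * adj s * (s * adj s) = s * adj s" "t * adj t * (t * adj t) = t * adj t"
  proof -
    have c: "adj s * (s * x) = x" "adj t * (t * x) = x" "adj s * (t * x) = 0" "adj t * (s * x) = 0" for x
      by (simp_all add: mult.assoc[symmetric] ss tt st ts)
    show "s * adj s * (t * adj t) = 0" "t * adj t * (s * adj s) = 0"
      "s * adj s * (s * adj s) = s * adj s" "t * adj t * (t * adj t) = t * adj t"
      by (simp_all add: mult.assoc c)
  qed
  have e: "\<exists>x\<in>carrier_mat k k. \<exists>y\<in>carrier_mat k k. D (s * adj s) = x * y \<and> 1\<^sub>m k = y * x"
    by (rule bexI[OF _ Dc[of s]], rule bexI[OF _ Dc[of "adj s"]]) (simp add: Dm ss D1)
  have f: "\<exists>x\<in>carrier_mat k k. \<exists>y\<in>carrier_mat k k. 1\<^sub>m k = x * y \<and> D (t * adj t) = y * x"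
    by (rule bexI[OF _ Dc[of "adj t"]], rule bexI[OF _ Dc[of t]]) (simp add: Dm tt D1)
  show ?thesis
    unfolding properly_infinite_def R idempotent_equiv_def
    by (rule conjI, fact, rule bexI[OF _ Dc[of "s * adj s"]], rule bexI[OF _ Dc[of "t * adj t"]])
       (intro conjI e f, simp_all add: Dm orth D0)
qed

end

section \<open>Classes of idempotents and the vanishing of the class of 1\<close>

lemma idem_class_surj: obtains G where "idempotent_mat G" "g = abs_idem_class G"
proof -
  have "idem_mat_equiv (rep_idem_class g) (rep_idem_class g)"
    using Quotient_rep_reflp[OF Quotient_idem_class] .
  then have "idempotent_mat (rep_idem_class g)" by (simp add: idem_mat_equiv_refl)
  moreover have "g = abs_idem_class (rep_idem_class g)"
    using Quotient_abs_rep[OF Quotient_idem_class] by metis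
  ultimately show ?thesis by (rule that)
qed

lemma abs_idem_class_eq_iff:
  assumes "idempotent_mat e" "idempotent_mat f"
  shows "abs_idem_class e = abs_idem_class f \<longleftrightarrow> idem_mat_equiv e f"
  using Quotient_rel[OF Quotient_idem_class, of e f] assms by (simp add: idem_mat_equiv_refl)

lemma abs_idem_class_plus:
  assumes "idempotent_mat e" "idempotent_mat f"
  shows "abs_idem_class e + abs_idem_class f = abs_idem_class (mat_direct_sum e f)"
  using assms by (simp add: plus_idem_class.abs_eq idem_mat_equiv_refl)

lemma idempotent_one_mat: "idempotent_mat (1\<^sub>m n :: 'a::ring_1 mat)"
  by (simp add: idempotent_mat_def)

lemma idempotent_zero_mat: "idempotent_mat (0\<^sub>m n n :: 'a::ring_1 mat)"
  by (simp add: idempotent_mat_def)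

lemma mat_1_1_one: "mat 1 1 (\<lambda>_. 1) = (1\<^sub>m 1 :: 'a::ring_1 mat)"
  and mat_1_1_zero: "mat 1 1 (\<lambda>_. 0) = (0\<^sub>m 1 1 :: 'a::ring_1 mat)"
  by (auto intro!: eq_matI)

text \<open>Empty matrices of sizes n x 0 and 0 x n implement the equivalence with the empty
  idempotent.\<close>

lemma abs_idem_class_zero_mat: "abs_idem_class (0\<^sub>m n n :: 'a::ring_1 mat) = 0"
proof -
  have "idem_mat_equiv (0\<^sub>m n n :: 'a mat) (0\<^sub>m 0 0)"
    unfolding idem_mat_equiv_def
    by (intro conjI idempotent_zero_mat bexI[of _ "0\<^sub>m n 0"] bexI[of _ "0\<^sub>m 0 n"])
       (auto intro!: eq_matI simp: scalar_prod_def)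
  then show ?thesis
    unfolding zero_idem_class_def by (subst abs_idem_class_eq_iff) (auto simp: idempotent_zero_mat)
qed

lemma K0_class_one_eq_zero_iff:
  "K0_class (1 :: 'a::ring_1) = K0_class 0 \<longleftrightarrow>
    (\<exists>g :: 'a idem_class. abs_idem_class (1\<^sub>m 1) + g = g)"
proof -
  have "K0_class (1 :: 'a) = K0_class 0 \<longleftrightarrow>
      (\<exists>g. abs_idem_class (1\<^sub>m 1 :: 'a mat) + 0 + g = abs_idem_class (0\<^sub>m 1 1) + 0 + g)"
    unfolding K0_class_def K0_class_mat_def mat_1_1_one mat_1_1_zero grothendieck.abs_eq_iff by simp
  then show ?thesis by (simp add: abs_idem_class_zero_mat)
qed

text \<open>The row of \<open>s\<close> and \<open>t\<close> and the column of their adjoints make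
  two copies of 1 equivalent to one, so the class of 1 absorbs itself.\<close>

lemma (in isometry_pair) K0_class_one: "K0_class (1 :: 'a) = K0_class 0"
proof -
  let ?I = "1\<^sub>m 1 :: 'a mat"
  have "idem_mat_equiv (mat_direct_sum ?I ?I) ?I"
    unfolding idem_mat_equiv_def
  proof (intro conjI idempotent_mat_direct_sum idempotent_one_mat)
    let ?x = "mat 2 1 (\<lambda>(i, j). if i = 0 then adj s else adj t)"
      and ?y = "mat 1 2 (\<lambda>(i, j). if j = 0 then s else t)"
    have two: "{0..<2 :: nat} = {0, 1}" by auto
    have d: "dim_row (mat_direct_sum ?I ?I) = 2" "dim_row ?I = 1" by (simp_all add: mat_direct_sum_def)
    show "\<exists>x\<in>carrier_mat (dim_row (mat_direct_sum ?I ?I)) (dim_row ?I).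
        \<exists>y\<in>carrier_mat (dim_row ?I) (dim_row (mat_direct_sum ?I ?I)).
          mat_direct_sum ?I ?I = x * y \<and> ?I = y * x"
      unfolding d
    proof (rule bexI[of _ ?x], rule bexI[of _ ?y], rule conjI)
      show "mat_direct_sum ?I ?I = ?x * ?y"
        by (rule eq_matI) (auto simp: mat_direct_sum_def scalar_prod_def ss tt st ts less_2_cases_iff)
      show "?I = ?y * ?x"
        by (rule eq_matI) (auto simp: scalar_prod_def two complete)
    qed auto
  qed
  then have "abs_idem_class ?I + abs_idem_class ?I = abs_idem_class ?I"
    by (simp add: abs_idem_class_plus idempotent_one_mat abs_idem_class_eq_iff idempotent_mat_direct_sum)
  then show ?thesis unfolding K0_class_one_eq_zero_iff by blast
qed

text \<open>Adding the complementary idempotent replaces \<open>g\<close> by the class of an identity matrix.\<close>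

lemma K0_class_one_eq_zeroD:
  assumes "K0_class (1 :: 'a::ring_1) = K0_class 0"
  obtains m x y where "x \<in> carrier_mat (m + 1) m" "y \<in> carrier_mat m (m + 1)" "x * y = (1\<^sub>m (m + 1) :: 'a mat)"
proof -
  obtain g where g: "abs_idem_class (1\<^sub>m 1 :: 'a mat) + g = g"
    using assms unfolding K0_class_one_eq_zero_iff by blast
  obtain G where G: "idempotent_mat G" "g = abs_idem_class G" using idem_class_surj[of g] by blast
  define m where "m = dim_row G"
  have Gc: "G \<in> carrier_mat m m" unfolding m_def by (rule idempotent_mat_carrier[OF G(1)])
  have GG: "G * G = G" using G(1) unfolding idempotent_mat_def by blast
  define H where "H = 1\<^sub>m m - G"
  have Hc: "H \<in> carrier_mat m m" unfolding H_def by (rule minus_carrier_mat[OF Gc])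
  have "G * H = G * 1\<^sub>m m - G * G" unfolding H_def by (rule mult_minus_distrib_mat[OF Gc one_carrier_mat Gc])
  then have GH: "G * H = 0\<^sub>m m m" by (simp only: GG right_mult_one_mat[OF Gc] minus_r_inv_mat[OF Gc])
  have "H * G = 1\<^sub>m m * G - G * G" unfolding H_def by (rule minus_mult_distrib_mat[OF one_carrier_mat Gc Gc])
  then have HG: "H * G = 0\<^sub>m m m" by (simp only: GG left_mult_one_mat[OF Gc] minus_r_inv_mat[OF Gc])
  have "H * H = 1\<^sub>m m * H - G * H"
    using minus_mult_distrib_mat[OF one_carrier_mat Gc Hc] by (simp only: H_def)
  also have "\<dots> = H" unfolding GH left_mult_one_mat[OF Hc] using Hc by (intro eq_matI) auto
  finally have HH: "H * H = H" .
  have iH: "idempotent_mat H" using Hc HH by (simp add: idempotent_mat_def)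
  have sum: "G + H = 1\<^sub>m m" unfolding H_def using Gc by (auto intro!: eq_matI)
  have "idem_mat_equiv (mat_direct_sum G H) (1\<^sub>m m)"
    unfolding idem_mat_equiv_def
  proof (intro conjI idempotent_mat_direct_sum G(1) iH idempotent_one_mat)
    \<comment> \<open>The witnesses are the column with entries \<open>G\<close>, \<open>H\<close>
      and the row with the same entries; blocks of width or height 0 pad them so that block
      multiplication applies.\<close>
    let ?z = "0\<^sub>m m 0 :: 'a mat" and ?z' = "0\<^sub>m 0 m :: 'a mat" and ?e = "0\<^sub>m 0 0 :: 'a mat"
    let ?x = "four_block_mat G ?z H ?z" and ?y = "four_block_mat G H ?z' ?z'"
    have "?x * ?y = four_block_mat (G * G + ?z * ?z') (G * H + ?z * ?z') (H * G + ?z * ?z') (H * H + ?z * ?z')"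
      by (rule mult_four_block_mat) (use Gc Hc in auto)
    also have "\<dots> = mat_direct_sum G H"
      using Gc Hc by (simp add: GG GH HG HH mat_direct_sum_def)
    finally have 1: "mat_direct_sum G H = ?x * ?y" ..
    have "?y * ?x = four_block_mat (G * G + H * H) (G * ?z + H * ?z) (?z' * G + ?z' * H) (?z' * ?z + ?z' * ?z)"
      by (rule mult_four_block_mat) (use Gc Hc in auto)
    also have "\<dots> = 1\<^sub>m m"
      using Gc Hc by (intro eq_matI) (auto simp: GG HH sum)
    finally have 2: "1\<^sub>m m = ?y * ?x" ..
    have d: "dim_row (mat_direct_sum G H) = m + m" "dim_row (1\<^sub>m m :: 'a mat) = m"
      using Gc Hc by (simp_all add: mat_direct_sum_def)
    have "?x \<in> carrier_mat (m + m) m" "?y \<in> carrier_mat m (m + m)"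
      using four_block_carrier_mat[OF Gc, of ?z m 0] Gc Hc by (auto intro!: carrier_matI)
    with 1 2 show "\<exists>x\<in>carrier_mat (dim_row (mat_direct_sum G H)) (dim_row (1\<^sub>m m :: 'a mat)).
        \<exists>y\<in>carrier_mat (dim_row (1\<^sub>m m :: 'a mat)) (dim_row (mat_direct_sum G H)).
          mat_direct_sum G H = x * y \<and> 1\<^sub>m m = y * x"
      unfolding d by blast
  qed
  then have gH: "g + abs_idem_class H = abs_idem_class (1\<^sub>m m)"
    unfolding G(2) by (simp add: abs_idem_class_plus abs_idem_class_eq_iff G(1) iH idempotent_mat_direct_sum idempotent_one_mat)
  have "abs_idem_class (1\<^sub>m 1) + abs_idem_class (1\<^sub>m m) = (abs_idem_class (1\<^sub>m 1) + g) + abs_idem_class H"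
    unfolding gH[symmetric] by (simp add: add.assoc)
  also have "\<dots> = abs_idem_class (1\<^sub>m m)" unfolding g gH ..
  finally have "abs_idem_class (mat_direct_sum (1\<^sub>m 1) (1\<^sub>m m)) = abs_idem_class (1\<^sub>m m :: 'a mat)"
    by (simp add: abs_idem_class_plus idempotent_one_mat)
  then have eq: "idem_mat_equiv (mat_direct_sum (1\<^sub>m 1) (1\<^sub>m m)) (1\<^sub>m m :: 'a mat)"
    by (simp add: abs_idem_class_eq_iff idempotent_mat_direct_sum idempotent_one_mat)
  have ds: "mat_direct_sum (1\<^sub>m 1) (1\<^sub>m m) = (1\<^sub>m (m + 1) :: 'a mat)"
    unfolding mat_direct_sum_def by (rule eq_matI) auto
  show ?thesis using eq unfolding ds idem_mat_equiv_def by (auto intro: that)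
qed

text \<open>Orthogonality of the idempotents passes to their factors: multiplying by one left
  inverse on the left and one right factor on the right cancels everything but the mixed
  product.\<close>

lemma properly_infinite_matD:
  assumes "properly_infinite (ring_mat TYPE('a::ring_1) k ())"
  obtains x\<^sub>1 y\<^sub>1 x\<^sub>2 y\<^sub>2 :: "'a::ring_1 mat" where
    "x\<^sub>1 \<in> carrier_mat k k" "y\<^sub>1 \<in> carrier_mat k k" "x\<^sub>2 \<in> carrier_mat k k" "y\<^sub>2 \<in> carrier_mat k k"
    "y\<^sub>1 * x\<^sub>1 = 1\<^sub>m k" "y\<^sub>2 * x\<^sub>2 = 1\<^sub>m k" "y\<^sub>1 * x\<^sub>2 = 0\<^sub>m k k" "y\<^sub>2 * x\<^sub>1 = 0\<^sub>m k k"
proof -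
  let ?R = "ring_mat TYPE('a) k ()"
  have R: "carrier ?R = carrier_mat k k" "\<one>\<^bsub>?R\<^esub> = 1\<^sub>m k" "\<zero>\<^bsub>?R\<^esub> = 0\<^sub>m k k" "\<And>x y. x \<otimes>\<^bsub>?R\<^esub> y = x * y"
    by (simp_all add: ring_mat_def)
  obtain x\<^sub>1 y\<^sub>1 x\<^sub>2 y\<^sub>2 :: "'a mat" where c: "x\<^sub>1 \<in> carrier_mat k k" "y\<^sub>1 \<in> carrier_mat k k" "x\<^sub>2 \<in> carrier_mat k k" "y\<^sub>2 \<in> carrier_mat k k"
    and 1: "1\<^sub>m k = y\<^sub>1 * x\<^sub>1" and 2: "1\<^sub>m k = y\<^sub>2 * x\<^sub>2"
    and z: "(x\<^sub>1 * y\<^sub>1) * (x\<^sub>2 * y\<^sub>2) = 0\<^sub>m k k" "(x\<^sub>2 * y\<^sub>2) * (x\<^sub>1 * y\<^sub>1) = 0\<^sub>m k k"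
    using assms unfolding properly_infinite_def R idempotent_equiv_def by blast
  have orth: "b * u = 0\<^sub>m k k"
    if c: "a \<in> carrier_mat k k" "b \<in> carrier_mat k k" "u \<in> carrier_mat k k" "v \<in> carrier_mat k k"
      and 1: "1\<^sub>m k = b * a" "1\<^sub>m k = v * u" and z: "(a * b) * (u * v) = 0\<^sub>m k k" for a b u v :: "'a mat"
  proof -
    have "b * ((a * b) * (u * v)) * u = (b * a) * (b * u) * (v * u)"
      using c by (simp add: assoc_mult_mat[of _ k k _ k _ k])
    also have "\<dots> = b * u" using c by (simp add: 1[symmetric])
    finally show ?thesis using c by (simp add: z)
  qed
  from that[OF c 1[symmetric] 2[symmetric] orth[OF c 1 2 z(1)] orth[OF c(3,4,1,2) 2 1 z(2)]]
  show ?thesis .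
qed

context roe_rep begin

text \<open>Placing \<open>x\<^sub>1\<close> and \<open>x\<^sub>2\<close> side by side gives a k x
  2k matrix whose left inverse is \<open>y\<^sub>1\<close> stacked on
  \<open>y\<^sub>2\<close>.\<close>

lemma amenable_imp_not_properly_infinite:
  assumes am: "amenable_metric d" and "k \<ge> 1"
  shows "\<not> properly_infinite (ring_mat TYPE('a) k ())"
proof
  assume "properly_infinite (ring_mat TYPE('a) k ())"
  then obtain x\<^sub>1 y\<^sub>1 x\<^sub>2 y\<^sub>2 :: "'a mat" where
    c: "x\<^sub>1 \<in> carrier_mat k k" "y\<^sub>1 \<in> carrier_mat k k" "x\<^sub>2 \<in> carrier_mat k k" "y\<^sub>2 \<in> carrier_mat k k"
    and r: "y\<^sub>1 * x\<^sub>1 = 1\<^sub>m k" "y\<^sub>2 * x\<^sub>2 = 1\<^sub>m k" "y\<^sub>1 * x\<^sub>2 = 0\<^sub>m k k" "y\<^sub>2 * x\<^sub>1 = 0\<^sub>m k k"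
    by (rule properly_infinite_matD)
  have e: "(\<Sum>l<k. y $$ (i, l) * x $$ (l, j)) = (y * x) $$ (i, j)"
    if "x \<in> carrier_mat k k" "y \<in> carrier_mat k k" "i < k" "j < k" for x y :: "'a mat" and i j
    using that by (simp add: scalar_prod_def lessThan_atLeast0)
  show False
  proof (rule rank_condition[OF am, of k "2 * k"
        "\<lambda>i l. if i < k then y\<^sub>1 $$ (i, l) else y\<^sub>2 $$ (i - k, l)"
        "\<lambda>l j. if j < k then x\<^sub>1 $$ (l, j) else x\<^sub>2 $$ (l, j - k)"])
    show "k < 2 * k" using \<open>k \<ge> 1\<close> by simp
    fix i j assume ij: "i < 2 * k" "j < 2 * k"
    then have "i \<ge> k \<Longrightarrow> i - k < k" "j \<ge> k \<Longrightarrow> j - k < k" by auto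
    then show "(\<Sum>l<k. (if i < k then y\<^sub>1 $$ (i, l) else y\<^sub>2 $$ (i - k, l)) *
        (if j < k then x\<^sub>1 $$ (l, j) else x\<^sub>2 $$ (l, j - k))) = (if i = j then 1 else 0)"
      using ij by (cases "i < k"; cases "j < k") (auto simp: e c r)
  qed
qed

lemma amenable_imp_K0_class_one:
  assumes am: "amenable_metric d"
  shows "K0_class (1 :: 'a) \<noteq> K0_class 0"
proof
  assume "K0_class (1 :: 'a) = K0_class 0"
  then obtain m and x y :: "'a mat" where c: "x \<in> carrier_mat (m + 1) m" "y \<in> carrier_mat m (m + 1)"
    and xy: "x * y = 1\<^sub>m (m + 1)" by (rule K0_class_one_eq_zeroD)
  show False
  proof (rule rank_condition[OF am, of m "m + 1" "\<lambda>i l. x $$ (i, l)" "\<lambda>l j. y $$ (l, j)"])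
    fix i j assume ij: "i < m + 1" "j < m + 1"
    have "(\<Sum>l<m. x $$ (i, l) * y $$ (l, j)) = (x * y) $$ (i, j)"
      using c ij by (simp add: scalar_prod_def lessThan_atLeast0)
    then show "(\<Sum>l<m. x $$ (i, l) * y $$ (l, j)) = (if i = j then 1 else 0)" using ij by (simp add: xy)
  qed simp
qed

end

section \<open>From a paradoxical decomposition to isometries in the translation algebra\<close>

context bdd_geometry begin

text \<open>Injectivity of the two translations makes them isometries, disjointness of the ranges
  makes these orthogonal, and the covering of \<open>X\<close> by the ranges gives
  completeness.\<close>

lemma nonamenable_isometries:
  assumes "\<not> amenable_metric d"
  obtains S T where "S \<in> translation_algebra d" "T \<in> translation_algebra d"
    "adj S * S = 1" "adj T * T = 1" "adj S * T = 0" "adj T * S = 0" "S * adj S + T * adj T = 1"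
proof -
  obtain s t R where st: "inj s" "inj t" "range s \<inter> range t = {}" "range s \<union> range t = UNIV"
    "\<And>x. d x (s x) \<le> ennreal R" "\<And>x. d x (t x) \<le> ennreal R"
    using nonamenable_paradoxical[OF assms] by blast
  define V where "V u = partial_isometry UNIV u" for u :: "'x \<Rightarrow> 'x"
  have V: "op_apply (V u) (ell2_delta x) = ell2_delta (u x)" if "inj u" for u x
    using that by (simp add: V_def partial_isometry_delta)
  have VV: "coef (adj (V u) * V w) x y = (if u x = w y then 1 else 0)" if "inj u" "inj w" for u w x y
    using that by (simp add: coef_def op_simps cinner_delta_left[symmetric] cinner_adj_right V)
       (simp add: cinner_delta_left ell2_simps)
  have adjV: "op_apply (adj (V u)) (ell2_delta (u x)) = ell2_delta x" if "inj u" for u x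
  proof (rule ell2_eqI)
    fix y show "ell2_fun (op_apply (adj (V u)) (ell2_delta (u x))) y = ell2_fun (ell2_delta x) y"
      using coef_adj[of "V u" y "u x"] that by (simp add: coef_def V ell2_simps inj_eq)
  qed
  have adjV0: "op_apply (adj (V u)) (ell2_delta z) = 0" if "inj u" "z \<notin> range u" for u z
  proof (rule ell2_eqI)
    fix y show "ell2_fun (op_apply (adj (V u)) (ell2_delta z)) y = ell2_fun 0 y"
      using coef_adj[of "V u" y z] that by (auto simp: coef_def V ell2_simps)
  qed
  show ?thesis
  proof (rule that[of "V s" "V t"])
    show "V s \<in> translation_algebra d" "V t \<in> translation_algebra d"
      unfolding V_def by (rule total_translation_mem[OF st(1,5)], rule total_translation_mem[OF st(2,6)])
    show "adj (V s) * V s = 1" "adj (V t) * V t = 1"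
      by (rule coef_eqI, simp add: VV coef_simps st inj_eq)+
    have "s x \<noteq> t y" for x y using st(3) by auto
    note ne = this this[symmetric]
    show "adj (V s) * V t = 0" "adj (V t) * V s = 0"
      by (rule coef_eqI, simp add: VV coef_simps st ne)+
    show "V s * adj (V s) + V t * adj (V t) = 1"
    proof (rule ell2_op_eq_on_deltaI)
      fix z
      show "op_apply (V s * adj (V s) + V t * adj (V t)) (ell2_delta z) = op_apply 1 (ell2_delta z)"
      proof (cases "z \<in> range s")
        case True
        then have "z \<notin> range t" using st(3) by blast
        with True show ?thesis by (auto simp: op_simps adjV adjV0 V st(1,2))
      next
        case False
        have "z \<in> range s \<union> range t" unfolding st(4) by (rule UNIV_I)
        with False have "z \<in> range t" by blast
        with False show ?thesis by (auto simp: op_simps adjV adjV0 V st(1,2))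
      qed
    qed
  qed
qed

lemma nonamenable_imp_not_algebraically_amenable:
  assumes "\<not> amenable_metric d"
  shows "\<not> algebraically_amenable (algebraic_uniform_roe_algebra d)"
proof -
  obtain S T where "S \<in> translation_algebra d" "T \<in> translation_algebra d"
    "adj S * S = 1" "adj T * T = 1" "adj S * T = 0" "adj T * S = 0"
    using nonamenable_isometries[OF assms] by blast
  then show ?thesis
    using algebraically_amenable_no_isometry_pair[of "algebraic_uniform_roe_algebra d" S T "adj S" "adj T"]
      translation_subset_roe by blast
qed

end

lemma (in roe_rep) nonamenable_isometry_pair:
  assumes "\<not> amenable_metric d"
  obtains s t :: 'a where "isometry_pair s t"
proof -
  obtain S T where c: "S \<in> CU" "T \<in> CU" and r: "adj S * S = 1" "adj T * T = 1" "adj S * T = 0" "adj T * S = 0"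
    "S * adj S + T * adj T = 1" using nonamenable_isometries[OF assms] by blast
  have "\<iota> (adj A * B) = adj (\<iota> A) * \<iota> B" "\<iota> (A * adj B) = \<iota> A * adj (\<iota> B)" if "A \<in> CU" "B \<in> CU" for A B
    using that by (simp_all add: \<iota>_mult \<iota>_adj transl_closed)
  note h = this
  have "isometry_pair (\<iota> S) (\<iota> T)"
  proof
    show "adj (\<iota> S) * \<iota> S = 1" "adj (\<iota> T) * \<iota> T = 1" "adj (\<iota> S) * \<iota> T = 0" "adj (\<iota> T) * \<iota> S = 0"
      using c by (simp_all add: h[symmetric] r \<iota>_one \<iota>_zero)
    have "\<iota> S * adj (\<iota> S) + \<iota> T * adj (\<iota> T) = \<iota> (S * adj S + T * adj T)"
      using c by (simp add: h[symmetric] \<iota>_add transl_closed)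
    then show "\<iota> S * adj (\<iota> S) + \<iota> T * adj (\<iota> T) = 1" by (simp add: r \<iota>_one)
  qed
  then show ?thesis by (rule that)
qed

section \<open>Leavitt algebras\<close>

subsection \<open>Evaluation on the free algebra\<close>

abbreviation "psingle \<equiv> Poly_Mapping.single"
abbreviation "pkeys \<equiv> Poly_Mapping.keys"
abbreviation "plookup \<equiv> Poly_Mapping.lookup"

definition eval_word :: "(leavitt_gen \<Rightarrow> 'a::complex_star_algebra) \<Rightarrow> free_word \<Rightarrow> 'a"
  where "eval_word S w = prod_list (map S (letters w))"

definition eval_poly :: "(leavitt_gen \<Rightarrow> 'a::complex_star_algebra) \<Rightarrow> free_poly \<Rightarrow> 'a"
  where "eval_poly S p = (\<Sum>w\<in>pkeys p. plookup p w *\<^sub>C eval_word S w)"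

lemma letters_add [simp]: "letters (u + v) = letters u @ letters v"
  and letters_zero [simp]: "letters 0 = []"
  by (simp_all add: plus_free_word_def zero_free_word_def)

lemma FWord_add: "FWord u + FWord v = FWord (u @ v)"
  by (simp add: plus_free_word_def)

lemma eval_word_add: "eval_word S (u + v) = eval_word S u * eval_word S v"
  by (simp add: eval_word_def)

lemma poly_sum_single: "p = (\<Sum>w\<in>pkeys p. psingle w (plookup p w))"
proof (rule poly_mapping_eqI)
  fix v
  show "plookup p v = plookup (\<Sum>w\<in>pkeys p. psingle w (plookup p w)) v"
    by (simp add: lookup_sum lookup_single when_def in_keys_iff)
qed

lemma eval_poly_superset:
  assumes "finite K" "pkeys p \<subseteq> K"
  shows "eval_poly S p = (\<Sum>w\<in>K. plookup p w *\<^sub>C eval_word S w)"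
  unfolding eval_poly_def
  by (rule sum.mono_neutral_left) (use assms in \<open>auto simp: in_keys_iff\<close>)

lemma eval_poly_add: "eval_poly S (p + q) = eval_poly S p + eval_poly S q"
proof -
  let ?K = "pkeys p \<union> pkeys q"
  have K: "finite ?K" "pkeys p \<subseteq> ?K" "pkeys q \<subseteq> ?K" "pkeys (p + q) \<subseteq> ?K"
    using Poly_Mapping.keys_add[of p q] by auto
  show ?thesis
    unfolding eval_poly_superset[OF K(1,2)] eval_poly_superset[OF K(1,3)] eval_poly_superset[OF K(1,4)]
    by (simp add: lookup_add scaleC_add_left sum.distrib)
qed

lemma eval_poly_single: "eval_poly S (psingle w c) = c *\<^sub>C eval_word S w"
  by (simp add: eval_poly_def)

lemma eval_poly_zero: "eval_poly S 0 = 0"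
  by (simp add: eval_poly_def)

lemma eval_poly_one: "eval_poly S 1 = 1"
  using eval_poly_single[of S 0 1] by (simp add: eval_word_def scaleC_one)

lemma eval_poly_diff: "eval_poly S (p - q) = eval_poly S p - eval_poly S q"
  using eval_poly_add[of S "p - q" q] by (simp add: algebra_simps)

lemma eval_poly_sum: "eval_poly S (sum h K) = (\<Sum>i\<in>K. eval_poly S (h i))"
  by (induction K rule: infinite_finite_induct) (simp_all add: eval_poly_zero eval_poly_add)

lemma eval_poly_mult: "eval_poly S (p * q) = eval_poly S p * eval_poly S q"
proof -
  have "p * q = (\<Sum>w\<in>pkeys p. \<Sum>v\<in>pkeys q. psingle (w + v) (plookup p w * plookup q v))"
    by (subst poly_sum_single[of p], subst poly_sum_single[of q]) (simp add: sum_product mult_single)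
  then have "eval_poly S (p * q)
      = (\<Sum>w\<in>pkeys p. \<Sum>v\<in>pkeys q. (plookup p w * plookup q v) *\<^sub>C eval_word S (w + v))"
    by (simp only: eval_poly_sum eval_poly_single)
  also have "\<dots> = eval_poly S p * eval_poly S q"
    by (simp add: eval_poly_def sum_product eval_word_add mult_scaleC_left mult_scaleC_right scaleC_scaleC mult.commute)
  finally show ?thesis .
qed

lemma eval_poly_gen: "eval_poly S (free_gen g) = S g"
  by (simp add: free_gen_def eval_poly_single eval_word_def scaleC_one)

lemma eval_poly_scal: "eval_poly S (psingle 0 c * p) = c *\<^sub>C eval_poly S p"
  by (simp add: eval_poly_mult eval_poly_single eval_word_def mult_scaleC_left)

lemma adj_one: "adj 1 = (1 :: 'a::complex_star_algebra)"
  by (metis adj_adj adj_mult mult_1_right)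

lemma adj_zero: "adj 0 = (0 :: 'a::complex_star_algebra)"
  using adj_add[of 0 "0 :: 'a"] by simp

lemma adj_sum: "adj (sum h K) = (\<Sum>i\<in>K. adj (h i :: 'a::complex_star_algebra))"
  by (induction K rule: infinite_finite_induct) (simp_all add: adj_zero adj_add)

lemma eval_poly_star:
  assumes "\<And>g. S (gen_star g) = adj (S g)"
  shows "eval_poly S (poly_star p) = adj (eval_poly S p)"
proof -
  have "prod_list (map S (rev (map gen_star l))) = adj (prod_list (map S l))" for l
    by (induction l) (simp_all add: adj_one adj_mult assms)
  then have "eval_word S (word_star w) = adj (eval_word S w)" for w
    by (simp add: eval_word_def word_star_def)
  then show ?thesis
    by (simp add: poly_star_def eval_poly_sum eval_poly_single eval_poly_def[of S p] adj_sum adj_scaleC)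
qed

subsection \<open>Ideals of the free *-algebra\<close>

definition word_over :: "nat set \<Rightarrow> free_word \<Rightarrow> bool"
  where "word_over I w \<longleftrightarrow> set (letters w) \<subseteq> LX ` I \<union> LY ` I"

lemma free_star_algebra_simps:
  "carrier (free_star_algebra I) = {p. \<forall>w\<in>pkeys p. word_over I w}"
  "x \<otimes>\<^bsub>free_star_algebra I\<^esub> y = x * y" "\<one>\<^bsub>free_star_algebra I\<^esub> = 1"
  "\<zero>\<^bsub>free_star_algebra I\<^esub> = 0" "x \<oplus>\<^bsub>free_star_algebra I\<^esub> y = x + y"
  "scal (free_star_algebra I) c x = psingle 0 c * x" "star (free_star_algebra I) x = poly_star x"
  by (simp_all add: free_star_algebra_def word_over_def)

abbreviation "fcarrier I \<equiv> carrier (free_star_algebra I)"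

lemma fcarrier_add: "p \<in> fcarrier I \<Longrightarrow> q \<in> fcarrier I \<Longrightarrow> p + q \<in> fcarrier I"
  using Poly_Mapping.keys_add[of p q] by (auto simp: free_star_algebra_simps)

lemma fcarrier_single: "word_over I w \<Longrightarrow> psingle w c \<in> fcarrier I"
  by (simp add: free_star_algebra_simps)

lemma fcarrier_mult:
  assumes "p \<in> fcarrier I" "q \<in> fcarrier I"
  shows "p * q \<in> fcarrier I"
proof -
  have "word_over I w" if "w \<in> pkeys (p * q)" for w
  proof -
    obtain u v where "u \<in> pkeys p" "v \<in> pkeys q" "w = u + v" using keys_mult[of p q] \<open>w \<in> pkeys (p * q)\<close> by auto
    then show ?thesis using assms by (auto simp: free_star_algebra_simps word_over_def)
  qed
  then show ?thesis by (simp add: free_star_algebra_simps)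
qed

lemma word_over_zero: "word_over I 0"
  by (simp add: word_over_def)

lemma fcarrier_zero: "0 \<in> fcarrier I" and fcarrier_one: "1 \<in> fcarrier I"
  using word_over_zero by (simp_all add: free_star_algebra_simps)

lemma fcarrier_uminus: "p \<in> fcarrier I \<Longrightarrow> - p \<in> fcarrier I"
  by (simp add: free_star_algebra_simps in_keys_iff)

lemma fcarrier_diff: "p \<in> fcarrier I \<Longrightarrow> q \<in> fcarrier I \<Longrightarrow> p - q \<in> fcarrier I"
  using fcarrier_add[of p I "- q"] fcarrier_uminus[of q I] by simp

lemma fcarrier_sum: "(\<And>i. i \<in> K \<Longrightarrow> h i \<in> fcarrier I) \<Longrightarrow> sum h K \<in> fcarrier I"
  by (induction K rule: infinite_finite_induct) (auto simp: fcarrier_zero intro: fcarrier_add)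

lemma fcarrier_gen: "i \<in> I \<Longrightarrow> free_gen (LX i) \<in> fcarrier I" "i \<in> I \<Longrightarrow> free_gen (LY i) \<in> fcarrier I"
  by (auto simp: free_gen_def free_star_algebra_simps word_over_def)

lemma fcarrier_star:
  assumes "p \<in> fcarrier I"
  shows "poly_star p \<in> fcarrier I"
  unfolding poly_star_def
proof (rule fcarrier_sum)
  fix w assume "w \<in> pkeys p"
  then have w: "set (letters w) \<subseteq> LX ` I \<union> LY ` I" using assms by (simp add: free_star_algebra_simps word_over_def)
  have "gen_star g \<in> LX ` I \<union> LY ` I" if "g \<in> set (letters w)" for g
    using w that by (cases g) auto
  then have "word_over I (word_star w)" by (auto simp: word_over_def word_star_def)
  then show "psingle (word_star w) (cnj (plookup p w)) \<in> fcarrier I" by (rule fcarrier_single)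
qed

lemma ring_free_star_algebra: "ring (free_star_algebra I)"
proof (rule ringI)
  show "abelian_group (free_star_algebra I)"
  proof (rule abelian_groupI)
    fix p assume p: "p \<in> fcarrier I"
    show "\<exists>q\<in>fcarrier I. q \<oplus>\<^bsub>free_star_algebra I\<^esub> p = \<zero>\<^bsub>free_star_algebra I\<^esub>"
      by (rule bexI[OF _ fcarrier_uminus[OF p]]) (simp add: free_star_algebra_simps)
  qed (simp_all add: free_star_algebra_simps(2-) fcarrier_add fcarrier_zero algebra_simps)
  show "Group.monoid (free_star_algebra I)"
    by (rule Group.monoidI) (simp_all add: free_star_algebra_simps(2-) fcarrier_mult fcarrier_one mult.assoc)
qed (simp_all add: free_star_algebra_simps(2-) algebra_simps)

lemma leavitt_orthogonality_subset: "leavitt_orthogonality I \<subseteq> fcarrier I"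
  by (auto simp: leavitt_orthogonality_def intro!: fcarrier_diff fcarrier_mult fcarrier_gen fcarrier_one fcarrier_zero)

text \<open>The normal word of \<open>\<mu>\<close>, \<open>\<nu>\<close> evaluates to \<open>S\<^sub>\<mu> S\<^sub>\<nu>\<^sup>*\<close>.\<close>

definition nword :: "nat list \<Rightarrow> nat list \<Rightarrow> free_word"
  where "nword \<mu> \<nu> = FWord (map LX \<mu> @ map LY (rev \<nu>))"

text \<open>\<open>J\<close> is any ideal containing the relations
  \<open>Y\<^sub>i X\<^sub>j = \<delta>\<^sub>i\<^sub>j\<close>, so that both kinds of Leavitt
  algebra are covered.\<close>

locale free_ideal =
  fixes I :: "nat set" and J :: "free_poly set"
  assumes idl: "ideal J (free_star_algebra I)"
    and orth: "leavitt_orthogonality I \<subseteq> J"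
begin

lemma J_carrier: "J \<subseteq> fcarrier I"
  using additive_subgroup.a_subset[OF ideal.axioms(1)[OF idl]] .

lemma J_zero: "0 \<in> J"
  using additive_subgroup.zero_closed[OF ideal.axioms(1)[OF idl]] by (simp add: free_star_algebra_simps)

lemma J_add: "a \<in> J \<Longrightarrow> b \<in> J \<Longrightarrow> a + b \<in> J"
  using additive_subgroup.a_closed[OF ideal.axioms(1)[OF idl]] by (simp add: free_star_algebra_simps)

lemma J_left: "c \<in> fcarrier I \<Longrightarrow> a \<in> J \<Longrightarrow> c * a \<in> J"
  and J_right: "c \<in> fcarrier I \<Longrightarrow> a \<in> J \<Longrightarrow> a * c \<in> J"
  using ideal.I_l_closed[OF idl] ideal.I_r_closed[OF idl] by (simp_all add: free_star_algebra_simps)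

lemma J_uminus: "a \<in> J \<Longrightarrow> - a \<in> J"
  using J_left[OF fcarrier_uminus[OF fcarrier_one]] by simp

lemma J_diff: "a \<in> J \<Longrightarrow> b \<in> J \<Longrightarrow> a - b \<in> J"
  using J_add[OF _ J_uminus] by simp

lemma J_trans: "a - b \<in> J \<Longrightarrow> b - c \<in> J \<Longrightarrow> a - c \<in> J"
  using J_add[of "a - b" "b - c"] by simp

lemma J_sum: "(\<And>i. i \<in> K \<Longrightarrow> h i \<in> J) \<Longrightarrow> sum h K \<in> J"
  by (induction K rule: infinite_finite_induct) (auto simp: J_zero intro: J_add)

lemma J_scal: "a \<in> J \<Longrightarrow> psingle 0 c * a \<in> J"
  by (rule J_left[OF fcarrier_single[OF word_over_zero]])

lemma coset: "J +>\<^bsub>free_star_algebra I\<^esub> p = {q. q - p \<in> J}"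
proof
  show "J +>\<^bsub>free_star_algebra I\<^esub> p \<subseteq> {q. q - p \<in> J}"
    by (auto simp: a_r_coset_def' free_star_algebra_simps(5))
  have "q = (q - p) + p" for q by simp
  then show "{q. q - p \<in> J} \<subseteq> J +>\<^bsub>free_star_algebra I\<^esub> p"
    unfolding a_r_coset_def' free_star_algebra_simps(5) by blast
qed

definition nwords :: "free_word set"
  where "nwords = {nword \<mu> \<nu> |\<mu> \<nu>. set \<mu> \<subseteq> I \<and> set \<nu> \<subseteq> I}"

lemma nwordsI: "set \<mu> \<subseteq> I \<Longrightarrow> set \<nu> \<subseteq> I \<Longrightarrow> nword \<mu> \<nu> \<in> nwords"
  unfolding nwords_def by blast

lemma word_over_nword: "set \<mu> \<subseteq> I \<Longrightarrow> set \<nu> \<subseteq> I \<Longrightarrow> word_over I (nword \<mu> \<nu>)"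
  by (auto simp: word_over_def nword_def)

text \<open>Rewriting modulo \<open>J\<close> need only be carried out on monomials.\<close>

lemma reduce_linear:
  assumes step: "\<And>w. w \<in> A \<Longrightarrow> \<exists>q. pkeys q \<subseteq> B \<and> psingle w 1 - q \<in> J"
    and p: "pkeys p \<subseteq> A"
  shows "\<exists>q. pkeys q \<subseteq> B \<and> p - q \<in> J"
proof -
  have "\<forall>w\<in>A. \<exists>q. pkeys q \<subseteq> B \<and> psingle w 1 - q \<in> J" using step by blast
  from bchoice[OF this] obtain f where f: "\<And>w. w \<in> A \<Longrightarrow> pkeys (f w) \<subseteq> B" "\<And>w. w \<in> A \<Longrightarrow> psingle w 1 - f w \<in> J"
    by blast
  define q where "q = (\<Sum>w\<in>pkeys p. psingle 0 (plookup p w) * f w)"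
  have "pkeys (psingle 0 c * f w) \<subseteq> B" if "w \<in> A" for c w
    using keys_mult[of "psingle 0 c" "f w"] f(1)[OF that] by (auto split: if_splits)
  then have "pkeys q \<subseteq> B" unfolding q_def using p by (intro order_trans[OF Poly_Mapping.keys_sum]) blast
  moreover have "p - q = (\<Sum>w\<in>pkeys p. psingle 0 (plookup p w) * (psingle w 1 - f w))"
    by (subst (1) poly_sum_single[of p]) (simp add: q_def algebra_simps mult_single sum_subtractf)
  then have "p - q \<in> J" using f(2) p by (auto intro!: J_sum J_scal)
  ultimately show ?thesis by blast
qed

text \<open>Letters are prefixed one at a time. An X keeps a normal word normal; a Y cancels against
  a leading X or, if there is none, joins the block of Y's. As \<open>nword\<close> reverses its
  second argument, that letter is appended to \<open>\<nu>\<close>.\<close>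

lemma reduce_word:
  assumes "set l \<subseteq> LX ` I \<union> LY ` I"
  shows "\<exists>q. pkeys q \<subseteq> nwords \<and> psingle (FWord l) 1 - q \<in> J"
  using assms
proof (induction l)
  case Nil
  have "FWord [] \<in> nwords" using nwordsI[of "[]" "[]"] by (simp add: nword_def)
  then show ?case using J_zero by (intro exI[of _ "psingle (FWord []) 1"]) simp
next
  case (Cons g l)
  then obtain z where z: "pkeys z \<subseteq> nwords" "psingle (FWord l) 1 - z \<in> J" by auto
  have g: "free_gen g \<in> fcarrier I" using Cons.prems fcarrier_gen by auto
  have step: "\<exists>q. pkeys q \<subseteq> nwords \<and> free_gen g * psingle w 1 - q \<in> J" if w: "w \<in> nwords" for w
  proof -
    obtain \<mu> \<nu> where w: "w = nword \<mu> \<nu>" "set \<mu> \<subseteq> I" "set \<nu> \<subseteq> I" using w by (auto simp: nwords_def)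
    have m: "free_gen h * psingle (FWord u) 1 = psingle (FWord (h # u)) 1" for h u
      by (simp add: free_gen_def mult_single FWord_add)
    show ?thesis
    proof (cases g)
      case (LX i)
      then have "i \<in> I" using Cons.prems by auto
      then have "nword (i # \<mu>) \<nu> \<in> nwords" using w by (intro nwordsI) auto
      moreover have "free_gen g * psingle w 1 = psingle (nword (i # \<mu>) \<nu>) 1"
        by (simp add: w(1) nword_def m LX)
      ultimately show ?thesis using J_zero by (intro exI[of _ "psingle (nword (i # \<mu>) \<nu>) 1"]) simp
    next
      case (LY i)
      then have i: "i \<in> I" using Cons.prems by auto
      show ?thesis
      proof (cases \<mu>)
        case Nil
        have "nword [] (\<nu> @ [i]) \<in> nwords" using w i by (intro nwordsI) auto
        moreover have "free_gen g * psingle w 1 = psingle (nword [] (\<nu> @ [i])) 1"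
          by (simp add: w(1) nword_def m LY Nil)
        ultimately show ?thesis using J_zero by (intro exI[of _ "psingle (nword [] (\<nu> @ [i])) 1"]) simp
      next
        case (Cons j \<mu>')
        then have j: "j \<in> I" "set \<mu>' \<subseteq> I" using w by auto
        have n: "nword \<mu>' \<nu> \<in> nwords" using w j by (intro nwordsI) auto
        define r where "r = (if i = j then 1 else 0 :: free_poly)"
        have "free_gen (LY i) * free_gen (LX j) - r \<in> J"
          using orth i j unfolding leavitt_orthogonality_def r_def by blast
        then have "(free_gen (LY i) * free_gen (LX j) - r) * psingle (nword \<mu>' \<nu>) 1 \<in> J"
          by (rule J_right[rotated]) (rule fcarrier_single[OF word_over_nword[OF j(2) w(3)]])
        moreover have "free_gen (LX j) * psingle (nword \<mu>' \<nu>) 1 = psingle w 1"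
          by (simp add: w(1) Cons nword_def free_gen_def mult_single FWord_add)
        ultimately have "free_gen g * psingle w 1 - r * psingle (nword \<mu>' \<nu>) 1 \<in> J"
          by (simp add: LY left_diff_distrib mult.assoc)
        moreover have "pkeys (r * psingle (nword \<mu>' \<nu>) 1) \<subseteq> nwords" using n by (simp add: r_def)
        ultimately show ?thesis by blast
      qed
    qed
  qed
  have "free_gen g * psingle w 1 = psingle (FWord [g] + w) 1" for w by (simp add: free_gen_def mult_single)
  then have step': "\<exists>q. pkeys q \<subseteq> nwords \<and> psingle v 1 - q \<in> J" if "v \<in> (+) (FWord [g]) ` nwords" for v
    using step that by auto
  have gz: "pkeys (free_gen g * z) \<subseteq> (+) (FWord [g]) ` nwords"
    using keys_mult[of "free_gen g" z] z(1) by (auto simp: free_gen_def)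
  obtain q where q: "pkeys q \<subseteq> nwords" "free_gen g * z - q \<in> J"
    using reduce_linear[OF step' gz] by blast
  have "psingle (FWord (g # l)) 1 = free_gen g * psingle (FWord l) 1"
    by (simp add: free_gen_def mult_single FWord_add)
  then have "psingle (FWord (g # l)) 1 - free_gen g * z \<in> J"
    using J_left[OF g z(2)] by (simp add: right_diff_distrib)
  from J_trans[OF this q(2)] q(1) show ?case by blast
qed

lemma reduce:
  assumes "p \<in> fcarrier I"
  shows "\<exists>q. pkeys q \<subseteq> nwords \<and> p - q \<in> J"
proof (rule reduce_linear)
  show "pkeys p \<subseteq> {w. word_over I w}" using assms by (auto simp: free_star_algebra_simps)
  fix w assume "w \<in> {w. word_over I w}"
  then show "\<exists>q. pkeys q \<subseteq> nwords \<and> psingle w 1 - q \<in> J"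
    using reduce_word[of "letters w"] by (cases w) (simp add: word_over_def)
qed

text \<open>Expanding \<open>1 = \<Sum>\<^sub>j X\<^sub>j Y\<^sub>j\<close> in the middle of a normal word lengthens \<open>\<nu>\<close>, so all normal words
  can be given the same \<open>length \<nu>\<close>.\<close>

lemma lengthen:
  assumes I: "I = {..<n}" and rel: "(\<Sum>j<n. free_gen (LX j) * free_gen (LY j)) - 1 \<in> J"
    and \<mu>\<nu>: "set \<mu> \<subseteq> I" "set \<nu> \<subseteq> I" "length \<nu> \<le> L"
  shows "\<exists>q. pkeys q \<subseteq> {nword \<mu> \<nu> |\<mu> \<nu>. set \<mu> \<subseteq> I \<and> set \<nu> \<subseteq> I \<and> length \<nu> = L} \<and> psingle (nword \<mu> \<nu>) 1 - q \<in> J"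
  using \<mu>\<nu>
proof (induction "L - length \<nu>" arbitrary: \<mu> \<nu>)
  case 0
  then have "pkeys (psingle (nword \<mu> \<nu>) (1::complex)) \<subseteq> {nword \<mu> \<nu> |\<mu> \<nu>. set \<mu> \<subseteq> I \<and> set \<nu> \<subseteq> I \<and> length \<nu> = L}"
    by auto
  then show ?case using J_zero by (intro exI[of _ "psingle (nword \<mu> \<nu>) 1"]) simp
next
  case (Suc k)
  let ?B = "{nword \<mu> \<nu> |\<mu> \<nu>. set \<mu> \<subseteq> I \<and> set \<nu> \<subseteq> I \<and> length \<nu> = L}"
  let ?X = "psingle (FWord (map LX \<mu>)) 1 :: free_poly" and ?Y = "psingle (FWord (map LY (rev \<nu>))) 1 :: free_poly"
  define r where "r = (\<Sum>j<n. psingle (nword (\<mu> @ [j]) (\<nu> @ [j])) (1 :: complex))"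
  have "word_over I (FWord (map LX \<mu>))" "word_over I (FWord (map LY (rev \<nu>)))"
    using Suc.prems(1,2) by (auto simp: word_over_def)
  then have "?X * ((\<Sum>j<n. free_gen (LX j) * free_gen (LY j)) - 1) * ?Y \<in> J"
    by (intro J_right J_left rel fcarrier_single)
  moreover have "?X * ((\<Sum>j<n. free_gen (LX j) * free_gen (LY j)) - 1) * ?Y
      = (\<Sum>j<n. ?X * (free_gen (LX j) * free_gen (LY j)) * ?Y) - ?X * ?Y"
    by (simp add: left_diff_distrib right_diff_distrib sum_distrib_left sum_distrib_right)
  moreover have "?X * (free_gen (LX j) * free_gen (LY j)) * ?Y = psingle (nword (\<mu> @ [j]) (\<nu> @ [j])) 1" for j
    by (simp add: nword_def free_gen_def mult_single FWord_add)
  moreover have "?X * ?Y = psingle (nword \<mu> \<nu>) 1"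
    by (simp add: nword_def mult_single FWord_add)
  ultimately have "r - psingle (nword \<mu> \<nu>) 1 \<in> J" by (simp add: r_def)
  from J_uminus[OF this] have 1: "psingle (nword \<mu> \<nu>) 1 - r \<in> J" by simp
  have "\<exists>q. pkeys q \<subseteq> ?B \<and> psingle w 1 - q \<in> J" if "w \<in> (\<lambda>j. nword (\<mu> @ [j]) (\<nu> @ [j])) ` {..<n}" for w
  proof -
    obtain j where j: "j < n" "w = nword (\<mu> @ [j]) (\<nu> @ [j])" using \<open>w \<in> _\<close> by auto
    show ?thesis
      unfolding j(2) using Suc.prems j(1) Suc.hyps(2) by (intro Suc.hyps(1)) (auto simp: I)
  qed
  moreover have "pkeys r \<subseteq> (\<lambda>j. nword (\<mu> @ [j]) (\<nu> @ [j])) ` {..<n}"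
    unfolding r_def by (intro order_trans[OF Poly_Mapping.keys_sum]) auto
  ultimately obtain q where "pkeys q \<subseteq> ?B" "r - q \<in> J"
    using reduce_linear[of "(\<lambda>j. nword (\<mu> @ [j]) (\<nu> @ [j])) ` {..<n}" ?B r] by blast
  with J_trans[OF 1] show ?case by blast
qed

lemma reduce_uniform:
  assumes I: "I = {..<n}" and rel: "(\<Sum>j<n. free_gen (LX j) * free_gen (LY j)) - 1 \<in> J"
    and p: "p \<in> fcarrier I"
  shows "\<exists>L q. pkeys q \<subseteq> {nword \<mu> \<nu> |\<mu> \<nu>. set \<mu> \<subseteq> I \<and> set \<nu> \<subseteq> I \<and> length \<nu> = L} \<and> p - q \<in> J"
proof -
  obtain q where q: "pkeys q \<subseteq> nwords" "p - q \<in> J" using reduce[OF p] by blast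
  have "\<forall>w\<in>pkeys q. \<exists>\<mu> \<nu>. w = nword \<mu> \<nu> \<and> set \<mu> \<subseteq> I \<and> set \<nu> \<subseteq> I" using q(1) by (auto simp: nwords_def)
  from bchoice[OF this] obtain m where m: "\<forall>w\<in>pkeys q. \<exists>\<nu>. w = nword (m w) \<nu> \<and> set (m w) \<subseteq> I \<and> set \<nu> \<subseteq> I" by blast
  from bchoice[OF this] obtain v where v: "\<forall>w\<in>pkeys q. w = nword (m w) (v w) \<and> set (m w) \<subseteq> I \<and> set (v w) \<subseteq> I" by blast
  \<comment> \<open>Inserting 0 covers the case that \<open>q\<close> is zero and has no
    words.\<close>
  define L where "L = Max (insert 0 ((\<lambda>w. length (v w)) ` pkeys q))"
  have L: "length (v w) \<le> L" if "w \<in> pkeys q" for w unfolding L_def by (rule Max_ge) (use that in auto)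
  let ?B = "{nword \<mu> \<nu> |\<mu> \<nu>. set \<mu> \<subseteq> I \<and> set \<nu> \<subseteq> I \<and> length \<nu> = L}"
  have "\<exists>q. pkeys q \<subseteq> ?B \<and> psingle w 1 - q \<in> J" if w: "w \<in> pkeys q" for w
  proof -
    have "w = nword (m w) (v w)" "set (m w) \<subseteq> I" "set (v w) \<subseteq> I" using v w by auto
    with lengthen[OF I rel this(2,3) L[OF w]] show ?thesis by simp
  qed
  then obtain q' where "pkeys q' \<subseteq> ?B" "q - q' \<in> J" using reduce_linear[of "pkeys q" ?B q] by blast
  with J_trans[OF q(2)] show ?thesis by blast
qed

end

subsection \<open>Families of isometries with orthogonal ranges\<close>

locale isometry_family =
  fixes I :: "nat set" and T :: "nat \<Rightarrow> 'a::complex_star_algebra"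
  assumes orthonormal: "\<And>i j. i \<in> I \<Longrightarrow> j \<in> I \<Longrightarrow> adj (T i) * T j = (if i = j then 1 else 0)"
begin

definition Tw :: "nat list \<Rightarrow> 'a" where "Tw \<mu> = prod_list (map T \<mu>)"

definition TT :: "leavitt_gen \<Rightarrow> 'a"
  where "TT g = (case g of LX i \<Rightarrow> T i | LY i \<Rightarrow> adj (T i))"

lemma Tw_append: "Tw (\<mu> @ \<nu>) = Tw \<mu> * Tw \<nu>" and Tw_Nil: "Tw [] = 1" and Tw_Cons: "Tw (i # \<mu>) = T i * Tw \<mu>"
  by (simp_all add: Tw_def)

lemma TT_star: "TT (gen_star g) = adj (TT g)"
  by (cases g) (simp_all add: TT_def adj_adj)

lemma Tw_isometry: "set \<mu> \<subseteq> I \<Longrightarrow> adj (Tw \<mu>) * Tw \<mu> = 1"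
proof (induction \<mu>)
  case (Cons i \<mu>)
  have "adj (Tw (i # \<mu>)) * Tw (i # \<mu>) = adj (Tw \<mu>) * (adj (T i) * T i) * Tw \<mu>"
    by (simp add: Tw_Cons adj_mult mult.assoc)
  then show ?case using Cons orthonormal[of i i] by simp
qed (simp add: Tw_Nil adj_one)

text \<open>The common prefix cancels by isometry, and at the first place where the words differ
  orthogonality of the generators gives 0.\<close>

lemma Tw_parallel:
  assumes "parallel \<mu> \<nu>" "set \<mu> \<subseteq> I" "set \<nu> \<subseteq> I"
  shows "adj (Tw \<mu>) * Tw \<nu> = 0"
proof -
  obtain as b bs c cs where d: "b \<noteq> c" "\<mu> = as @ b # bs" "\<nu> = as @ c # cs"
    using parallel_decomp[OF assms(1)] by blast
  have "adj (Tw \<mu>) * Tw \<nu> = adj (Tw bs) * (adj (T b) * ((adj (Tw as) * Tw as) * T c)) * Tw cs"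
    by (simp add: d Tw_append Tw_Cons adj_mult mult.assoc)
  also have "\<dots> = 0" using assms d Tw_isometry[of as] orthonormal[of b c] by simp
  finally show ?thesis .
qed

lemma eval_nword: "eval_word TT (nword \<mu> \<nu>) = Tw \<mu> * adj (Tw \<nu>)"
proof -
  have "prod_list (map TT (map LY (rev \<nu>))) = adj (Tw \<nu>)"
    by (induction \<nu>) (simp_all add: Tw_Nil Tw_Cons adj_one adj_mult TT_def)
  moreover have "prod_list (map TT (map LX \<mu>)) = Tw \<mu>"
    by (induction \<mu>) (simp_all add: Tw_Nil Tw_Cons TT_def)
  ultimately show ?thesis by (simp add: eval_word_def nword_def)
qed

end

text \<open>Sandwiching the value between two word isometries isolates the coefficient of
  \<open>w0\<close>: the right factor kills all words with another Y-part, the left factor those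
  with another X-part. The tail \<open>u\<close> is there to make words incomparable that would
  otherwise be prefixes of each other.\<close>

lemma (in isometry_family) separate:
  assumes dec: "\<And>w. w \<in> pkeys q \<Longrightarrow> w = nword (m w) (v w) \<and> set (m w) \<subseteq> I \<and> set (v w) \<subseteq> I"
    and w0: "w0 \<in> pkeys q" and u: "set u \<subseteq> I"
    and right: "\<And>w. w \<in> pkeys q \<Longrightarrow> v w \<noteq> v w0 \<Longrightarrow> parallel (v w) (v w0 @ u)"
    and left: "\<And>w. w \<in> pkeys q \<Longrightarrow> m w \<noteq> m w0 \<Longrightarrow> parallel (m w0 @ u) (m w @ u)"
  shows "eval_poly TT q \<noteq> 0"
proof
  assume z: "eval_poly TT q = 0"
  let ?L = "adj (Tw (m w0 @ u))" and ?R = "Tw (v w0 @ u)"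
  have trm: "?L * (eval_word TT w * ?R) = (if w = w0 then 1 else 0)" if w: "w \<in> pkeys q" for w
  proof -
    have "w = nword (m w) (v w)" using dec[OF w] by simp
    then have e: "eval_word TT w = Tw (m w) * adj (Tw (v w))" by (subst \<open>w = _\<close>) (rule eval_nword)
    show ?thesis
    proof (cases "v w = v w0")
      case True
      have "adj (Tw (v w)) * ?R = Tw u"
        using Tw_isometry[of "v w0"] dec[OF w0] by (simp add: True Tw_append mult.assoc[symmetric])
      then have f: "?L * (eval_word TT w * ?R) = ?L * Tw (m w @ u)"
        by (simp add: e Tw_append mult.assoc)
      show ?thesis
      proof (cases "m w = m w0")
        case True
        have "w = nword (m w) (v w)" "w0 = nword (m w0) (v w0)" using dec[OF w] dec[OF w0] by simp_all
        then have "w = w0" using \<open>v w = v w0\<close> True by simp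
        then show ?thesis unfolding f using Tw_isometry[of "m w0 @ u"] dec[OF w0] u by simp
      next
        case False
        then have "w \<noteq> w0" by auto
        then show ?thesis
          unfolding f using Tw_parallel[OF left[OF w False]] dec[OF w] dec[OF w0] u by simp
      qed
    next
      case False
      then have "w \<noteq> w0" by auto
      then show ?thesis
        using Tw_parallel[OF right[OF w False]] dec[OF w] dec[OF w0] u by (simp add: e mult.assoc)
    qed
  qed
  have "?L * (eval_poly TT q * ?R) = (\<Sum>w\<in>pkeys q. plookup q w *\<^sub>C (?L * (eval_word TT w * ?R)))"
    by (simp add: eval_poly_def sum_distrib_left sum_distrib_right mult_scaleC_left mult_scaleC_right)
  also have "\<dots> = (\<Sum>w\<in>pkeys q. if w = w0 then plookup q w0 *\<^sub>C 1 else 0)"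
    by (rule sum.cong) (auto simp: trm)
  finally have "plookup q w0 *\<^sub>C (1 :: 'a) = 0" using z w0 by simp
  then have "plookup q w0 = 0" using complex_vector.scale_eq_0_iff[of "plookup q w0" "1 :: 'a"] by simp
  with w0 show False by (simp add: in_keys_iff)
qed

text \<open>A letter occurring in neither word can only be matched with itself at the end, which
  would force the words to be equal.\<close>

lemma parallel_append_fresh:
  assumes "j \<notin> set \<mu>" "j \<notin> set \<nu>" "\<mu> \<noteq> \<nu>"
  shows "parallel (\<mu> @ [j]) (\<nu> @ [j])"
proof -
  have "\<not> prefix (\<mu> @ [j]) (\<nu> @ [j])" if "j \<notin> set \<nu>" "\<mu> \<noteq> \<nu>" for \<mu> \<nu>
    using that by (auto dest: set_mono_prefix)
  with assms show ?thesis by (auto simp: parallel_def)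
qed

text \<open>No proper shift of \<open>0 \<dots> 0 1\<close> by at most the number of its zeros overlaps the word itself.\<close>

lemma parallel_append_zeros_one:
  assumes "length \<mu> \<le> M" "length \<nu> \<le> M" "\<mu> \<noteq> \<nu>"
  shows "parallel (\<mu> @ (replicate (Suc M) 0 @ [1 :: nat])) (\<nu> @ (replicate (Suc M) 0 @ [1]))"
proof -
  have "\<not> prefix (\<mu> @ (replicate (Suc M) 0 @ [1 :: nat])) (\<nu> @ (replicate (Suc M) 0 @ [1]))"
    if le: "length \<mu> \<le> M" "length \<nu> \<le> M" and ne: "\<mu> \<noteq> \<nu>" for \<mu> \<nu> :: "nat list"
  proof
    let ?u = "replicate (Suc M) 0 @ [1 :: nat]"
    assume "prefix (\<mu> @ ?u) (\<nu> @ ?u)"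
    then obtain zs where zs: "\<nu> @ ?u = (\<mu> @ ?u) @ zs" by (auto simp: prefix_def)
    then have len: "length \<nu> = length \<mu> + length zs" by (drule_tac arg_cong[where f = length]) simp
    have "zs \<noteq> []"
    proof
      assume "zs = []"
      with zs ne show False by simp
    qed
    \<comment> \<open>The position of the final 1 of the shorter tailed word; in the longer one,
      shifted by at least 1 and at most \<open>M\<close>, it falls among the zeros.\<close>
    define k where "k = length \<mu> + Suc M"
    have "(\<mu> @ ?u @ zs) ! k = 1" by (simp add: k_def nth_append)
    then have "(\<nu> @ ?u) ! k = 1" using zs by simp
    moreover have "length \<nu> \<le> k" "k - length \<nu> < Suc M" using le len \<open>zs \<noteq> []\<close> by (auto simp: k_def)
    then have "(\<nu> @ ?u) ! k = 0" by (simp add: nth_append del: replicate_Suc)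
    ultimately show False by simp
  qed
  with assms show ?thesis by (auto simp: parallel_def)
qed

lemma (in free_ideal) nwords_decode:
  assumes "pkeys q \<subseteq> {nword \<mu> \<nu> |\<mu> \<nu>. set \<mu> \<subseteq> I \<and> set \<nu> \<subseteq> I \<and> P \<nu>}"
  obtains m v where "\<And>w. w \<in> pkeys q \<Longrightarrow> w = nword (m w) (v w) \<and> set (m w) \<subseteq> I \<and> set (v w) \<subseteq> I \<and> P (v w)"
proof -
  have "\<forall>w\<in>pkeys q. \<exists>p. w = nword (fst p) (snd p) \<and> set (fst p) \<subseteq> I \<and> set (snd p) \<subseteq> I \<and> P (snd p)"
    using assms by fastforce
  from bchoice[OF this] obtain f where
    "\<forall>w\<in>pkeys q. w = nword (fst (f w)) (snd (f w)) \<and> set (fst (f w)) \<subseteq> I \<and> set (snd (f w)) \<subseteq> I \<and> P (snd (f w))"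
    by blast
  then show ?thesis by (intro that[of "\<lambda>w. fst (f w)" "\<lambda>w. snd (f w)"]) blast
qed

lemma ring_star_algebra_on_UNIV: "ring (star_algebra_on (UNIV :: 'a::complex_star_algebra set))"
proof (rule ringI)
  show "abelian_group (star_algebra_on (UNIV :: 'a set))"
  proof (rule abelian_groupI)
    fix p :: 'a
    show "\<exists>q\<in>carrier (star_algebra_on UNIV). q \<oplus>\<^bsub>star_algebra_on UNIV\<^esub> p = \<zero>\<^bsub>star_algebra_on UNIV\<^esub>"
      by (rule bexI[of _ "- p"]) (simp_all add: star_algebra_on_def)
  qed (simp_all add: star_algebra_on_def algebra_simps)
  show "Group.monoid (star_algebra_on (UNIV :: 'a set))"
    by (rule Group.monoidI) (simp_all add: star_algebra_on_def mult.assoc)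
qed (simp_all add: star_algebra_on_def algebra_simps)

lemma ideal_eval_kernel:
  "ideal {p \<in> fcarrier I. eval_poly S p = (0 :: 'a::complex_star_algebra)} (free_star_algebra I)"
proof -
  have "ring_hom_ring (free_star_algebra I) (star_algebra_on (UNIV :: 'a set)) (eval_poly S)"
    by (rule ring_hom_ringI2[OF ring_free_star_algebra ring_star_algebra_on_UNIV], rule ring_hom_memI)
       (simp_all add: free_star_algebra_simps(2-) eval_poly_mult eval_poly_add eval_poly_one star_algebra_on_def)
  from ring_hom_ring.kernel_is_ideal[OF this]
  show ?thesis by (simp add: a_kernel_def' star_algebra_on_def)
qed

context free_ideal begin

abbreviation (input) cs :: "free_poly \<Rightarrow> free_poly set"
  where "cs p \<equiv> J +>\<^bsub>free_star_algebra I\<^esub> p"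

abbreviation (input) "Q \<equiv> quotient_star_algebra (free_star_algebra I) J"

lemma quotient_carrier: "carrier Q = cs ` fcarrier I"
  unfolding quotient_star_algebra_def FactRing_def A_RCOSETS_def' by auto

lemma quotient_mult: "p \<in> fcarrier I \<Longrightarrow> q \<in> fcarrier I \<Longrightarrow> cs p \<otimes>\<^bsub>Q\<^esub> cs q = cs (p * q)"
  and quotient_add: "p \<in> fcarrier I \<Longrightarrow> q \<in> fcarrier I \<Longrightarrow> cs p \<oplus>\<^bsub>Q\<^esub> cs q = cs (p + q)"
  using ring_hom_mult[OF ideal.rcos_ring_hom[OF idl]] ring_hom_add[OF ideal.rcos_ring_hom[OF idl]]
  by (simp_all add: quotient_star_algebra_def free_star_algebra_simps(2-))

lemma quotient_one: "\<one>\<^bsub>Q\<^esub> = cs 1"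
  using ring_hom_one[OF ideal.rcos_ring_hom[OF idl]]
  by (simp add: quotient_star_algebra_def free_star_algebra_simps(2-))

end

locale leavitt_family = free_ideal I J + isometry_family I T
  for I J and T :: "nat \<Rightarrow> 'a::complex_star_algebra" +
  assumes J_kernel: "p \<in> J \<Longrightarrow> eval_poly TT p = 0"
begin

text \<open>With infinitely many generators some letter \<open>j\<close> occurs in no word of the
  reduced element and serves as tail. Taking \<open>w0\<close> with shortest Y-part ensures that no
  other Y-part is a proper prefix of it.\<close>

lemma kernel_eq_UNIV:
  assumes I: "I = UNIV" and p: "p \<in> fcarrier I" "eval_poly TT p = 0"
  shows "p \<in> J"
proof -
  obtain q where q: "pkeys q \<subseteq> nwords" "p - q \<in> J" using reduce[OF p(1)] by blast
  have eq: "eval_poly TT q = 0" using J_kernel[OF q(2)] p(2) by (simp add: eval_poly_diff)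
  have "q = 0"
  proof (rule ccontr)
    assume "q \<noteq> 0"
    then have ne: "pkeys q \<noteq> {}" by (simp add: keys_eq_empty)
    have "pkeys q \<subseteq> {nword \<mu> \<nu> |\<mu> \<nu>. set \<mu> \<subseteq> I \<and> set \<nu> \<subseteq> I \<and> True}" using q(1) by (simp add: nwords_def)
    then obtain m v where mv: "\<And>w. w \<in> pkeys q \<Longrightarrow> w = nword (m w) (v w) \<and> set (m w) \<subseteq> I \<and> set (v w) \<subseteq> I \<and> True"
      by (rule nwords_decode) blast
    obtain w0 where w0: "w0 \<in> pkeys q" "\<And>w. w \<in> pkeys q \<Longrightarrow> length (v w0) \<le> length (v w)"
    proof -
      obtain w1 where "w1 \<in> pkeys q" using ne by blast
      from ex_has_least_nat[of "\<lambda>w. w \<in> pkeys q", OF this, of "\<lambda>w. length (v w)"]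
      show ?thesis using that by blast
    qed
    have "finite (\<Union>w\<in>pkeys q. set (m w) \<union> set (v w))" by simp
    then obtain j where "j \<notin> (\<Union>w\<in>pkeys q. set (m w) \<union> set (v w))" using ex_new_if_finite infinite_UNIV_nat by blast
    then have j: "j \<notin> set (m w)" "j \<notin> set (v w)" if "w \<in> pkeys q" for w using that by auto
    have "eval_poly TT q \<noteq> 0"
    proof (rule separate[of q m v w0 "[j]"])
      fix w assume w: "w \<in> pkeys q"
      show "w = nword (m w) (v w) \<and> set (m w) \<subseteq> I \<and> set (v w) \<subseteq> I" using mv[OF w] by simp
      show "parallel (m w0 @ [j]) (m w @ [j])" if "m w \<noteq> m w0"
        by (rule parallel_append_fresh) (use j w w0 that in auto)
      show "parallel (v w) (v w0 @ [j])" if ne: "v w \<noteq> v w0"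
      proof -
        have "\<not> prefix (v w) (v w0 @ [j])"
        proof
          assume "prefix (v w) (v w0 @ [j])"
          then have "v w = v w0 @ [j] \<or> prefix (v w) (v w0)" by simp
          then show False
          proof
            assume "v w = v w0 @ [j]"
            with j(2)[OF w] show False by simp
          next
            assume "prefix (v w) (v w0)"
            then obtain zs where "v w0 = v w @ zs" by (auto simp: prefix_def)
            with w0(2)[OF w] ne show False by simp
          qed
        qed
        moreover have "\<not> prefix (v w0 @ [j]) (v w)" using j(2)[OF w] by (auto dest: set_mono_prefix)
        ultimately show ?thesis by (simp add: parallel_def)
      qed
    qed (use w0 I in auto)
    with eq show False by simp
  qed
  with q(2) show ?thesis by simp
qed

text \<open>A fresh letter may not exist here. Instead the relation
  \<open>\<Sum>\<^sub>j X\<^sub>j Y\<^sub>j = 1\<close> brings all Y-parts to one length, so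
  distinct ones are incomparable, and the tail of zeros followed by 1 separates the X-parts; it uses
  two letters, whence \<open>n \<ge> 2\<close>.\<close>

lemma kernel_eq_finite:
  assumes I: "I = {..<n}" and "n \<ge> 2" and rel: "(\<Sum>j<n. free_gen (LX j) * free_gen (LY j)) - 1 \<in> J"
    and p: "p \<in> fcarrier I" "eval_poly TT p = 0"
  shows "p \<in> J"
proof -
  obtain q L where q: "pkeys q \<subseteq> {nword \<mu> \<nu> |\<mu> \<nu>. set \<mu> \<subseteq> I \<and> set \<nu> \<subseteq> I \<and> length \<nu> = L}" "p - q \<in> J"
    using reduce_uniform[OF I rel p(1)] by blast
  have eq: "eval_poly TT q = 0" using J_kernel[OF q(2)] p(2) by (simp add: eval_poly_diff)
  have "q = 0"
  proof (rule ccontr)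
    assume "q \<noteq> 0"
    then obtain w0 where w0: "w0 \<in> pkeys q" by (metis ex_in_conv keys_eq_empty)
    obtain m v where mv: "\<And>w. w \<in> pkeys q \<Longrightarrow> w = nword (m w) (v w) \<and> set (m w) \<subseteq> I \<and> set (v w) \<subseteq> I \<and> length (v w) = L"
      using nwords_decode[OF q(1)] by blast
    define M where "M = Max ((\<lambda>w. length (m w)) ` pkeys q)"
    have M: "length (m w) \<le> M" if "w \<in> pkeys q" for w unfolding M_def by (rule Max_ge) (use that in auto)
    let ?u = "replicate (Suc M) 0 @ [1 :: nat]"
    have "eval_poly TT q \<noteq> 0"
    proof (rule separate[of q m v w0 ?u])
      show "set ?u \<subseteq> I" using I \<open>n \<ge> 2\<close> by auto
      fix w assume w: "w \<in> pkeys q"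
      show "w = nword (m w) (v w) \<and> set (m w) \<subseteq> I \<and> set (v w) \<subseteq> I" using mv[OF w] by simp
      show "parallel (m w0 @ ?u) (m w @ ?u)" if "m w \<noteq> m w0"
        by (rule parallel_append_zeros_one[OF M[OF w0] M[OF w]]) (use that in auto)
      show "parallel (v w) (v w0 @ ?u)" if ne: "v w \<noteq> v w0"
      proof -
        have len: "length (v w) = length (v w0)" using mv[OF w] mv[OF w0] by simp
        have "\<not> prefix (v w) (v w0 @ ?u)"
        proof
          assume "prefix (v w) (v w0 @ ?u)"
          then obtain zs where "v w0 @ ?u = v w @ zs" by (auto simp: prefix_def)
          with len have "v w0 = v w" by (simp add: append_eq_append_conv)
          with ne show False by simp
        qed
        moreover have "\<not> prefix (v w0 @ ?u) (v w)"
        proof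
          assume "prefix (v w0 @ ?u) (v w)"
          from prefix_length_le[OF this] len show False by simp
        qed
        ultimately show ?thesis by (simp add: parallel_def)
      qed
    qed (rule w0)
    with eq show False by simp
  qed
  with q(2) show ?thesis by simp
qed

text \<open>As \<open>J\<close> is the whole kernel of evaluation, cosets are equal exactly when
  their values are. So evaluating any representative gives an injective map, and the unions defining
  scalar multiples and stars in the quotient are single cosets.\<close>

lemma contains_quotient:
  assumes ker: "\<And>p. p \<in> fcarrier I \<Longrightarrow> eval_poly TT p = 0 \<Longrightarrow> p \<in> J"
  shows "contains_unital_star_subalgebra (star_algebra_on (UNIV :: 'a set))
    (quotient_star_algebra (free_star_algebra I) J)"
proof -
  let ?F = "free_star_algebra I"
  let ?Q = "Q"
  have self: "p \<in> cs p" for p by (simp add: coset J_zero)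
  have cs_eq: "cs p = cs q" if "p - q \<in> J" for p q
  proof -
    have "r - p \<in> J \<longleftrightarrow> r - q \<in> J" for r
      using J_add[OF _ that, of "r - p"] J_diff[OF _ that, of "r - q"] by auto
    then show ?thesis by (simp add: coset)
  qed
  have in_cos: "q \<in> fcarrier I" "eval_poly TT q = eval_poly TT p" if "p \<in> fcarrier I" "q \<in> cs p" for p q
  proof -
    have "q - p \<in> J" using that(2) by (simp add: coset)
    then have "(q - p) + p \<in> fcarrier I" using J_carrier that(1) by (intro fcarrier_add) auto
    then show "q \<in> fcarrier I" by simp
    show "eval_poly TT q = eval_poly TT p" using J_kernel[OF \<open>q - p \<in> J\<close>] by (simp add: eval_poly_diff)
  qed
  have cs_eq_eval: "cs p = cs q" if "p \<in> fcarrier I" "q \<in> fcarrier I" "eval_poly TT p = eval_poly TT q" for p q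
    by (rule cs_eq, rule ker) (use that in \<open>auto simp: eval_poly_diff intro: fcarrier_diff\<close>)
  define h where "h C = eval_poly TT (SOME p. p \<in> C)" for C
  have h: "h (cs p) = eval_poly TT p" if "p \<in> fcarrier I" for p
  proof -
    have "(SOME q. q \<in> cs p) \<in> cs p" by (rule someI[of _ p]) (rule self)
    from in_cos(2)[OF that this] show ?thesis by (simp add: h_def)
  qed
  have quotient_scal: "scal ?Q c (cs p) = cs (psingle 0 c * p)" if p: "p \<in> fcarrier I" for c p
  proof -
    have "cs (psingle 0 c * q) = cs (psingle 0 c * p)" if "q \<in> cs p" for q
      by (rule cs_eq_eval)
         (use p in_cos[OF p that] in \<open>simp_all add: eval_poly_scal fcarrier_mult fcarrier_single word_over_zero\<close>)
    then have "(\<Union>q\<in>cs p. cs (psingle 0 c * q)) = cs (psingle 0 c * p)" using self[of p] by blast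
    then show ?thesis by (simp add: quotient_star_algebra_def free_star_algebra_simps(6))
  qed
  have quotient_star: "star ?Q (cs p) = cs (poly_star p)" if p: "p \<in> fcarrier I" for p
  proof -
    have "cs (poly_star q) = cs (poly_star p)" if "q \<in> cs p" for q
      by (rule cs_eq_eval)
         (use p in_cos[OF p that] in \<open>simp_all add: eval_poly_star[of TT, OF TT_star] fcarrier_star\<close>)
    then have "(\<Union>q\<in>cs p. cs (poly_star q)) = cs (poly_star p)" using self[of p] by blast
    then show ?thesis by (simp add: quotient_star_algebra_def free_star_algebra_simps(7))
  qed
  have "h \<in> star_hom ?Q (star_algebra_on (UNIV :: 'a set))"
    unfolding star_hom_def mem_Collect_eq quotient_carrier
  proof (intro conjI ballI allI)
    show "h \<in> cs ` fcarrier I \<rightarrow> carrier (star_algebra_on UNIV)" by (simp add: star_algebra_on_def)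
    fix x assume "x \<in> cs ` fcarrier I"
    then obtain p where p: "p \<in> fcarrier I" "x = cs p" by blast
    show "h (scal ?Q c x) = scal (star_algebra_on UNIV) c (h x)" for c
      by (simp add: p quotient_scal h fcarrier_mult fcarrier_single word_over_zero eval_poly_scal star_algebra_on_def)
    show "h (star ?Q x) = star (star_algebra_on UNIV) (h x)"
      by (simp add: p quotient_star h fcarrier_star eval_poly_star[of TT, OF TT_star] star_algebra_on_def)
    fix y assume "y \<in> cs ` fcarrier I"
    then obtain q where q: "q \<in> fcarrier I" "y = cs q" by blast
    show "h (x \<oplus>\<^bsub>?Q\<^esub> y) = h x \<oplus>\<^bsub>star_algebra_on UNIV\<^esub> h y"
      by (simp add: p q quotient_add h fcarrier_add eval_poly_add star_algebra_on_def)
    show "h (x \<otimes>\<^bsub>?Q\<^esub> y) = h x \<otimes>\<^bsub>star_algebra_on UNIV\<^esub> h y"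
      by (simp add: p q quotient_mult h fcarrier_mult eval_poly_mult star_algebra_on_def)
  qed
  moreover have "h \<one>\<^bsub>?Q\<^esub> = \<one>\<^bsub>star_algebra_on (UNIV :: 'a set)\<^esub>"
    by (simp add: quotient_one h fcarrier_one eval_poly_one star_algebra_on_def)
  moreover have "inj_on h (carrier ?Q)"
    unfolding quotient_carrier
  proof (rule inj_onI)
    fix x y assume xy: "x \<in> cs ` fcarrier I" "y \<in> cs ` fcarrier I" "h x = h y"
    then obtain p q where "p \<in> fcarrier I" "x = cs p" "q \<in> fcarrier I" "y = cs q" by blast
    with xy(3) show "x = y" using cs_eq_eval[of p q] by (simp add: h)
  qed
  ultimately show ?thesis unfolding contains_unital_star_subalgebra_def by blast
qed

end

text \<open>The images of the generators satisfy the defining relations; this is what contradicts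
  the rank condition.\<close>

lemma (in free_ideal) contains_quotientD:
  assumes "contains_unital_star_subalgebra (star_algebra_on (UNIV :: 'a::complex_star_algebra set))
    (quotient_star_algebra (free_star_algebra I) J)"
  obtains X Y :: "nat \<Rightarrow> 'a::complex_star_algebra" where "\<And>i j. i \<in> I \<Longrightarrow> j \<in> I \<Longrightarrow> Y i * X j = (if i = j then 1 else 0)"
proof -
  let ?F = "free_star_algebra I"
  let ?Q = "Q"
  obtain h :: "free_poly set \<Rightarrow> 'a" where h: "h \<in> star_hom ?Q (star_algebra_on UNIV)" "h \<one>\<^bsub>?Q\<^esub> = 1"
    using assms unfolding contains_unital_star_subalgebra_def by (auto simp: star_algebra_on_def)
  have hm: "h (cs (p * q)) = h (cs p) * h (cs q)" and ha: "h (cs (p + q)) = h (cs p) + h (cs q)"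
    if p: "p \<in> fcarrier I" "q \<in> fcarrier I" for p q
  proof -
    have "cs p \<in> carrier ?Q" "cs q \<in> carrier ?Q" using p quotient_carrier by auto
    then have "h (cs p \<otimes>\<^bsub>?Q\<^esub> cs q) = h (cs p) * h (cs q)" "h (cs p \<oplus>\<^bsub>?Q\<^esub> cs q) = h (cs p) + h (cs q)"
      using h(1) by (simp_all add: star_hom_def star_algebra_on_def)
    then show "h (cs (p * q)) = h (cs p) * h (cs q)" "h (cs (p + q)) = h (cs p) + h (cs q)"
      by (simp_all add: quotient_mult[OF p] quotient_add[OF p])
  qed
  have h0: "h (cs 0) = 0" using ha[OF fcarrier_zero fcarrier_zero] by simp
  show ?thesis
  proof (rule that[of "\<lambda>i. h (cs (free_gen (LY i)))" "\<lambda>j. h (cs (free_gen (LX j)))"])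
    fix i j assume ij: "i \<in> I" "j \<in> I"
    let ?r = "if i = j then 1 else 0 :: free_poly" and ?q = "free_gen (LY i) * free_gen (LX j) :: free_poly"
    have "?q - ?r \<in> J" using orth ij unfolding leavitt_orthogonality_def by blast
    then have "h (cs (?q - ?r)) = h (cs 0)"
    proof -
      assume r: "?q - ?r \<in> J"
      have "p - (?q - ?r) \<in> J \<longleftrightarrow> p - 0 \<in> J" for p
        using J_add[OF _ r, of "p - (?q - ?r)"] J_diff[OF _ r, of p] by auto
      then show ?thesis unfolding coset by simp
    qed
    moreover have c: "?q - ?r \<in> fcarrier I" "?r \<in> fcarrier I"
      using ij by (auto intro!: fcarrier_diff fcarrier_mult fcarrier_gen fcarrier_one fcarrier_zero)
    ultimately have "h (cs ?q) = h (cs ?r)" using ha[OF c] h0 by simp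
    moreover have "h (cs ?r) = (if i = j then 1 else 0)" using h(2) h0 by (simp add: quotient_one)
    ultimately show "h (cs (free_gen (LY i))) * h (cs (free_gen (LX j))) = (if i = j then 1 else 0)"
      using hm[OF fcarrier_gen(2)[OF ij(1)] fcarrier_gen(1)[OF ij(2)]] by simp
  qed
qed

section \<open>Leavitt algebras inside an algebra with an isometry pair\<close>

context isometry_pair begin

text \<open>Common powers of \<open>s\<close> cancel, and a leftover \<open>s\<close> meets
  \<open>t\<close> with orthogonal range. These are the standard generators of O_infinity inside
  O_2.\<close>

lemma pow_orthonormal: "adj (s ^ i * t) * (s ^ j * t) = (if i = j then 1 else 0)"
proof (induction i j rule: diff_induct)
  case (1 i)
  show ?case
  proof (cases i)
    case (Suc i')
    have "adj (s ^ i * t) * (s ^ 0 * t) = adj (s ^ i' * t) * (adj s * t)"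
      by (simp add: Suc adj_mult mult.assoc)
    then show ?thesis by (simp add: st Suc)
  qed (simp add: tt)
next
  case (2 j)
  have "adj (s ^ 0 * t) * (s ^ Suc j * t) = (adj t * s) * (s ^ j * t)" by (simp add: mult.assoc)
  then show ?case by (simp add: ts)
next
  case (3 i j)
  have "adj (s ^ Suc i * t) * (s ^ Suc j * t) = adj (s ^ i * t) * ((adj s * s) * (s ^ j * t))"
    by (simp add: adj_mult mult.assoc)
  then show ?case using 3 by (simp add: ss)
qed

lemma pow_isometry: "adj (s ^ m) * s ^ m = 1"
proof (induction m)
  case (Suc m)
  have "adj (s ^ Suc m) * s ^ Suc m = adj (s ^ m) * ((adj s * s) * s ^ m)"
    by (simp add: adj_mult mult.assoc)
  then show ?case using Suc by (simp add: ss)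
qed (simp add: adj_one)

lemma pow_orthogonal: "i < m \<Longrightarrow> adj (s ^ i * t) * s ^ m = 0"
proof (induction i arbitrary: m)
  case 0
  then obtain m' where "m = Suc m'" by (cases m) auto
  then have "adj (s ^ 0 * t) * s ^ m = (adj t * s) * s ^ m'" by (simp add: mult.assoc)
  then show ?case by (simp add: ts)
next
  case (Suc i)
  then obtain m' where m: "m = Suc m'" "i < m'" by (cases m) auto
  then have "adj (s ^ Suc i * t) * s ^ m = adj (s ^ i * t) * ((adj s * s) * s ^ m')"
    by (simp add: adj_mult mult.assoc)
  then show ?case using Suc.IH[OF m(2)] by (simp add: ss)
qed

text \<open>The \<open>m + 1\<close> elements \<open>t, s t, ..., s ^ (m - 1) * t, s ^ m\<close> are
  the usual generators of the Cuntz algebra O_(m+1) inside O_2.\<close>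

definition iso_family :: "nat \<Rightarrow> nat \<Rightarrow> 'a"
  where "iso_family m i = (if i < m then s ^ i * t else s ^ m)"

lemma iso_family_orthonormal:
  assumes "i \<le> m" "j \<le> m"
  shows "adj (iso_family m i) * iso_family m j = (if i = j then 1 else 0)"
proof -
  consider "i < m" "j < m" | "i < m" "j = m" | "i = m" "j < m" | "i = m" "j = m" using assms by linarith
  then show ?thesis
  proof cases
    case 3
    have "adj (iso_family m i) * iso_family m j = adj (adj (s ^ j * t) * s ^ m)"
      using 3 by (simp add: iso_family_def adj_mult adj_adj)
    then show ?thesis using 3 pow_orthogonal[of j m] by (simp add: adj_zero)
  qed (simp_all add: iso_family_def pow_orthonormal pow_isometry pow_orthogonal)
qed

text \<open>Passing from \<open>m\<close> to \<open>m + 1\<close> splits the range projection of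
  \<open>s ^ m\<close> into those of \<open>s ^ m * t\<close> and \<open>s ^ Suc m\<close>.\<close>

lemma iso_family_complete: "(\<Sum>j<Suc m. iso_family m j * adj (iso_family m j)) = 1"
proof -
  have "(\<Sum>j<m. (s ^ j * t) * adj (s ^ j * t)) + s ^ m * adj (s ^ m) = 1"
  proof (induction m)
    case (Suc m)
    have "s ^ Suc m = s ^ m * s" by (rule power_Suc2)
    then have "(s ^ m * t) * adj (s ^ m * t) + s ^ Suc m * adj (s ^ Suc m) = s ^ m * (s * adj s + t * adj t) * adj (s ^ m)"
      by (simp only: adj_mult) (simp add: distrib_left distrib_right mult.assoc)
    then show ?case using Suc by (simp add: complete add.assoc)
  qed (simp add: adj_one)
  then show ?thesis by (simp add: iso_family_def)
qed

text \<open>The generating relations hold for the isometry family, so the ideal lies in the kernel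
  of evaluation; \<open>kernel_eq_finite\<close> gives the converse.\<close>

lemma contains_leavitt:
  assumes "n \<ge> 2"
  shows "contains_unital_star_subalgebra (star_algebra_on (UNIV :: 'a set)) (leavitt_algebra n)"
proof -
  obtain m where n: "n = Suc m" using assms by (cases n) auto
  let ?F = "free_star_algebra {..<n}"
  let ?rel = "(\<Sum>j<n. free_gen (LX j) * free_gen (LY j)) - 1 :: free_poly"
  let ?G = "insert ?rel (leavitt_orthogonality {..<n})"
  define J where "J = genideal ?F ?G"
  have G: "?G \<subseteq> fcarrier {..<n}"
    using leavitt_orthogonality_subset
    by (auto intro!: fcarrier_diff fcarrier_sum fcarrier_mult fcarrier_gen fcarrier_one)
  have GJ: "?G \<subseteq> J" unfolding J_def by (rule ring.genideal_self[OF ring_free_star_algebra G])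
  interpret T: isometry_family "{..<n}" "iso_family m"
    by standard (simp add: iso_family_orthonormal n)
  have "eval_poly T.TT p = 0" if "p \<in> ?G" for p
  proof (cases "p = ?rel")
    case True
    then show ?thesis
      using iso_family_complete[of m]
      by (simp add: eval_poly_diff eval_poly_add eval_poly_sum eval_poly_mult eval_poly_gen eval_poly_one T.TT_def n)
  next
    case False
    then obtain i j where "i < n" "j < n" "p = free_gen (LY i) * free_gen (LX j) - (if i = j then 1 else 0)"
      using \<open>p \<in> ?G\<close> by (auto simp: leavitt_orthogonality_def)
    then show ?thesis
      using T.orthonormal[of i j]
      by (simp add: eval_poly_diff eval_poly_mult eval_poly_gen eval_poly_one eval_poly_zero T.TT_def)
  qed
  then have "J \<subseteq> {p \<in> fcarrier {..<n}. eval_poly T.TT p = 0}"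
    unfolding J_def using G
    by (intro ring.genideal_minimal[OF ring_free_star_algebra ideal_eval_kernel]) auto
  then have ker: "eval_poly T.TT p = 0" if "p \<in> J" for p using that by blast
  have "ideal J ?F" unfolding J_def by (rule ring.genideal_ideal[OF ring_free_star_algebra G])
  moreover have "leavitt_orthogonality {..<n} \<subseteq> J" using GJ by blast
  ultimately interpret leavitt_family "{..<n}" J "iso_family m"
    by (intro leavitt_family.intro free_ideal.intro T.isometry_family_axioms leavitt_family_axioms.intro ker)
  have "contains_unital_star_subalgebra (star_algebra_on (UNIV :: 'a set)) (quotient_star_algebra ?F J)"
    by (rule contains_quotient) (use GJ in \<open>auto intro: kernel_eq_finite[OF refl assms]\<close>)
  then show ?thesis by (simp add: leavitt_algebra_def J_def Let_def)
qed

lemma contains_leavitt_infinity: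
  "contains_unital_star_subalgebra (star_algebra_on (UNIV :: 'a set)) leavitt_algebra_infinity"
proof -
  let ?F = "free_star_algebra UNIV"
  let ?G = "leavitt_orthogonality UNIV"
  define J where "J = genideal ?F ?G"
  have G: "?G \<subseteq> fcarrier UNIV" by (rule leavitt_orthogonality_subset)
  have GJ: "?G \<subseteq> J" unfolding J_def by (rule ring.genideal_self[OF ring_free_star_algebra G])
  interpret T: isometry_family UNIV "\<lambda>i. s ^ i * t"
    by standard (rule pow_orthonormal)
  have "eval_poly T.TT p = 0" if "p \<in> ?G" for p
  proof -
    obtain i j where "p = free_gen (LY i) * free_gen (LX j) - (if i = j then 1 else 0)"
      using \<open>p \<in> ?G\<close> by (auto simp: leavitt_orthogonality_def)
    then show ?thesis
      using T.orthonormal[of i j]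
      by (simp add: eval_poly_diff eval_poly_mult eval_poly_gen eval_poly_one eval_poly_zero T.TT_def)
  qed
  then have "J \<subseteq> {p \<in> fcarrier UNIV. eval_poly T.TT p = 0}"
    unfolding J_def using G
    by (intro ring.genideal_minimal[OF ring_free_star_algebra ideal_eval_kernel]) auto
  then have ker: "eval_poly T.TT p = 0" if "p \<in> J" for p using that by blast
  have "ideal J ?F" unfolding J_def by (rule ring.genideal_ideal[OF ring_free_star_algebra G])
  moreover have "leavitt_orthogonality UNIV \<subseteq> J" using GJ by blast
  ultimately interpret leavitt_family UNIV J "\<lambda>i. s ^ i * t"
    by (intro leavitt_family.intro free_ideal.intro T.isometry_family_axioms leavitt_family_axioms.intro ker)
  have "contains_unital_star_subalgebra (star_algebra_on (UNIV :: 'a set)) (quotient_star_algebra ?F J)"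
    by (rule contains_quotient) (rule kernel_eq_UNIV[OF refl])
  then show ?thesis by (simp add: leavitt_algebra_infinity_def J_def Let_def)
qed

end

section \<open>Exclusion of Leavitt algebras by the rank condition\<close>

context roe_rep begin

text \<open>Two such elements form a 1 x 2 matrix with a left inverse.\<close>

lemma amenable_imp_no_orthonormal_pair:
  fixes X Y :: "nat \<Rightarrow> 'a"
  assumes "amenable_metric d" and "\<And>i j. i < 2 \<Longrightarrow> j < 2 \<Longrightarrow> Y i * X j = (if i = j then 1 else 0)"
  shows False
  by (rule rank_condition[OF assms(1), of 1 2 "\<lambda>i _. Y i" "\<lambda>_ j. X j"]) (use assms(2) in auto)

lemma amenable_imp_not_contains_leavitt:
  assumes am: "amenable_metric d" and "n \<ge> 2"
  shows "\<not> contains_unital_star_subalgebra (star_algebra_on (UNIV :: 'a set)) (leavitt_algebra n)"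
proof
  let ?F = "free_star_algebra {..<n}"
  let ?G = "insert ((\<Sum>j<n. free_gen (LX j) * free_gen (LY j)) - 1 :: free_poly) (leavitt_orthogonality {..<n})"
  have G: "?G \<subseteq> fcarrier {..<n}"
    using leavitt_orthogonality_subset
    by (auto intro!: fcarrier_diff fcarrier_sum fcarrier_mult fcarrier_gen fcarrier_one)
  interpret free_ideal "{..<n}" "genideal ?F ?G"
    by (rule free_ideal.intro[OF ring.genideal_ideal[OF ring_free_star_algebra G]])
       (use ring.genideal_self[OF ring_free_star_algebra G] in blast)
  assume "contains_unital_star_subalgebra (star_algebra_on (UNIV :: 'a set)) (leavitt_algebra n)"
  then have "contains_unital_star_subalgebra (star_algebra_on (UNIV :: 'a set))
      (quotient_star_algebra ?F (genideal ?F ?G))" by (simp only: leavitt_algebra_def Let_def)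
  then show False
  proof (rule contains_quotientD)
    fix X Y :: "nat \<Rightarrow> 'a"
    assume "\<And>i j. i \<in> {..<n} \<Longrightarrow> j \<in> {..<n} \<Longrightarrow> Y i * X j = (if i = j then 1 else 0)"
    then have "Y i * X j = (if i = j then 1 else 0)" if "i < 2" "j < 2" for i j using that \<open>n \<ge> 2\<close> by simp
    then show False by (rule amenable_imp_no_orthonormal_pair[OF am])
  qed
qed

lemma amenable_imp_not_contains_leavitt_infinity:
  assumes am: "amenable_metric d"
  shows "\<not> contains_unital_star_subalgebra (star_algebra_on (UNIV :: 'a set)) leavitt_algebra_infinity"
proof
  let ?F = "free_star_algebra UNIV"
  let ?G = "leavitt_orthogonality UNIV"
  have G: "?G \<subseteq> fcarrier UNIV" by (rule leavitt_orthogonality_subset)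
  interpret free_ideal UNIV "genideal ?F ?G"
    by (rule free_ideal.intro[OF ring.genideal_ideal[OF ring_free_star_algebra G]])
       (use ring.genideal_self[OF ring_free_star_algebra G] in blast)
  assume "contains_unital_star_subalgebra (star_algebra_on (UNIV :: 'a set)) leavitt_algebra_infinity"
  then have "contains_unital_star_subalgebra (star_algebra_on (UNIV :: 'a set))
      (quotient_star_algebra ?F (genideal ?F ?G))" by (simp only: leavitt_algebra_infinity_def Let_def)
  then show False
  proof (rule contains_quotientD)
    fix X Y :: "nat \<Rightarrow> 'a"
    assume "\<And>i j. i \<in> UNIV \<Longrightarrow> j \<in> UNIV \<Longrightarrow> Y i * X j = (if i = j then 1 else 0)"
    then have "Y i * X j = (if i = j then 1 else 0)" for i j by simp
    then show False by (rule amenable_imp_no_orthonormal_pair[OF am])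
  qed
qed

end

theorem theorem2:
  fixes d :: "'x \<Rightarrow> 'x \<Rightarrow> ennreal"
    and \<iota> :: "'x ell2_op \<Rightarrow> 'a::pre_cstar_algebra"
    and k n :: nat
  assumes "extended_metric d"
    and "bounded_geometry d"
    and "\<iota> \<in> star_hom (star_algebra_on (translation_algebra d)) (star_algebra_on (UNIV :: 'a set))"
    and "inj_on \<iota> (translation_algebra d)"
    and "closure (\<iota> ` translation_algebra d) = (UNIV :: 'a set)"
    and "k \<ge> 1"
    and "n \<ge> 2"
  shows "(amenable_metric d \<longleftrightarrow> algebraically_amenable (algebraic_uniform_roe_algebra d)) \<and>
    (amenable_metric d \<longleftrightarrow> folner_pre_cstar_algebra TYPE('a)) \<and>
    (amenable_metric d \<longleftrightarrow> (\<exists>\<tau> :: 'a \<Rightarrow> complex. tracial_state \<tau>)) \<and>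
    (amenable_metric d \<longleftrightarrow> \<not> properly_infinite (ring_mat TYPE('a) k ())) \<and>
    (amenable_metric d \<longleftrightarrow>
      \<not> contains_unital_star_subalgebra (star_algebra_on (UNIV :: 'a set)) (leavitt_algebra n)) \<and>
    (amenable_metric d \<longleftrightarrow>
      \<not> contains_unital_star_subalgebra (star_algebra_on (UNIV :: 'a set)) leavitt_algebra_infinity) \<and>
    (amenable_metric d \<longleftrightarrow> K0_class (1 :: 'a) \<noteq> K0_class (0 :: 'a))"
proof -
  interpret bdd_geometry d by (rule bdd_geometry.intro[OF assms(1,2)])
  interpret roe_rep d \<iota> by unfold_locales (fact assms(3-5))+
  show ?thesis
  proof (cases "amenable_metric d")
    case True
    then show ?thesis
      using amenable_imp_algebraically_amenable amenable_imp_folner amenable_imp_tracial_state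
        amenable_imp_not_properly_infinite[OF _ assms(6)] amenable_imp_not_contains_leavitt[OF _ assms(7)]
        amenable_imp_not_contains_leavitt_infinity amenable_imp_K0_class_one
      by simp
  next
    case False
    then obtain s t :: 'a where "isometry_pair s t" by (rule nonamenable_isometry_pair)
    then interpret isometry_pair s t .
    show ?thesis
      using False nonamenable_imp_not_algebraically_amenable not_folner no_tracial_state
        properly_infinite_mat[OF assms(6)] contains_leavitt[OF assms(7)] contains_leavitt_infinity K0_class_one
      by simp
  qed
qed

end
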